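(* Let $N\ge1$ and let $\mathbf U^N_0$ be an $\mathbb R^N_0$-valued, $\mathcal F_0$-measurable random variable. The stochastic differential equation $$\mathrm d\mathbf U^N(t)=-\mathbf D^{(1,-)}_N\overline{\mathbf A}^N(\mathbf U^N(t))\,\mathrm dt+\nu\mathbf D^{(2)}_N\mathbf U^N(t)\,\mathrm dt+\mathrm d\mathbf W^{Q,N}(t)$$ admits a unique strong solution $(\mathbf U^N(t))_{t\ge0}$ taking values in $\mathbb R^N_0$ and with initial condition $\mathbf U^N_0$.
   Context: $\mathbb N^*=\{1,2,\dots\}$, $\mathbb T=\mathbb R/\mathbb Z$ identified with $(0,1]$. $L^2_0(\mathbb T)$ is the set of $v\in L^2(\mathbb T)$ with $\int_{\mathbb T}v=0$; $H^2_0(\mathbb T)=L^2_0(\mathbb T)\cap H^2(\mathbb T)$ with norm $\|v\|_{H^2_0(\mathbb T)}=\|\partial_x^2v\|_{L^2(\mathbb T)}$. Assumptions. $\nu>0$. The function $A:\mathbb R\to\mathbb R$ is $C^2$, $A''$ is locally Lipschitz, and there are $\mathsf C_A>0$, $\mathsf p_A\in\mathbb N^*$ with $|A'(v)|\le\mathsf C_A(1+|v|^{\mathsf p_A})$ for all $v\in\mathbb R$. For all $k\ge1$, $g^k\in H^2_0(\mathbb T)$, and $\mathsf D:=\sum_{k\ge1}\|g^k\|^2_{H^2_0(\mathbb T)}<+\infty$. $(W^k)_{k\ge1}$ are independent real Brownian motions on a probability space $(\Omega,\mathcal F,\mathbb P)$ with respect to a normal filtration $(\mathcal F_t)_{t\ge0}$.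 The function $\overline A:\mathbb R^2\to\mathbb R$ is $C^1$, its partial derivatives are locally Lipschitz on $\mathbb R^2$, and: $\overline A(v,v)=A(v)$ for all $v$; $\partial_1\overline A(v,w)\ge0$ and $\partial_2\overline A(v,w)\le0$ for all $v,w$; there are $\mathsf C_{\bar A}>0$, $\mathsf p_{\bar A}\in\mathbb N^*$ with $|\partial_1\overline A(v,w)|\le\mathsf C_{\bar A}(1+|v|^{\mathsf p_{\bar A}})$ and $|\partial_2\overline A(v,w)|\le\mathsf C_{\bar A}(1+|w|^{\mathsf p_{\bar A}})$ for all $v,w\in\mathbb R$. Discretisation. $\mathbb T_N=\mathbb Z/N\mathbb Z$ (identified with $\{1,\dots,N\}$, indices modulo $N$), $x_i=i/N$, $\mathbb R^N_0=\{\mathbf v\in\mathbb R^N:v_1+\dots+v_N=0\}$. $(\Pi_Nv)_i=N\int_{x_{i-1}}^{x_i}v(x)\,\mathrm dx$. $(\mathbf D^{(1,+)}_N\mathbf v)_i=N(v_{i+1}-v_i)$, $(\mathbf D^{(1,-)}_N\mathbf v)_i=N(v_i-v_{i-1})$, $\mathbf D^{(2)}_N=\mathbf D^{(1,-)}_N\mathbf D^{(1,+)}_N$. $\overline{\mathbf A}^N(\mathbf v)$ is the vector with coordinates $\overline A(v_i,v_{i+1})$, $i\in\mathbb T_N$. $\mathbf g^k=\Pi_Ng^k$ and $\mathbf W^{Q,N}=\sum_{k\ge1}\mathbf g^kW^k$. *)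

theory Defs
  imports "HOL-Probability.Probability"
begin

section \<open>Function spaces on the torus\<close>

text \<open>The torus is identified with the interval (0,1]. Elements of L2 are represented by functions
  on the reals, of which only the values on (0,1] matter; test functions are 1-periodic on the
  reals, so the weak derivatives below are those on the torus, with no boundary terms.\<close>

abbreviation torus :: "real measure" where
  "torus \<equiv> restrict_space lborel {0<..1}"

definition L2_torus :: "(real \<Rightarrow> real) set" where
  "L2_torus = {v. v \<in> borel_measurable torus \<and> integrable torus (\<lambda>x. (v x)\<^sup>2)}"

definition L2_norm_torus :: "(real \<Rightarrow> real) \<Rightarrow> real" where
  "L2_norm_torus v = sqrt (LINT x|torus. (v x)\<^sup>2)"

definition test_function :: "(real \<Rightarrow> real) \<Rightarrow> bool" where
  "test_function \<phi> \<longleftrightarrow>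
     (\<forall>n x. (deriv ^^ n) \<phi> differentiable (at x)) \<and> (\<forall>x. \<phi> (x + 1) = \<phi> x)"

definition has_weak_deriv :: "nat \<Rightarrow> (real \<Rightarrow> real) \<Rightarrow> (real \<Rightarrow> real) \<Rightarrow> bool" where
  "has_weak_deriv n v w \<longleftrightarrow>
     (\<forall>\<phi>. test_function \<phi> \<longrightarrow>
        (LINT x|torus. v x * (deriv ^^ n) \<phi> x) = (-1) ^ n * (LINT x|torus. w x * \<phi> x))"

definition H2_torus :: "(real \<Rightarrow> real) set" where
  "H2_torus = {v \<in> L2_torus. \<forall>j\<in>{1, 2}. \<exists>w\<in>L2_torus. has_weak_deriv j v w}"

definition L20_torus :: "(real \<Rightarrow> real) set" where
  "L20_torus = {v \<in> L2_torus. (LINT x|torus. v x) = 0}"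

definition H20_torus :: "(real \<Rightarrow> real) set" where
  "H20_torus = L20_torus \<inter> H2_torus"

text \<open>The weak derivative is only determined almost everywhere, hence the choice operator.\<close>

definition weak_deriv :: "nat \<Rightarrow> (real \<Rightarrow> real) \<Rightarrow> real \<Rightarrow> real" where
  "weak_deriv n v = (SOME w. w \<in> L2_torus \<and> has_weak_deriv n v w)"

definition H20_norm :: "(real \<Rightarrow> real) \<Rightarrow> real" where
  "H20_norm v = L2_norm_torus (weak_deriv 2 v)"


section \<open>Regularity of the flux functions\<close>

text \<open>The time-dependent library notion, applied to a family that is constant in time.\<close>

definition locally_lipschitz :: "('a::metric_space \<Rightarrow> 'b::metric_space) \<Rightarrow> bool" where
  "locally_lipschitz f \<longleftrightarrow> local_lipschitz (UNIV :: real set) UNIV (\<lambda>_. f)"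

definition C2_real :: "(real \<Rightarrow> real) \<Rightarrow> bool" where
  "C2_real f \<longleftrightarrow> (\<forall>x. f differentiable (at x)) \<and> (\<forall>x. deriv f differentiable (at x)) \<and>
     continuous_on UNIV (deriv (deriv f))"

definition partial1 :: "(real \<times> real \<Rightarrow> real) \<Rightarrow> real \<times> real \<Rightarrow> real" where
  "partial1 f p = deriv (\<lambda>v. f (v, snd p)) (fst p)"

definition partial2 :: "(real \<times> real \<Rightarrow> real) \<Rightarrow> real \<times> real \<Rightarrow> real" where
  "partial2 f p = deriv (\<lambda>w. f (fst p, w)) (snd p)"

definition C1_real2 :: "(real \<times> real \<Rightarrow> real) \<Rightarrow> bool" where
  "C1_real2 f \<longleftrightarrow> (\<forall>p. f differentiable (at p)) \<and>
     continuous_on UNIV (partial1 f) \<and> continuous_on UNIV (partial2 f)"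


section \<open>Filtrations and Brownian motions\<close>

text \<open>Time is real, and only nonnegative times are meaningful. Of each \<open>F t\<close> only the space and
  the sigma-algebra are used.\<close>

definition normal_filtration :: "'w measure \<Rightarrow> (real \<Rightarrow> 'w measure) \<Rightarrow> bool" where
  "normal_filtration M F \<longleftrightarrow>
     (\<forall>t\<ge>0. subalgebra M (F t)) \<and>
     (\<forall>s t. 0 \<le> s \<and> s \<le> t \<longrightarrow> sets (F s) \<subseteq> sets (F t)) \<and>
     null_sets M \<subseteq> sets (F 0) \<and>
     (\<forall>t\<ge>0. sets (F t) = (\<Inter>s\<in>{t<..}. sets (F s)))"

definition brownian_motion ::
  "'w measure \<Rightarrow> (real \<Rightarrow> 'w measure) \<Rightarrow> (real \<Rightarrow> 'w \<Rightarrow> real) \<Rightarrow> bool" where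
  "brownian_motion M F B \<longleftrightarrow>
     (\<forall>t\<ge>0. B t \<in> borel_measurable (F t)) \<and>
     (AE \<omega> in M. B 0 \<omega> = 0) \<and>
     (AE \<omega> in M. continuous_on {0..} (\<lambda>t. B t \<omega>)) \<and>
     (\<forall>s t. 0 \<le> s \<and> s < t \<longrightarrow>
        distributed M lborel (\<lambda>\<omega>. B t \<omega> - B s \<omega>) (normal_density 0 (sqrt (t - s))) \<and>
        prob_space.indep_set M (sets (F s))
          {(\<lambda>\<omega>. B t \<omega> - B s \<omega>) -` S \<inter> space M | S. S \<in> sets borel})"

definition independent_processes ::
  "'w measure \<Rightarrow> 'k set \<Rightarrow> ('k \<Rightarrow> real \<Rightarrow> 'w \<Rightarrow> real) \<Rightarrow> bool" where
  "independent_processes M K X \<longleftrightarrow>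
     prob_space.indep_vars M (\<lambda>_. PiM {0..} (\<lambda>_. borel)) (\<lambda>k \<omega>. \<lambda>t\<in>{0..}. X k t \<omega>) K"


section \<open>The discretised equation\<close>

text \<open>A vector of dimension \<open>N\<close> is an extensional function on \<open>{1..N}\<close>, and the state space is
  \<open>PiM {1..N} (\<lambda>_. borel)\<close>. The functions \<open>succ_mod\<close> and \<open>pred_mod\<close> are the shifts
  of indices modulo \<open>N\<close>.\<close>

abbreviation RN :: "nat \<Rightarrow> (nat \<Rightarrow> real) measure" where
  "RN N \<equiv> PiM {1..N} (\<lambda>_. borel)"

definition RN0 :: "nat \<Rightarrow> (nat \<Rightarrow> real) set" where
  "RN0 N = {v \<in> {1..N} \<rightarrow>\<^sub>E UNIV. (\<Sum>i=1..N. v i) = 0}"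

definition succ_mod :: "nat \<Rightarrow> nat \<Rightarrow> nat" where
  "succ_mod N i = (if i = N then 1 else i + 1)"

definition pred_mod :: "nat \<Rightarrow> nat \<Rightarrow> nat" where
  "pred_mod N i = (if i = 1 then N else i - 1)"

definition cell_avg :: "nat \<Rightarrow> (real \<Rightarrow> real) \<Rightarrow> nat \<Rightarrow> real" where
  "cell_avg N v = (\<lambda>i\<in>{1..N}.
     real N * (LINT x:{(real i - 1) / real N <.. real i / real N}|lborel. v x))"

definition D1_plus :: "nat \<Rightarrow> (nat \<Rightarrow> real) \<Rightarrow> nat \<Rightarrow> real" where
  "D1_plus N v = (\<lambda>i\<in>{1..N}. real N * (v (succ_mod N i) - v i))"

definition D1_minus :: "nat \<Rightarrow> (nat \<Rightarrow> real) \<Rightarrow> nat \<Rightarrow> real" where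
  "D1_minus N v = (\<lambda>i\<in>{1..N}. real N * (v i - v (pred_mod N i)))"

definition D2 :: "nat \<Rightarrow> (nat \<Rightarrow> real) \<Rightarrow> nat \<Rightarrow> real" where
  "D2 N v = D1_minus N (D1_plus N v)"

definition num_flux :: "nat \<Rightarrow> (real \<times> real \<Rightarrow> real) \<Rightarrow> (nat \<Rightarrow> real) \<Rightarrow> nat \<Rightarrow> real" where
  "num_flux N Abar v = (\<lambda>i\<in>{1..N}. Abar (v i, v (succ_mod N i)))"

definition drift ::
  "nat \<Rightarrow> real \<Rightarrow> (real \<times> real \<Rightarrow> real) \<Rightarrow> (nat \<Rightarrow> real) \<Rightarrow> nat \<Rightarrow> real" where
  "drift N \<nu> Abar v =
     (\<lambda>i\<in>{1..N}. - D1_minus N (num_flux N Abar v) i + \<nu> * D2 N v i)"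

text \<open>The sum over all \<open>k \<ge> 1\<close>, taken pathwise. Under the assumptions on the noise, the summands
  are independent and the series converges almost surely, locally uniformly in time.\<close>

definition noise ::
  "nat \<Rightarrow> (nat \<Rightarrow> real \<Rightarrow> real) \<Rightarrow> (nat \<Rightarrow> real \<Rightarrow> 'w \<Rightarrow> real) \<Rightarrow> real \<Rightarrow> 'w \<Rightarrow> nat \<Rightarrow> real" where
  "noise N g W t \<omega> = (\<lambda>i\<in>{1..N}. \<Sum>k. cell_avg N (g (Suc k)) i * W (Suc k) t \<omega>)"

text \<open>Strong solution on the given filtered space: an adapted process with almost surely continuous
  paths which almost surely satisfies the integrated equation at all times. The noise is additive,
  so that its stochastic integral is the noise itself. Path continuity refers to the product
  topology on functions, which on extensional functions on \<open>{1..N}\<close> is the Euclidean one.\<close>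

definition strong_solution ::
  "'w measure \<Rightarrow> (real \<Rightarrow> 'w measure) \<Rightarrow> (nat \<Rightarrow> real \<Rightarrow> 'w \<Rightarrow> real) \<Rightarrow> (nat \<Rightarrow> real \<Rightarrow> real) \<Rightarrow>
   nat \<Rightarrow> real \<Rightarrow> (real \<times> real \<Rightarrow> real) \<Rightarrow> ('w \<Rightarrow> nat \<Rightarrow> real) \<Rightarrow> (real \<Rightarrow> 'w \<Rightarrow> nat \<Rightarrow> real) \<Rightarrow> bool" where
  "strong_solution M F W g N \<nu> Abar U0 U \<longleftrightarrow>
     (\<forall>t\<ge>0. U t \<in> F t \<rightarrow>\<^sub>M RN N) \<and>
     (AE \<omega> in M. continuous_on {0..} (\<lambda>t. U t \<omega>)) \<and>
     (AE \<omega> in M. U 0 \<omega> = U0 \<omega>) \<and>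
     (AE \<omega> in M. \<forall>t\<ge>0. \<forall>i\<in>{1..N}.
        U t \<omega> i = U0 \<omega> i + (LINT s:{0..t}|lborel. drift N \<nu> Abar (U s \<omega>) i) + noise N g W t \<omega> i)"

end

theory Submission
  imports Defs
begin

text \<open>
  The noise is additive, so the equation can be solved path by path. With the forcing
  \<open>X t = U0 + noise t\<close> it is the integral equation \<open>u t = X t + \<integral>\<^sub>0\<^sup>t drift (u s) ds\<close>,
  in which randomness only enters through the continuous path \<open>X\<close>. Three points carry the proof.

  The forcing is continuous. The coefficients of the noise are only square summable, so
  the series need not converge absolutely and its convergence comes from cancellation. A maximal
  inequality in time (Kolmogorov's argument, \<open>maximal_inequality_time\<close>) followed by one in the
  number of terms (Ottaviani's argument, \<open>maximal_inequality_partial_sums\<close>) shows that almost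
  surely the partial sums are Cauchy, uniformly on compact time intervals
  (\<open>AE_series_continuous\<close>). Square summability of the coefficients amounts to bounding the
  average of \<open>g\<close> over a cell by the \<open>L\<^sup>2\<close> norm of its weak second derivative
  (\<open>abs_cell_avg_le\<close>): modulo constants, which \<open>g\<close> does not see, the indicator of a cell is a
  limit of second derivatives of uniformly bounded test functions.

  Solutions do not explode and are unique. The flux may grow polynomially, so a pathwise energy
  estimate for \<open>u - X\<close> would not close. Monotonicity of the flux gives more: a small Euler step
  \<open>v \<mapsto> v + h * drift v\<close> contracts the \<open>l\<^sup>1\<close> distance (\<open>euler_step_contraction\<close>), because it is
  order preserving and conserves the total mass. In the limit, the \<open>l\<^sup>1\<close> distance between two paths
  grows at most by the integrated \<open>l\<^sup>1\<close> norm of the defect in the equation for their difference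
  (\<open>l1_stability\<close>). Two solutions have no defect, hence coincide. The defect of a solution against
  the forcing \<open>X\<close> is \<open>drift (X s)\<close>, so \<open>u - X\<close> is bounded by a quantity that depends on \<open>X\<close> only
  (\<open>solution_distance_to_forcing\<close>).

  Solutions exist and are adapted. Clipping the arguments of the flux at level \<open>n\<close> makes it globally
  Lipschitz and keeps it monotone; Picard iteration then gives a global solution whose iterates are
  adapted. The bound on \<open>u - X\<close> does not depend on \<open>n\<close>, so on a given time interval all clipped
  solutions coincide from some level on and solve the original equation
  (\<open>clipped_sol_eventually_solves\<close>). Their limit is the solution (\<open>flow_solves\<close>), and it is adapted
  as a limit of adapted processes (\<open>flow_measurable\<close>). The paths on which the noise
  misbehaves form a null set, which belongs to the initial sigma-algebra of a normal filtration, so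
  replacing the noise by zero there does not spoil adaptedness.
\<close>

section \<open>Cell averages and the $H^2_0$ norm\<close>

lemma prob_space_torus: "prob_space torus"
  by (rule prob_spaceI) (simp add: emeasure_restrict_space space_restrict_space)

lemma measure_torus: "measure torus {0<..1} = 1"
  using prob_space.prob_space[OF prob_space_torus] by (simp add: space_restrict_space)

lemma torus_borel_measurable: "f \<in> borel_measurable borel \<Longrightarrow> f \<in> borel_measurable torus"
  by (rule measurable_restrict_space1) simp

lemma torus_integral: "(LINT x|torus. f x) = (LINT x:{0<..1}|lborel. f x)" for f :: "real \<Rightarrow> real"
  by (subst integral_restrict_space) (auto simp: set_lebesgue_integral_def)

lemma torus_integrable_bounded:
  fixes f :: "real \<Rightarrow> real"
  assumes "f \<in> borel_measurable torus" "\<And>x. 0 < x \<Longrightarrow> x \<le> 1 \<Longrightarrow> \<bar>f x\<bar> \<le> K"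
  shows "integrable torus f"
proof -
  interpret prob_space torus by (rule prob_space_torus)
  show ?thesis using assms
    by (intro integrable_const_bound[where B=K]) (auto intro!: AE_I2 simp: space_restrict_space)
qed

lemma torus_integrable_continuous:
  fixes f :: "real \<Rightarrow> real"
  assumes "continuous_on UNIV f"
  shows "integrable torus f"
proof -
  have "compact (f ` {0..1})"
    using assms by (intro compact_continuous_image continuous_on_subset[OF assms]) auto
  then obtain K where "\<forall>y\<in>f ` {0..1}. norm y \<le> K"
    using compact_imp_bounded bounded_iff by metis
  then show ?thesis
    by (intro torus_integrable_bounded[where K=K] torus_borel_measurable
        borel_measurable_continuous_onI assms) auto
qed

lemma torus_integral_abs_le:
  fixes f :: "real \<Rightarrow> real"
  assumes f: "integrable torus f" and K: "\<And>x. 0 < x \<Longrightarrow> x \<le> 1 \<Longrightarrow> \<bar>f x\<bar> \<le> K"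
  shows "\<bar>LINT x|torus. f x\<bar> \<le> K"
proof -
  interpret prob_space torus by (rule prob_space_torus)
  have "\<bar>LINT x|torus. f x\<bar> \<le> (LINT x|torus. \<bar>f x\<bar>)"
    by (rule integral_abs_bound)
  also have "\<dots> \<le> (LINT x|torus. K)"
    using f K by (intro integral_mono) (auto simp: space_restrict_space)
  also have "\<dots> = K" using prob_space by (simp add: space_restrict_space)
  finally show ?thesis .
qed

lemma torus_integral_deriv:
  fixes f F :: "real \<Rightarrow> real"
  assumes f: "continuous_on UNIV f" and F: "\<And>x. (F has_real_derivative f x) (at x)"
  shows "(LINT x|torus. f x) = F 1 - F 0"
proof -
  have "(LBINT x=ereal 0..ereal 1. f x) = F 1 - F 0"
    using F f by (intro interval_integral_FTC_finite)
      (auto intro: continuous_on_subset has_vector_derivative_at_within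
        simp: has_real_derivative_iff_has_vector_derivative)
  then show ?thesis
    by (simp add: torus_integral interval_integral_Ioc)
qed

lemma L2_torus_integrable:
  assumes "v \<in> L2_torus"
  shows "integrable torus v"
proof -
  interpret prob_space torus by (rule prob_space_torus)
  have "\<bar>y\<bar> \<le> 1 + y\<^sup>2" for y :: real
  proof -
    have "(\<bar>y\<bar> - 1)\<^sup>2 = y\<^sup>2 - 2 * \<bar>y\<bar> + 1"
      by (simp add: power2_eq_square algebra_simps)
    then show ?thesis using zero_le_power2[of "\<bar>y\<bar> - 1"] by linarith
  qed
  then show ?thesis
    using assms unfolding L2_torus_def
    by (intro Bochner_Integration.integrable_bound[where f="\<lambda>x. 1 + (v x)\<^sup>2" and g=v] AE_I2) auto
qed

text \<open>The Cauchy--Schwarz inequality against the constant 1, as nonnegativity of a variance.\<close>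

lemma torus_integral_abs_le_L2_norm:
  assumes "v \<in> L2_torus"
  shows "(LINT x|torus. \<bar>v x\<bar>) \<le> L2_norm_torus v"
proof -
  interpret prob_space torus by (rule prob_space_torus)
  have i: "integrable torus (\<lambda>x. \<bar>v x\<bar>)" "integrable torus (\<lambda>x. \<bar>v x\<bar>\<^sup>2)"
    using L2_torus_integrable[OF assms] assms by (auto simp: L2_torus_def)
  have "0 \<le> variance (\<lambda>x. \<bar>v x\<bar>)" by (rule variance_positive)
  also have "\<dots> = (LINT x|torus. (v x)\<^sup>2) - (LINT x|torus. \<bar>v x\<bar>)\<^sup>2"
    using variance_eq[OF i] by simp
  finally show ?thesis
    unfolding L2_norm_torus_def by (intro real_le_rsqrt) simp
qed

text \<open>The mean of \<open>f\<close> is the increment of an antiderivative over one period, so mean zero makes the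
  antiderivative periodic. Normalising it to mean zero again allows the construction to be iterated.\<close>

lemma periodic_antiderivative:
  fixes f :: "real \<Rightarrow> real"
  assumes f: "continuous_on UNIV f" and per: "\<And>x. f (x + 1) = f x"
    and mean: "(LINT x|torus. f x) = 0"
    and K: "\<And>x. 0 \<le> x \<Longrightarrow> x \<le> 1 \<Longrightarrow> \<bar>f x\<bar> \<le> K"
  obtains F where "\<And>x. (F has_real_derivative f x) (at x)" "\<And>x. F (x + 1) = F x"
    "(LINT x|torus. F x) = 0" "\<And>x. 0 \<le> x \<Longrightarrow> x \<le> 1 \<Longrightarrow> \<bar>F x\<bar> \<le> 2 * K"
proof -
  have "\<exists>P. \<forall>x::real. -\<infinity> < ereal x \<longrightarrow> ereal x < \<infinity> \<longrightarrow> (P has_vector_derivative f x) (at x)"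
    using f by (intro einterval_antiderivative) (auto simp: continuous_on_eq_continuous_at)
  then obtain P where P: "\<And>x. (P has_real_derivative f x) (at x)"
    by (auto simp: has_real_derivative_iff_has_vector_derivative)
  define c where "c = (LINT x|torus. P x - P 0)"
  define F where "F x = P x - P 0 - c" for x
  have F: "(F has_real_derivative f x) (at x)" for x
    unfolding F_def by (auto intro!: derivative_eq_intros P)
  have cP: "continuous_on UNIV P"
    using P by (intro continuous_at_imp_continuous_on) (auto intro: DERIV_isCont)
  have iP: "integrable torus (\<lambda>x. P x - P 0)"
    by (intro torus_integrable_continuous continuous_intros cP)
  interpret prob_space torus by (rule prob_space_torus)
  have F0: "(LINT x|torus. F x) = 0"
    unfolding F_def using iP by (simp add: c_def measure_torus space_restrict_space)
  have "((\<lambda>x. F (x + 1) - F x) has_real_derivative f (x + 1) - f x) (at x)" for x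
    by (intro DERIV_diff F DERIV_shift[THEN iffD1])
  then have "F (x + 1) - F x = F (0 + 1) - F 0" for x
    using per by (intro DERIV_isconst_all[where f="\<lambda>x. F (x + 1) - F x"]) simp
  moreover have "F 1 - F 0 = 0"
    using torus_integral_deriv[OF f F] mean by simp
  ultimately have Fper: "F (x + 1) = F x" for x by simp
  have PK: "\<bar>P x - P 0\<bar> \<le> K" if x: "0 \<le> x" "x \<le> 1" for x
  proof (cases "x = 0")
    case True then show ?thesis using K[of 0] by simp
  next
    case False
    then obtain z where z: "0 < z" "z < x" "P x - P 0 = (x - 0) * f z"
      using MVT2[of 0 x P f] P x by auto
    have "\<bar>P x - P 0\<bar> = x * \<bar>f z\<bar>" using z x by (simp add: abs_mult)
    also have "\<dots> \<le> 1 * K" using K[of z] z x by (intro mult_mono) auto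
    finally show ?thesis by simp
  qed
  have "\<bar>c\<bar> \<le> K"
    unfolding c_def by (intro torus_integral_abs_le iP PK) auto
  then have "\<bar>F x\<bar> \<le> 2 * K" if x: "0 \<le> x" "x \<le> 1" for x
    using PK[OF x] unfolding F_def by linarith
  with F Fper F0 show ?thesis by (rule that)
qed

text \<open>Smoothness without computing higher derivatives: membership in a class of functions that is
  closed under differentiation propagates along the iteration of \<open>deriv\<close>.\<close>

lemma derivative_closed_imp_smooth:
  fixes f :: "real \<Rightarrow> real"
  assumes S: "\<And>f. f \<in> S \<Longrightarrow> \<exists>f'\<in>S. \<forall>x. (f has_real_derivative f' x) (at x)" and f: "f \<in> S"
  shows "(deriv ^^ n) f differentiable (at x)"
proof -
  have "(deriv ^^ n) f \<in> S"
  proof (induction n)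
    case (Suc n)
    then obtain f' where f': "f' \<in> S" "\<forall>x. ((deriv ^^ n) f has_real_derivative f' x) (at x)"
      using S by blast
    then have "deriv ((deriv ^^ n) f) = f'" by (auto intro!: ext DERIV_imp_deriv)
    with f' show ?case by simp
  qed (simp add: f)
  then show ?thesis using S real_differentiable_def by blast
qed

lemma H20_weak_deriv:
  assumes "g \<in> H20_torus"
  shows "weak_deriv 2 g \<in> L2_torus" "has_weak_deriv 2 g (weak_deriv 2 g)"
proof -
  have "\<exists>w. w \<in> L2_torus \<and> has_weak_deriv 2 g w"
    using assms by (auto simp: H20_torus_def H2_torus_def)
  from someI_ex[OF this]
  show "weak_deriv 2 g \<in> L2_torus" "has_weak_deriv 2 g (weak_deriv 2 g)"
    by (simp_all add: weak_deriv_def)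
qed

text \<open>The duality estimate behind the bound on cell averages. Since \<open>g\<close> has mean zero, the mean of \<open>f\<close>
  may be removed; the rest of \<open>f\<close> is the second derivative of a periodic function \<open>P\<close> of
  size at most 8 (removing a mean and integrating twice each cost a factor 2), and moving both derivatives to \<open>g\<close> leaves the integral of the weak second derivative
  against \<open>P\<close>. The class \<open>S\<close> only serves to certify that \<open>P\<close> is smooth.\<close>

lemma H20_integral_smooth_le:
  fixes f :: "real \<Rightarrow> real"
  assumes g: "g \<in> H20_torus"
    and S: "\<And>f. f \<in> S \<Longrightarrow> \<exists>f'\<in>S. \<forall>x. (f has_real_derivative f' x) (at x)"
    and f: "f \<in> S" "\<And>x. f (x + 1) = f x" "\<And>x. \<bar>f x\<bar> \<le> 1"
  shows "\<bar>LINT x|torus. g x * f x\<bar> \<le> 8 * H20_norm g"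
proof -
  interpret prob_space torus by (rule prob_space_torus)
  define w where "w = weak_deriv 2 g"
  have w: "w \<in> L2_torus" "has_weak_deriv 2 g w"
    unfolding w_def using H20_weak_deriv[OF g] by auto
  have gi: "integrable torus g" and g0: "(LINT x|torus. g x) = 0"
    using g by (auto simp: H20_torus_def L20_torus_def intro: L2_torus_integrable)
  obtain f' where f': "f' \<in> S" "\<And>x. (f has_real_derivative f' x) (at x)"
    using S f(1) by blast
  have fc: "continuous_on UNIV f"
    using f' by (intro continuous_at_imp_continuous_on) (auto intro: DERIV_isCont)
  define m where "m = (LINT x|torus. f x)"
  have m: "\<bar>m\<bar> \<le> 1"
    unfolding m_def using fc f(3) by (intro torus_integral_abs_le torus_integrable_continuous)
  define f0 where "f0 x = f x - m" for x
  have f0c: "continuous_on UNIV f0" unfolding f0_def by (intro continuous_intros fc)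
  have f0d: "(f0 has_real_derivative f' x) (at x)" for x
    unfolding f0_def by (auto intro!: derivative_eq_intros f')
  have m0: "(LINT x|torus. f0 x) = 0"
    unfolding f0_def using torus_integrable_continuous[OF fc]
    by (simp add: m_def measure_torus space_restrict_space)
  have f0per: "f0 (x + 1) = f0 x" for x using f(2) by (simp add: f0_def)
  have f0K: "\<bar>f0 x\<bar> \<le> 2" for x using f(3)[of x] m unfolding f0_def by linarith
  obtain Q where Q: "\<And>x. (Q has_real_derivative f0 x) (at x)" "\<And>x. Q (x + 1) = Q x"
      "(LINT x|torus. Q x) = 0" "\<And>x. 0 \<le> x \<Longrightarrow> x \<le> 1 \<Longrightarrow> \<bar>Q x\<bar> \<le> 2 * 2"
    by (rule periodic_antiderivative[OF f0c f0per m0 f0K], rule that)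
  have Qc: "continuous_on UNIV Q"
    using Q by (intro continuous_at_imp_continuous_on) (auto intro: DERIV_isCont)
  obtain P where P: "\<And>x. (P has_real_derivative Q x) (at x)" "\<And>x. P (x + 1) = P x"
      "(LINT x|torus. P x) = 0" "\<And>x. 0 \<le> x \<Longrightarrow> x \<le> 1 \<Longrightarrow> \<bar>P x\<bar> \<le> 2 * (2 * 2)"
    by (rule periodic_antiderivative[OF Qc Q(2,3), of "2 * 2"], erule (1) Q(4), rule that)
  have Pc: "continuous_on UNIV P"
    using P by (intro continuous_at_imp_continuous_on) (auto intro: DERIV_isCont)
  have "test_function P"
    unfolding test_function_def
  proof (intro conjI allI)
    fix n x show "(deriv ^^ n) P differentiable (at x)"
    proof (rule derivative_closed_imp_smooth[of "S \<union> {f0, Q, P}"])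
      fix h assume "h \<in> S \<union> {f0, Q, P}"
      then show "\<exists>h'\<in>S \<union> {f0, Q, P}. \<forall>x. (h has_real_derivative h' x) (at x)"
        using S f0d f'(1) Q(1) P(1) by blast
    qed simp
  qed (simp add: P)
  moreover have "deriv P = Q" "deriv Q = f0"
    using P Q by (auto intro!: ext DERIV_imp_deriv)
  ultimately have eq: "(LINT x|torus. g x * f0 x) = (LINT x|torus. w x * P x)"
    using w(2) unfolding has_weak_deriv_def by (force simp: numeral_2_eq_2)
  have bnd: "integrable torus (\<lambda>x. h x * u x)"
    if "integrable torus h" "continuous_on UNIV u" "\<And>x. 0 \<le> x \<Longrightarrow> x \<le> 1 \<Longrightarrow> \<bar>u x\<bar> \<le> K" for h u :: "real \<Rightarrow> real" and K
  proof (rule Bochner_Integration.integrable_bound[where f="\<lambda>x. K * h x"])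
    show "AE x in torus. norm (h x * u x) \<le> norm (K * h x)"
    proof (rule AE_I2)
      fix x assume "x \<in> space torus"
      then have "\<bar>u x\<bar> \<le> \<bar>K\<bar>" using that(3)[of x] by (auto simp: space_restrict_space)
      then show "norm (h x * u x) \<le> norm (K * h x)"
        using mult_right_mono[of "\<bar>u x\<bar>" "\<bar>K\<bar>" "\<bar>h x\<bar>"] by (simp add: abs_mult mult.commute)
    qed
    have "u \<in> borel_measurable torus"
      by (intro torus_borel_measurable borel_measurable_continuous_onI that)
    then show "(\<lambda>x. h x * u x) \<in> borel_measurable torus" using that(1) by auto
  qed (use that in auto)
  have "(LINT x|torus. g x * f x) = (LINT x|torus. g x * f0 x + m * g x)"
    by (simp add: f0_def algebra_simps)
  also have "\<dots> = (LINT x|torus. g x * f0 x) + m * (LINT x|torus. g x)"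
    using gi bnd[OF gi f0c, of 2] f0K by (subst Bochner_Integration.integral_add) auto
  finally have "\<bar>LINT x|torus. g x * f x\<bar> = \<bar>LINT x|torus. w x * P x\<bar>"
    using g0 eq by simp
  also have "\<dots> \<le> (LINT x|torus. \<bar>w x * P x\<bar>)" by (rule integral_abs_bound)
  also have "\<dots> \<le> (LINT x|torus. 8 * \<bar>w x\<bar>)"
  proof (rule integral_mono)
    show "integrable torus (\<lambda>x. \<bar>w x * P x\<bar>)"
      using bnd[OF L2_torus_integrable[OF w(1)] Pc P(4)] by simp
    show "integrable torus (\<lambda>x. 8 * \<bar>w x\<bar>)" using L2_torus_integrable[OF w(1)] by simp
    fix x assume "x \<in> space torus"
    then have "\<bar>P x\<bar> \<le> 8" using P(4)[of x] by (auto simp: space_restrict_space)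
    then show "\<bar>w x * P x\<bar> \<le> 8 * \<bar>w x\<bar>"
      using mult_right_mono[of "\<bar>P x\<bar>" 8 "\<bar>w x\<bar>"] by (simp add: abs_mult mult.commute)
  qed
  also have "\<dots> = 8 * (LINT x|torus. \<bar>w x\<bar>)" by simp
  also have "\<dots> \<le> 8 * L2_norm_torus w"
    using torus_integral_abs_le_L2_norm[OF w(1)] by simp
  finally show ?thesis by (simp add: H20_norm_def w_def)
qed

text \<open>A trigonometric function of period 1, because both factors change sign under a shift by 1. For
  \<open>0 \<le> a < b \<le> 1\<close> it is positive inside the arc from \<open>a\<close> to \<open>b\<close> and negative outside, so that
  \<open>tanh (c * arc_sign a b x)\<close> is a smooth periodic approximation of a sign function as \<open>c\<close> grows.\<close>

definition arc_sign :: "real \<Rightarrow> real \<Rightarrow> real \<Rightarrow> real" where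
  "arc_sign a b x = - sin (pi * (x - a)) * sin (pi * (x - b))"

text \<open>Expressions for a class of functions that contains \<open>tanh (c * arc_sign a b x)\<close> and is closed under
  differentiation, as required by the duality estimate. A formal derivative exists because
  \<open>tanh\<close> solves the differential equation \<open>y' = 1 - y\<^sup>2\<close>.\<close>

datatype smooth_expr = Const real | Sin real | Cos real | Sigmoid
  | Add smooth_expr smooth_expr | Mult smooth_expr smooth_expr

context
  fixes a b c :: real
begin

primrec expr_fun :: "smooth_expr \<Rightarrow> real \<Rightarrow> real" where
  "expr_fun (Const k) = (\<lambda>x. k)"
| "expr_fun (Sin d) = (\<lambda>x. sin (pi * (x - d)))"
| "expr_fun (Cos d) = (\<lambda>x. cos (pi * (x - d)))"
| "expr_fun Sigmoid = (\<lambda>x. tanh (c * arc_sign a b x))"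
| "expr_fun (Add e1 e2) = (\<lambda>x. expr_fun e1 x + expr_fun e2 x)"
| "expr_fun (Mult e1 e2) = (\<lambda>x. expr_fun e1 x * expr_fun e2 x)"

primrec expr_deriv :: "smooth_expr \<Rightarrow> smooth_expr" where
  "expr_deriv (Const k) = Const 0"
| "expr_deriv (Sin d) = Mult (Const pi) (Cos d)"
| "expr_deriv (Cos d) = Mult (Const (- pi)) (Sin d)"
| "expr_deriv Sigmoid =
    Mult (Add (Const 1) (Mult (Const (- 1)) (Mult Sigmoid Sigmoid)))
      (Mult (Const (- c * pi)) (Add (Mult (Cos a) (Sin b)) (Mult (Sin a) (Cos b))))"
| "expr_deriv (Add e1 e2) = Add (expr_deriv e1) (expr_deriv e2)"
| "expr_deriv (Mult e1 e2) = Add (Mult (expr_deriv e1) e2) (Mult (expr_deriv e2) e1)"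

lemma expr_fun_has_derivative: "(expr_fun e has_real_derivative expr_fun (expr_deriv e) x) (at x)"
proof (induction e)
  case Sigmoid
  have "cosh y \<noteq> 0" for y :: real using cosh_real_pos[of y] by linarith
  moreover have "(arc_sign a b has_real_derivative
      - pi * (cos (pi * (x - a)) * sin (pi * (x - b)) + sin (pi * (x - a)) * cos (pi * (x - b)))) (at x)"
    unfolding arc_sign_def by (auto intro!: derivative_eq_intros simp: algebra_simps)
  ultimately have "((\<lambda>x. tanh (c * arc_sign a b x)) has_real_derivative (1 - (tanh (c * arc_sign a b x))\<^sup>2) *
      (c * (- pi * (cos (pi * (x - a)) * sin (pi * (x - b)) + sin (pi * (x - a)) * cos (pi * (x - b)))))) (at x)"
    by (intro has_field_derivative_tanh DERIV_cmult)
  then show ?case by (simp add: power2_eq_square mult.assoc)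
next
  case (Add e1 e2)
  then show ?case by (auto intro: DERIV_add)
next
  case (Mult e1 e2)
  then show ?case by (auto intro: DERIV_mult)
qed (auto intro!: derivative_eq_intros)

end

lemma arc_sign_periodic: "arc_sign a b (x + 1) = arc_sign a b x"
proof -
  have "sin (pi * (x + 1 - d)) = - sin (pi * (x - d))" for d
    using sin_periodic_pi[of "pi * (x - d)"] by (simp add: algebra_simps)
  then show ?thesis by (simp add: arc_sign_def)
qed

lemma arc_sign_pos:
  assumes "0 \<le> a" "a < x" "x < b" "b \<le> 1"
  shows "arc_sign a b x > 0"
proof -
  have "sin (pi * (x - a)) > 0" using assms by (intro sin_gt_zero) auto
  moreover have "sin (pi * (b - x)) > 0" using assms by (intro sin_gt_zero) auto
  moreover have "pi * (x - b) = - (pi * (b - x))" by (simp add: algebra_simps)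
  ultimately show ?thesis by (simp add: arc_sign_def)
qed

lemma arc_sign_neg:
  assumes "0 \<le> a" "b \<le> 1" "a < b" "0 < x" "x < 1" "x < a \<or> b < x"
  shows "arc_sign a b x < 0"
  using assms(6)
proof
  assume "x < a"
  then have "sin (pi * (a - x)) > 0" "sin (pi * (b - x)) > 0"
    using assms by (auto intro!: sin_gt_zero)
  moreover have "pi * (x - d) = - (pi * (d - x))" for d by (simp add: algebra_simps)
  ultimately show ?thesis by (simp only: arc_sign_def sin_minus) simp
next
  assume "b < x"
  then have "sin (pi * (x - a)) > 0" "sin (pi * (x - b)) > 0"
    using assms by (auto intro!: sin_gt_zero)
  then show ?thesis by (simp add: arc_sign_def)
qed

lemma tanh_scale_tendsto_sgn:
  fixes s :: real
  shows "(\<lambda>n. tanh (real n * s)) \<longlonglongrightarrow> sgn s"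
proof -
  have pos: "(\<lambda>n. tanh (real n * s)) \<longlonglongrightarrow> 1" if "s > 0" for s :: real
  proof -
    have "LIM n sequentially. real n * s :> at_top"
      using that by (intro filterlim_at_top_mult_tendsto_pos[OF tendsto_const]) (auto simp: filterlim_real_sequentially)
    then show ?thesis by (rule filterlim_compose[OF tanh_real_at_top])
  qed
  consider "s > 0" | "s = 0" | "s < 0" by linarith
  then show ?thesis
  proof cases
    case 3
    then have "(\<lambda>n. - tanh (real n * (- s))) \<longlonglongrightarrow> - 1" by (intro tendsto_minus pos) simp
    with 3 show ?thesis by simp
  qed (use pos in auto)
qed

text \<open>The duality estimate applies to \<open>tanh (n * arc_sign a b x)\<close> with a bound that does not depend on
  \<open>n\<close>. As \<open>n\<close> grows these functions converge to \<open>2 * indicator - 1\<close> off the endpoints, and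
  the constant \<open>- 1\<close> is invisible to \<open>g\<close>.\<close>

lemma H20_integral_cell_le:
  assumes g: "g \<in> H20_torus" and ab: "0 \<le> a" "a < b" "b \<le> 1"
  shows "\<bar>LINT x:{a<..b}|lborel. g x\<bar> \<le> 4 * H20_norm g"
proof -
  have gi: "integrable torus g" and g0: "(LINT x|torus. g x) = 0"
    using g by (auto simp: H20_torus_def L20_torus_def intro: L2_torus_integrable)
  note [measurable] = borel_measurable_integrable[OF gi]
  have mt: "(\<lambda>x. tanh (c * arc_sign a b x)) \<in> borel_measurable torus" for c
    unfolding arc_sign_def
    by (intro torus_borel_measurable borel_measurable_continuous_onI continuous_intros)
      (simp add: cosh_real_pos[THEN less_imp_neq, symmetric])
  have mi: "indicat_real {a<..b} \<in> borel_measurable torus" by (intro torus_borel_measurable) auto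
  have gI: "integrable torus (\<lambda>x. indicat_real {a<..b} x * g x)"
    by (intro Bochner_Integration.integrable_bound[OF gi] AE_I2 borel_measurable_times mi)
      (auto simp: indicator_def)
  \<comment> \<open>At 1 the function \<open>arc_sign\<close> vanishes if \<open>a = 0\<close>, so this point is excluded together with the endpoints.\<close>
  have "AE x in lborel. x \<notin> {a, b, 1}" by (intro AE_not_in) (simp add: emeasure_lborel_countable null_setsI)
  then have ae: "AE x in torus. x \<notin> {a, b, 1}"
    by (subst AE_restrict_space_iff) (auto elim: eventually_mono)
  have "(\<lambda>n. LINT x|torus. g x * tanh (real n * arc_sign a b x))
      \<longlonglongrightarrow> (LINT x|torus. 2 * (indicat_real {a<..b} x * g x) - g x)"
  proof (rule integral_dominated_convergence[where w="\<lambda>x. \<bar>g x\<bar>"])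
    show "AE x in torus. (\<lambda>n. g x * tanh (real n * arc_sign a b x)) \<longlonglongrightarrow> 2 * (indicat_real {a<..b} x * g x) - g x"
      using ae
    proof (rule AE_mp, intro AE_I2 impI)
      fix x assume x: "x \<in> space torus" "x \<notin> {a, b, 1}"
      then have "sgn (arc_sign a b x) = 2 * indicat_real {a<..b} x - 1"
        using arc_sign_pos[of a x b] arc_sign_neg[of a b x] ab
        by (cases "a < x \<and> x < b") (auto simp: space_restrict_space indicator_def)
      moreover have "(\<lambda>n. g x * tanh (real n * arc_sign a b x)) \<longlonglongrightarrow> g x * sgn (arc_sign a b x)"
        by (intro tendsto_intros tanh_scale_tendsto_sgn)
      moreover have "g x * (2 * indicat_real {a<..b} x - 1) = 2 * (indicat_real {a<..b} x * g x) - g x"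
        by (simp add: algebra_simps)
      ultimately show "(\<lambda>n. g x * tanh (real n * arc_sign a b x)) \<longlonglongrightarrow> 2 * (indicat_real {a<..b} x * g x) - g x"
        by simp
    qed
    show "AE x in torus. norm (g x * tanh (real n * arc_sign a b x)) \<le> \<bar>g x\<bar>" for n
      using tanh_real_bounds[of "real n * arc_sign a b _"]
      by (intro AE_I2) (simp add: abs_mult mult_left_le abs_le_iff minus_le_iff less_imp_le)
  qed (use gi mt mi in \<open>auto intro!: borel_measurable_times\<close>)
  then have lim: "(\<lambda>n. \<bar>LINT x|torus. g x * tanh (real n * arc_sign a b x)\<bar>)
      \<longlonglongrightarrow> \<bar>2 * (LINT x|torus. indicat_real {a<..b} x * g x)\<bar>"
    using gI gi g0 by (auto intro!: tendsto_rabs)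
  have "\<bar>2 * (LINT x|torus. indicat_real {a<..b} x * g x)\<bar> \<le> 8 * H20_norm g"
  proof (rule LIMSEQ_le_const2[OF lim], intro exI allI impI)
    fix n
    show "\<bar>LINT x|torus. g x * tanh (real n * arc_sign a b x)\<bar> \<le> 8 * H20_norm g"
      using expr_fun_has_derivative[of a b "real n"] tanh_real_bounds
      by (intro H20_integral_smooth_le[OF g, of "range (expr_fun a b (real n))"])
        (auto simp: arc_sign_periodic abs_le_iff minus_le_iff intro: less_imp_le
          intro!: range_eqI[of _ _ Sigmoid])
  qed
  moreover have "(LINT x|torus. indicat_real {a<..b} x * g x) = (LINT x:{a<..b}|lborel. g x)"
    unfolding torus_integral set_lebesgue_integral_def
  proof (intro Bochner_Integration.integral_cong refl)
    fix x show "indicat_real {0<..1} x *\<^sub>R (indicat_real {a<..b} x * g x) = indicat_real {a<..b} x *\<^sub>R g x"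
      using ab by (cases "x \<in> {a<..b}") auto
  qed
  ultimately show ?thesis by simp
qed

lemma abs_cell_avg_le:
  assumes "g \<in> H20_torus" "i \<in> {1..N}"
  shows "\<bar>cell_avg N g i\<bar> \<le> 4 * real N * H20_norm g"
proof -
  have N: "real N > 0" using assms by auto
  have "\<bar>LINT x:{(real i - 1) / real N<..real i / real N}|lborel. g x\<bar> \<le> 4 * H20_norm g"
  proof (rule H20_integral_cell_le[OF assms(1)])
    show "0 \<le> (real i - 1) / real N" "(real i - 1) / real N < real i / real N" "real i / real N \<le> 1"
      using assms(2) N by (auto intro: divide_nonneg_pos divide_strict_right_mono)
  qed
  then have "real N * \<bar>LINT x:{(real i - 1) / real N<..real i / real N}|lborel. g x\<bar> \<le> real N * (4 * H20_norm g)"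
    using N by (intro mult_left_mono) simp_all
  moreover have "\<bar>cell_avg N g i\<bar> = real N * \<bar>LINT x:{(real i - 1) / real N<..real i / real N}|lborel. g x\<bar>"
    using assms(2) unfolding cell_avg_def by (simp only: restrict_apply' abs_mult abs_of_nat)
  ultimately show ?thesis by simp
qed

lemma sum_cell_avg:
  assumes "g \<in> L20_torus" "N \<ge> 1"
  shows "(\<Sum>i=1..N. cell_avg N g i) = 0"
proof -
  have g: "integrable torus g" "(LINT x|torus. g x) = 0"
    using assms L2_torus_integrable by (auto simp: L20_torus_def)
  have gs: "set_integrable lborel {0<..1} g"
    using g(1) integrable_restrict_space[of "{0<..1}" lborel g] by (simp add: set_integrable_def)
  have "(LINT x:{0<..real n / real N}|lborel. g x) = (\<Sum>i=1..n. LINT x:{(real i - 1) / real N<..real i / real N}|lborel. g x)"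
    if "n \<le> N" for n
    using that
  proof (induction n)
    case (Suc n)
    have N: "real N > 0" using Suc by simp
    have le: "0 \<le> real n / real N" "real n / real N \<le> real (Suc n) / real N" "real (Suc n) / real N \<le> 1"
      using N Suc.prems by (simp_all add: field_simps)
    then have U: "{0<..real (Suc n) / real N} = {0<..real n / real N} \<union> {real n / real N<..real (Suc n) / real N}"
      by (simp add: ivl_disj_un_two)
    have "(LINT x:{0<..real (Suc n) / real N}|lborel. g x) =
      (LINT x:{0<..real n / real N}|lborel. g x) + (LINT x:{real n / real N<..real (Suc n) / real N}|lborel. g x)"
      unfolding U
    proof (intro set_integral_Un set_integrable_subset[OF gs])
      show "{0<..real n / real N} \<subseteq> {0<..1}" "{real n / real N<..real (Suc n) / real N} \<subseteq> {0<..1}"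
        using le by (auto intro: le_less_trans[OF le(1)])
    qed auto
    then show ?case using Suc by simp
  qed (simp add: set_lebesgue_integral_def)
  from this[of N] assms(2) g(2) have "(\<Sum>i=1..N. LINT x:{(real i - 1) / real N<..real i / real N}|lborel. g x) = 0"
    by (simp add: torus_integral)
  then show ?thesis by (simp add: cell_avg_def sum_distrib_left[symmetric])
qed

section \<open>Filtrations, Brownian motions and approximation of times\<close>

lemma normal_filtrationD:
  assumes "normal_filtration M F"
  shows "0 \<le> t \<Longrightarrow> subalgebra M (F t)"
    and "0 \<le> s \<Longrightarrow> s \<le> t \<Longrightarrow> sets (F s) \<subseteq> sets (F t)"
    and "null_sets M \<subseteq> sets (F 0)"
proof -
  have "\<forall>t\<ge>0. subalgebra M (F t)" "\<forall>s t. 0 \<le> s \<and> s \<le> t \<longrightarrow> sets (F s) \<subseteq> sets (F t)"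
    and n: "null_sets M \<subseteq> sets (F 0)"
    using assms unfolding normal_filtration_def by - (elim conjE, assumption)+
  then show "0 \<le> t \<Longrightarrow> subalgebra M (F t)" "0 \<le> s \<Longrightarrow> s \<le> t \<Longrightarrow> sets (F s) \<subseteq> sets (F t)"
    by iprover+
  show "null_sets M \<subseteq> sets (F 0)" by (rule n)
qed

lemma brownian_motionD:
  assumes "brownian_motion M F B"
  shows "0 \<le> t \<Longrightarrow> B t \<in> borel_measurable (F t)"
    and "AE \<omega> in M. B 0 \<omega> = 0"
    and "AE \<omega> in M. continuous_on {0..} (\<lambda>t. B t \<omega>)"
    and "0 \<le> s \<Longrightarrow> s < t \<Longrightarrow>
      distributed M lborel (\<lambda>\<omega>. B t \<omega> - B s \<omega>) (normal_density 0 (sqrt (t - s)))"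
    and "0 \<le> s \<Longrightarrow> s < t \<Longrightarrow> prob_space.indep_set M (sets (F s))
      {(\<lambda>\<omega>. B t \<omega> - B s \<omega>) -` S \<inter> space M | S. S \<in> sets borel}"
proof -
  have a: "\<forall>t\<ge>0. B t \<in> borel_measurable (F t)"
    and b: "AE \<omega> in M. B 0 \<omega> = 0" "AE \<omega> in M. continuous_on {0..} (\<lambda>t. B t \<omega>)"
    and d: "\<forall>s t. 0 \<le> s \<and> s < t \<longrightarrow>
        distributed M lborel (\<lambda>\<omega>. B t \<omega> - B s \<omega>) (normal_density 0 (sqrt (t - s))) \<and>
        prob_space.indep_set M (sets (F s))
          {(\<lambda>\<omega>. B t \<omega> - B s \<omega>) -` S \<inter> space M | S. S \<in> sets borel}"
    using assms unfolding brownian_motion_def by - (elim conjE, assumption)+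
  show "0 \<le> t \<Longrightarrow> B t \<in> borel_measurable (F t)" using a by iprover
  show "AE \<omega> in M. B 0 \<omega> = 0" "AE \<omega> in M. continuous_on {0..} (\<lambda>t. B t \<omega>)" by (fact b)+
  show "0 \<le> s \<Longrightarrow> s < t \<Longrightarrow>
      distributed M lborel (\<lambda>\<omega>. B t \<omega> - B s \<omega>) (normal_density 0 (sqrt (t - s)))"
    "0 \<le> s \<Longrightarrow> s < t \<Longrightarrow> prob_space.indep_set M (sets (F s))
      {(\<lambda>\<omega>. B t \<omega> - B s \<omega>) -` S \<inter> space M | S. S \<in> sets borel}"
    using d[rule_format, of s t] by iprover+
qed

text \<open>The rational grid points below a given time are used twice: to pass from rational to
  real times in the maximal inequalities, and to discretise time integrals of adapted processes.\<close>

lemma floor_grid_le: "of_int \<lfloor>real n * s\<rfloor> / real n \<le> s" if "0 \<le> s"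
proof (cases "n = 0")
  case False
  have "of_int \<lfloor>real n * s\<rfloor> / real n \<le> real n * s / real n"
    by (rule divide_right_mono) (auto intro: of_int_floor_le)
  with False show ?thesis by simp
qed (use that in simp)

lemma floor_grid_tendsto: "(\<lambda>n. of_int \<lfloor>real n * s\<rfloor> / real n) \<longlonglongrightarrow> s" if s: "0 \<le> s"
proof (rule tendsto_sandwich)
  show "\<forall>\<^sub>F n in sequentially. s - 1 / real n \<le> of_int \<lfloor>real n * s\<rfloor> / real n"
    using eventually_gt_at_top[of 0]
  proof eventually_elim
    case (elim n)
    have "real n * s - 1 \<le> of_int \<lfloor>real n * s\<rfloor>" by linarith
    then have "(real n * s - 1) / real n \<le> of_int \<lfloor>real n * s\<rfloor> / real n"
      by (rule divide_right_mono) simp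
    then show ?case using elim by (simp add: diff_divide_distrib)
  qed
  show "\<forall>\<^sub>F n in sequentially. of_int \<lfloor>real n * s\<rfloor> / real n \<le> s"
    using floor_grid_le[OF s] by (intro always_eventually) simp
  show "(\<lambda>n. s - 1 / real n) \<longlonglongrightarrow> s"
    using tendsto_diff[OF tendsto_const lim_const_over_n[of 1], of s] by simp
qed simp

lemma continuous_on_halfline:
  fixes f :: "real \<Rightarrow> 'a::topological_space"
  assumes "\<And>n::nat. continuous_on {0..real n} f"
  shows "continuous_on {0..} f"
  unfolding continuous_on_eq_continuous_within
proof
  fix t :: real assume t: "t \<in> {0..}"
  obtain n where n: "t < real n" using reals_Archimedean2 by blast
  have "continuous (at t within {0..real n}) f"
    using assms[of n] t n unfolding continuous_on_eq_continuous_within by simp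
  moreover have "at t within {0..real n} = at t within {0..}"
    by (rule at_within_nhd[of t "{..<real n}"]) (use n in auto)
  ultimately show "continuous (at t within {0..}) f" by simp
qed

section \<open>Locally uniform convergence of Brownian series\<close>

text \<open>Each \<open>B k\<close> is a Brownian motion for the filtration separately, and the processes are
  independent of each other. This does not make the whole family jointly Brownian for the
  filtration: the increments of several \<open>B k\<close> together may depend on the past. The arguments in time
  are therefore linear in the processes, and the arguments in the index use independence across \<open>k\<close>
  only.\<close>

locale brownian_series = prob_space M for M :: "'w measure" +
  fixes F :: "real \<Rightarrow> 'w measure" and B :: "nat \<Rightarrow> real \<Rightarrow> 'w \<Rightarrow> real" and c :: "nat \<Rightarrow> real"
  assumes filtration: "normal_filtration M F"
    and brownian: "brownian_motion M F (B k)"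
    and independent: "indep_vars (\<lambda>_. PiM {0..} (\<lambda>_. borel)) (\<lambda>k \<omega>. \<lambda>t\<in>{0..}. B k t \<omega>) UNIV"
begin

definition block_sum :: "nat \<Rightarrow> nat \<Rightarrow> real \<Rightarrow> 'w \<Rightarrow> real" where
  "block_sum m n t \<omega> = (\<Sum>k\<in>{m..<n}. c k * B k t \<omega>)"

lemma subalgebra: "0 \<le> t \<Longrightarrow> subalgebra M (F t)"
  by (rule normal_filtrationD(1)[OF filtration])

lemma space_F: "0 \<le> t \<Longrightarrow> space (F t) = space M"
  using subalgebra by (auto simp: subalgebra_def)

lemma F_measurable_mono:
  assumes "f \<in> borel_measurable (F s)" "0 \<le> s" "s \<le> t"
  shows "f \<in> borel_measurable (F t)"
proof (rule measurable_from_subalg[OF _ assms(1)])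
  show "subalgebra (F t) (F s)"
    using normal_filtrationD(2)[OF filtration assms(2,3)] assms space_F[of s] space_F[of t]
    by (simp add: subalgebra_def)
qed

lemma F_measurable_imp_measurable: "f \<in> borel_measurable (F t) \<Longrightarrow> 0 \<le> t \<Longrightarrow> f \<in> borel_measurable M"
  using measurable_from_subalg[OF subalgebra] .

lemma B_adapted: "0 \<le> s \<Longrightarrow> s \<le> t \<Longrightarrow> B k s \<in> borel_measurable (F t)"
  by (rule F_measurable_mono[OF brownian_motionD(1)[OF brownian]])

lemma B_measurable: "0 \<le> t \<Longrightarrow> B k t \<in> borel_measurable M"
  by (rule F_measurable_imp_measurable[OF B_adapted[of t t]]) auto

lemma block_sum_adapted: "0 \<le> s \<Longrightarrow> s \<le> t \<Longrightarrow> block_sum m n s \<in> borel_measurable (F t)"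
  unfolding block_sum_def using B_adapted by measurable

lemma block_sum_measurable: "0 \<le> t \<Longrightarrow> block_sum m n t \<in> borel_measurable M"
  by (rule F_measurable_imp_measurable[OF block_sum_adapted[of t t]]) auto

lemma increment_moments:
  assumes "0 \<le> s" "s \<le> t"
  shows "integrable M (\<lambda>\<omega>. B k t \<omega> - B k s \<omega>)" "expectation (\<lambda>\<omega>. B k t \<omega> - B k s \<omega>) = 0"
    "integrable M (\<lambda>\<omega>. (B k t \<omega> - B k s \<omega>)\<^sup>2)" "expectation (\<lambda>\<omega>. (B k t \<omega> - B k s \<omega>)\<^sup>2) = t - s"
proof -
  let ?X = "\<lambda>\<omega>. B k t \<omega> - B k s \<omega>"
  have "integrable M ?X \<and> expectation ?X = 0 \<and> integrable M (\<lambda>\<omega>. (?X \<omega>)\<^sup>2) \<and> expectation (\<lambda>\<omega>. (?X \<omega>)\<^sup>2) = t - s"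
  proof (cases "s = t")
    case False
    then have st: "s < t" using assms by simp
    then have D: "distributed M lborel ?X (normal_density 0 (sqrt (t - s)))"
      by (intro brownian_motionD(4)[OF brownian] assms)
    have pos: "0 < sqrt (t - s)" using st by simp
    have "integrable lborel (\<lambda>x. normal_density 0 (sqrt (t - s)) x * x\<^sup>2)"
      using integrable_normal_moment[OF pos, of 0 2] by simp
    then have i2: "integrable M (\<lambda>\<omega>. (?X \<omega>)\<^sup>2)"
      by (subst (asm) distributed_integrable[OF D]) auto
    have "?X \<in> borel_measurable M" using distributed_measurable[OF D] by simp
    then have i1: "integrable M ?X" using i2 by (rule square_integrable_imp_integrable)
    have e: "expectation ?X = 0" by (rule normal_distributed_expectation[OF pos D])
    have "variance ?X = (sqrt (t - s))\<^sup>2" by (rule normal_distributed_variance[OF pos D])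
    then show ?thesis using i1 i2 e st by simp
  qed simp
  then show "integrable M ?X" "expectation ?X = 0" "integrable M (\<lambda>\<omega>. (?X \<omega>)\<^sup>2)" "expectation (\<lambda>\<omega>. (?X \<omega>)\<^sup>2) = t - s"
    by auto
qed

lemma B_moments:
  assumes t: "0 \<le> t"
  shows "integrable M (B k t)" "expectation (B k t) = 0"
    "integrable M (\<lambda>\<omega>. (B k t \<omega>)\<^sup>2)" "expectation (\<lambda>\<omega>. (B k t \<omega>)\<^sup>2) = t"
proof -
  have ae: "AE \<omega> in M. B k t \<omega> - B k 0 \<omega> = B k t \<omega>"
    using brownian_motionD(2)[OF brownian[of k]] by eventually_elim simp
  have ae2: "AE \<omega> in M. (B k t \<omega> - B k 0 \<omega>)\<^sup>2 = (B k t \<omega>)\<^sup>2"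
    using ae by eventually_elim simp
  note inc = increment_moments[of 0 t k]
  have [measurable]: "B k t \<in> borel_measurable M" "B k 0 \<in> borel_measurable M"
    using t by (auto intro: B_measurable)
  show "integrable M (B k t)"
    using inc(1) t ae by (subst integrable_cong_AE[symmetric, OF _ _ ae]) auto
  show "expectation (B k t) = 0"
    using inc(2) t ae by (subst integral_cong_AE[symmetric, OF _ _ ae]) auto
  show "integrable M (\<lambda>\<omega>. (B k t \<omega>)\<^sup>2)"
    using inc(3) t ae by (subst integrable_cong_AE[symmetric, OF _ _ ae2]) auto
  show "expectation (\<lambda>\<omega>. (B k t \<omega>)\<^sup>2) = t"
    using inc(4) t ae by (subst integral_cong_AE[symmetric, OF _ _ ae2]) auto
qed

text \<open>The martingale property, tested against any integrable \<open>X\<close> that is known at time \<open>s\<close>. It is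
  linear in \<open>B k\<close> and hence passes to finite sums.\<close>

lemma increment_orthogonal:
  assumes st: "0 \<le> s" "s \<le> t" and X: "X \<in> borel_measurable (F s)" "integrable M X"
  shows "integrable M (\<lambda>\<omega>. X \<omega> * (B k t \<omega> - B k s \<omega>))"
    "expectation (\<lambda>\<omega>. X \<omega> * (B k t \<omega> - B k s \<omega>)) = 0"
proof -
  let ?I = "\<lambda>\<omega>. B k t \<omega> - B k s \<omega>"
  have "integrable M (\<lambda>\<omega>. X \<omega> * ?I \<omega>) \<and> expectation (\<lambda>\<omega>. X \<omega> * ?I \<omega>) = 0"
  proof (cases "s = t")
    case False
    let ?G = "{?I -` A \<inter> space M | A. A \<in> sets borel}"
    have "indep_set (sets (F s)) ?G"
      using False st by (intro brownian_motionD(5)[OF brownian]) auto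
    moreover have "Int_stable ?G"
    proof (rule Int_stableI)
      fix a b assume "a \<in> ?G" "b \<in> ?G"
      then obtain A A' where "a = ?I -` A \<inter> space M" "b = ?I -` A' \<inter> space M" "A \<in> sets borel" "A' \<in> sets borel"
        by blast
      then show "a \<inter> b \<in> ?G" by (intro CollectI exI[of _ "A \<inter> A'"]) auto
    qed
    ultimately have "indep_set (sigma_sets (space M) (sets (F s))) (sigma_sets (space M) ?G)"
      by (intro indep_set_sigma_sets sets.Int_stable)
    then have "indep_set (sigma_sets (space M) {X -` A \<inter> space M | A. A \<in> sets borel}) (sigma_sets (space M) ?G)"
      unfolding indep_set_def
    proof (rule indep_sets_mono_sets)
      have "{X -` A \<inter> space M | A. A \<in> sets borel} \<subseteq> sets (F s)"
        using measurable_sets[OF X(1)] space_F[OF st(1)] by auto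
      then show "case_bool (sigma_sets (space M) {X -` A \<inter> space M | A. A \<in> sets borel}) (sigma_sets (space M) ?G) i
          \<subseteq> case_bool (sigma_sets (space M) (sets (F s))) (sigma_sets (space M) ?G) i" for i
        by (cases i) (simp_all add: sigma_sets_subseteq)
    qed
    moreover have "?I \<in> borel_measurable M"
      using st by (intro borel_measurable_diff B_measurable) auto
    ultimately have "indep_var borel X borel ?I"
      unfolding indep_var_eq using X by auto
    then show ?thesis
      using indep_var_integrable[of X ?I] indep_var_lebesgue_integral[of X ?I] X(2) increment_moments[OF st, of k] by simp
  qed simp
  then show "integrable M (\<lambda>\<omega>. X \<omega> * ?I \<omega>)" "expectation (\<lambda>\<omega>. X \<omega> * ?I \<omega>) = 0" by auto
qed

lemma B_product_moments:
  assumes t: "0 \<le> t"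
  shows "integrable M (\<lambda>\<omega>. B j t \<omega> * B k t \<omega>)"
    "expectation (\<lambda>\<omega>. B j t \<omega> * B k t \<omega>) = (if j = k then t else 0)"
proof -
  have "integrable M (\<lambda>\<omega>. B j t \<omega> * B k t \<omega>) \<and> expectation (\<lambda>\<omega>. B j t \<omega> * B k t \<omega>) = (if j = k then t else 0)"
  proof (cases "j = k")
    case True
    then show ?thesis using B_moments(3,4)[OF t, of k] by (simp add: power2_eq_square)
  next
    case False
    have "indep_vars (\<lambda>_. borel) (\<lambda>k \<omega>. (\<lambda>x. x t) (\<lambda>t\<in>{0..}. B k t \<omega>)) UNIV"
      using t by (intro indep_vars_compose2[OF independent]) (auto intro: measurable_component_singleton)
    then have "indep_vars (\<lambda>_. borel) (\<lambda>k. B k t) UNIV" using t by simp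
    then have "indep_var (PiM {j} (\<lambda>_. borel)) (\<lambda>\<omega>. \<lambda>k\<in>{j}. B k t \<omega>) (PiM {k} (\<lambda>_. borel)) (\<lambda>\<omega>. \<lambda>k\<in>{k}. B k t \<omega>)"
      using False by (intro indep_var_restrict) auto
    then have "indep_var borel ((\<lambda>x. x j) \<circ> (\<lambda>\<omega>. \<lambda>k\<in>{j}. B k t \<omega>)) borel ((\<lambda>x. x k) \<circ> (\<lambda>\<omega>. \<lambda>k\<in>{k}. B k t \<omega>))"
      by (rule indep_var_compose) (auto intro: measurable_component_singleton)
    then have "indep_var borel (B j t) borel (B k t)" by (simp add: comp_def)
    then show ?thesis
      using False indep_var_integrable[of "B j t" "B k t"] indep_var_lebesgue_integral[of "B j t" "B k t"]
        B_moments[OF t] by simp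
  qed
  then show "integrable M (\<lambda>\<omega>. B j t \<omega> * B k t \<omega>)"
    "expectation (\<lambda>\<omega>. B j t \<omega> * B k t \<omega>) = (if j = k then t else 0)" by auto
qed

lemma block_sum_second_moment:
  assumes t: "0 \<le> t"
  shows "integrable M (\<lambda>\<omega>. (block_sum m n t \<omega>)\<^sup>2)"
    "expectation (\<lambda>\<omega>. (block_sum m n t \<omega>)\<^sup>2) = (\<Sum>k\<in>{m..<n}. (c k)\<^sup>2) * t"
proof -
  have eq: "(block_sum m n t \<omega>)\<^sup>2 = (\<Sum>j\<in>{m..<n}. \<Sum>k\<in>{m..<n}. (c j * c k) * (B j t \<omega> * B k t \<omega>))" for \<omega>
    unfolding block_sum_def power2_eq_square sum_product by (intro sum.cong refl) (simp add: mult_ac)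
  show "integrable M (\<lambda>\<omega>. (block_sum m n t \<omega>)\<^sup>2)"
    unfolding eq by (intro Bochner_Integration.integrable_sum integrable_mult_right B_product_moments[OF t])
  have "expectation (\<lambda>\<omega>. (block_sum m n t \<omega>)\<^sup>2) = (\<Sum>j\<in>{m..<n}. \<Sum>k\<in>{m..<n}. (c j * c k) * (if j = k then t else 0))"
    unfolding eq
    by (simp add: Bochner_Integration.integral_sum Bochner_Integration.integrable_sum B_product_moments[OF t] del: mult_if_delta)
  also have "\<dots> = (\<Sum>j\<in>{m..<n}. (c j)\<^sup>2 * t)"
    by (intro sum.cong refl) (simp add: if_distrib[of "\<lambda>x. _ * x"] power2_eq_square cong: if_cong)
  finally show "expectation (\<lambda>\<omega>. (block_sum m n t \<omega>)\<^sup>2) = (\<Sum>k\<in>{m..<n}. (c k)\<^sup>2) * t"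
    by (simp add: sum_distrib_right)
qed

text \<open>Kolmogorov's argument over a finite set of times. The event splits according to the first time \<open>t\<close>
  at which the level is exceeded; on that part, which is known at time \<open>t\<close>, the increment from \<open>t\<close> to
  \<open>T\<close> is orthogonal to the present value, so the second moment at time \<open>T\<close> is at least \<open>r\<^sup>2\<close> times the
  probability.\<close>

lemma maximal_inequality_time:
  assumes J: "finite J" "J \<subseteq> {0..T}" and T: "0 \<le> T" and r: "0 < r"
  shows "prob {\<omega>\<in>space M. \<exists>t\<in>J. r < \<bar>block_sum m n t \<omega>\<bar>} \<le> (\<Sum>k\<in>{m..<n}. (c k)\<^sup>2) * T / r\<^sup>2"
proof -
  define A where "A t = {\<omega>\<in>space M. r < \<bar>block_sum m n t \<omega>\<bar> \<and> (\<forall>s\<in>J. s < t \<longrightarrow> \<bar>block_sum m n s \<omega>\<bar> \<le> r)}" for t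
  have AF: "A t \<in> sets (F t)" if t: "t \<in> J" for t
  proof -
    have t0: "0 \<le> t" using t J by auto
    have [measurable]: "block_sum m n t \<in> borel_measurable (F t)" using t0 by (intro block_sum_adapted) auto
    have "Measurable.pred (F t) (\<lambda>\<omega>. s < t \<longrightarrow> \<bar>block_sum m n s \<omega>\<bar> \<le> r)" if "s \<in> J" for s
    proof (cases "s < t")
      case True
      then have [measurable]: "block_sum m n s \<in> borel_measurable (F t)" using that J by (intro block_sum_adapted) auto
      show ?thesis by measurable
    qed simp
    then have [measurable]: "Measurable.pred (F t) (\<lambda>\<omega>. \<forall>s\<in>J. s < t \<longrightarrow> \<bar>block_sum m n s \<omega>\<bar> \<le> r)"
      using J(1) by (intro pred_intros_finite)
    have "{\<omega>\<in>space (F t). r < \<bar>block_sum m n t \<omega>\<bar> \<and> (\<forall>s\<in>J. s < t \<longrightarrow> \<bar>block_sum m n s \<omega>\<bar> \<le> r)} \<in> sets (F t)"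
      by measurable
    then show ?thesis unfolding A_def space_F[OF t0] .
  qed
  have AM: "A t \<in> events" if "t \<in> J" for t
  proof -
    have "0 \<le> t" using J that by auto
    then show ?thesis using AF[OF that] subalgebra[of t] unfolding subalgebra_def by blast
  qed
  have disj: "disjoint_family_on A J"
  unfolding disjoint_family_on_def
  proof (intro ballI impI)
    fix s t assume st: "s \<in> J" "t \<in> J" "s \<noteq> t"
    then consider "s < t" | "t < s" by linarith
    then show "A s \<inter> A t = {}"
      using st by cases (force simp: A_def)+
  qed
  have U: "{\<omega>\<in>space M. \<exists>t\<in>J. r < \<bar>block_sum m n t \<omega>\<bar>} = (\<Union>t\<in>J. A t)"
  proof (intro equalityI subsetI)
    fix \<omega> assume "\<omega> \<in> {\<omega>\<in>space M. \<exists>t\<in>J. r < \<bar>block_sum m n t \<omega>\<bar>}"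
    then have \<omega>: "\<omega> \<in> space M" and ne: "{t\<in>J. r < \<bar>block_sum m n t \<omega>\<bar>} \<noteq> {}" by auto
    define t where "t = Min {t\<in>J. r < \<bar>block_sum m n t \<omega>\<bar>}"
    have fin: "finite {t\<in>J. r < \<bar>block_sum m n t \<omega>\<bar>}" using J by simp
    have t: "t \<in> J" "r < \<bar>block_sum m n t \<omega>\<bar>" using Min_in[OF fin ne] by (auto simp: t_def)
    have "\<bar>block_sum m n s \<omega>\<bar> \<le> r" if "s \<in> J" "s < t" for s
    proof (rule ccontr)
      assume "\<not> \<bar>block_sum m n s \<omega>\<bar> \<le> r"
      then have "s \<in> {t\<in>J. r < \<bar>block_sum m n t \<omega>\<bar>}" using that(1) by simp
      from Min_le[OF fin this] show False using that(2) by (simp add: t_def)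
    qed
    then have "\<omega> \<in> A t" using t \<omega> unfolding A_def by simp
    then show "\<omega> \<in> (\<Union>t\<in>J. A t)" by (rule UN_I[OF t(1)])
  next
    fix \<omega> assume "\<omega> \<in> (\<Union>t\<in>J. A t)"
    then obtain t where "t \<in> J" "\<omega> \<in> A t" by (rule UN_E)
    then show "\<omega> \<in> {\<omega>\<in>space M. \<exists>t\<in>J. r < \<bar>block_sum m n t \<omega>\<bar>}"
      unfolding A_def by (intro CollectI conjI bexI[of _ t]) simp_all
  qed
  have Ti: "integrable M (\<lambda>\<omega>. (block_sum m n T \<omega>)\<^sup>2)" by (rule block_sum_second_moment[OF T])
  have iT: "integrable M (\<lambda>\<omega>. indicator (A t) \<omega> * (block_sum m n T \<omega>)\<^sup>2)" if "t \<in> J" for t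
    using integrable_real_mult_indicator[OF AM[OF that] Ti] by (simp add: mult.commute)
  have le: "r\<^sup>2 * prob (A t) \<le> expectation (\<lambda>\<omega>. indicator (A t) \<omega> * (block_sum m n T \<omega>)\<^sup>2)" if t: "t \<in> J" for t
  proof -
    have tT: "0 \<le> t" "t \<le> T" using t J by auto
    \<comment> \<open>The orthogonality of increments is used for the present value, cut off to the event of first exceedance.\<close>
    define X where "X \<omega> = indicator (A t) \<omega> * block_sum m n t \<omega>" for \<omega>
    have XF: "X \<in> borel_measurable (F t)"
    proof -
      have [measurable]: "block_sum m n t \<in> borel_measurable (F t)" "A t \<in> sets (F t)"
        using tT AF[OF t] by (auto intro: block_sum_adapted)
      show ?thesis unfolding X_def by measurable
    qed
    have "integrable M (block_sum m n t)"
      using block_sum_measurable[OF tT(1)] block_sum_second_moment(1)[OF tT(1)] by (rule square_integrable_imp_integrable)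
    then have Xi: "integrable M X"
      using integrable_real_mult_indicator[OF AM[OF t], of "block_sum m n t"] unfolding X_def by (simp add: mult.commute)
    have inc: "block_sum m n T \<omega> - block_sum m n t \<omega> = (\<Sum>k\<in>{m..<n}. c k * (B k T \<omega> - B k t \<omega>))" for \<omega>
      by (simp add: block_sum_def sum_subtractf right_diff_distrib)
    have cross: "X \<omega> * (block_sum m n T \<omega> - block_sum m n t \<omega>) = (\<Sum>k\<in>{m..<n}. c k * (X \<omega> * (B k T \<omega> - B k t \<omega>)))" for \<omega>
      unfolding inc by (simp add: sum_distrib_left mult_ac)
    have orth: "integrable M (\<lambda>\<omega>. X \<omega> * (block_sum m n T \<omega> - block_sum m n t \<omega>))"
      "expectation (\<lambda>\<omega>. X \<omega> * (block_sum m n T \<omega> - block_sum m n t \<omega>)) = 0"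
      unfolding cross using increment_orthogonal[OF tT XF Xi]
      by (simp_all add: Bochner_Integration.integral_sum)
    have ind: "integrable M (indicat_real (A t))" using AM[OF t] by (simp add: integrable_indicator_iff less_top[symmetric])
    have "r\<^sup>2 * prob (A t) = expectation (\<lambda>\<omega>. r\<^sup>2 * indicator (A t) \<omega> + 2 * (X \<omega> * (block_sum m n T \<omega> - block_sum m n t \<omega>)))"
      using orth ind AM[OF t] by simp
    also have "\<dots> \<le> expectation (\<lambda>\<omega>. indicator (A t) \<omega> * (block_sum m n T \<omega>)\<^sup>2)"
    proof (rule integral_mono)
      show "integrable M (\<lambda>\<omega>. r\<^sup>2 * indicator (A t) \<omega> + 2 * (X \<omega> * (block_sum m n T \<omega> - block_sum m n t \<omega>)))"
        using orth ind by simp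
      show "integrable M (\<lambda>\<omega>. indicator (A t) \<omega> * (block_sum m n T \<omega>)\<^sup>2)" by (rule iT[OF t])
      fix \<omega>
      show "r\<^sup>2 * indicator (A t) \<omega> + 2 * (X \<omega> * (block_sum m n T \<omega> - block_sum m n t \<omega>)) \<le> indicator (A t) \<omega> * (block_sum m n T \<omega>)\<^sup>2"
      proof (cases "\<omega> \<in> A t")
        case True
        then have "r\<^sup>2 \<le> (block_sum m n t \<omega>)\<^sup>2"
          using r by (auto simp: A_def abs_le_square_iff[symmetric])
        moreover have "(block_sum m n T \<omega>)\<^sup>2 = (block_sum m n t \<omega>)\<^sup>2 + 2 * (block_sum m n t \<omega> * (block_sum m n T \<omega> - block_sum m n t \<omega>)) + (block_sum m n T \<omega> - block_sum m n t \<omega>)\<^sup>2"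
          by (simp add: power2_eq_square algebra_simps)
        ultimately have "r\<^sup>2 + 2 * (block_sum m n t \<omega> * (block_sum m n T \<omega> - block_sum m n t \<omega>)) \<le> (block_sum m n T \<omega>)\<^sup>2"
          using zero_le_power2[of "block_sum m n T \<omega> - block_sum m n t \<omega>"] by linarith
        then show ?thesis using True by (simp add: X_def)
      qed (simp add: X_def)
    qed
    finally show ?thesis .
  qed
  have "r\<^sup>2 * prob (\<Union>t\<in>J. A t) = (\<Sum>t\<in>J. r\<^sup>2 * prob (A t))"
    using AM disj J by (subst finite_measure_finite_Union) (auto simp: sum_distrib_left)
  also have "\<dots> \<le> (\<Sum>t\<in>J. expectation (\<lambda>\<omega>. indicator (A t) \<omega> * (block_sum m n T \<omega>)\<^sup>2))"
    by (rule sum_mono[OF le])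
  also have "\<dots> = expectation (\<lambda>\<omega>. \<Sum>t\<in>J. indicator (A t) \<omega> * (block_sum m n T \<omega>)\<^sup>2)"
    by (rule Bochner_Integration.integral_sum[symmetric]) (rule iT)
  also have "\<dots> \<le> expectation (\<lambda>\<omega>. (block_sum m n T \<omega>)\<^sup>2)"
  proof (rule integral_mono[OF Bochner_Integration.integrable_sum[OF iT] Ti])
    fix \<omega>
    have "(\<Sum>t\<in>J. indicat_real (A t) \<omega>) = indicator (\<Union>t\<in>J. A t) \<omega>"
      using J disj by (intro indicator_UN_disjoint[symmetric])
    then show "(\<Sum>t\<in>J. indicator (A t) \<omega> * (block_sum m n T \<omega>)\<^sup>2) \<le> (block_sum m n T \<omega>)\<^sup>2"
      by (simp add: sum_distrib_right[symmetric] indicator_def)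
  qed
  also have "\<dots> = (\<Sum>k\<in>{m..<n}. (c k)\<^sup>2) * T" by (rule block_sum_second_moment[OF T])
  finally show ?thesis using r by (simp add: U field_simps)
qed

lemma block_sum_split: "m \<le> n \<Longrightarrow> n \<le> p \<Longrightarrow> block_sum m p t \<omega> = block_sum m n t \<omega> + block_sum n p t \<omega>"
  unfolding block_sum_def by (simp add: sum.atLeastLessThan_concat)

text \<open>Both events are expressed through the path-valued coordinates with indices below \<open>n\<close>,
  respectively from \<open>n\<close> on. They are written in exactly the form needed for the splitting
  according to the first index at which a partial sum exceeds a level.\<close>

lemma block_independent:
  assumes mn: "m \<le> n" and J: "finite J" "J \<subseteq> {0..}" "finite I" "\<And>j. j \<in> I \<Longrightarrow> m \<le> j \<and> j < n"
  shows "prob ({\<omega>\<in>space M. (\<exists>t\<in>J. a < \<bar>block_sum m n t \<omega>\<bar>) \<and> (\<forall>j\<in>I. \<forall>t\<in>J. \<bar>block_sum m j t \<omega>\<bar> \<le> a)}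
      \<inter> {\<omega>\<in>space M. \<forall>t\<in>J. \<bar>block_sum n p t \<omega>\<bar> \<le> b}) =
    prob {\<omega>\<in>space M. (\<exists>t\<in>J. a < \<bar>block_sum m n t \<omega>\<bar>) \<and> (\<forall>j\<in>I. \<forall>t\<in>J. \<bar>block_sum m j t \<omega>\<bar> \<le> a)}
      * prob {\<omega>\<in>space M. \<forall>t\<in>J. \<bar>block_sum n p t \<omega>\<bar> \<le> b}"
proof -
  let ?P = "\<lambda>K. PiM K (\<lambda>_. PiM {0..} (\<lambda>_. borel :: real measure)) :: (nat \<Rightarrow> real \<Rightarrow> real) measure"
  define Y where "Y K \<omega> = (\<lambda>k\<in>K. \<lambda>t\<in>{0..}. B k t \<omega>)" for K and \<omega> :: 'w
  define f where "f x m n t = (\<Sum>k\<in>{m..<n}. c k * x k t)" for x :: "nat \<Rightarrow> real \<Rightarrow> real" and m n t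
  have ind: "indep_var (?P {m..<n}) (Y {m..<n}) (?P {n..<p}) (Y {n..<p})"
    unfolding Y_def by (rule indep_var_restrict[OF independent]) auto
  have fY: "f (Y K \<omega>) i j t = block_sum i j t \<omega>" if "{i..<j} \<subseteq> K" "t \<in> J" for K i j t \<omega>
    unfolding f_def block_sum_def Y_def using that J(2) by (intro sum.cong refl) auto
  have coord: "(\<lambda>x. x k t) \<in> borel_measurable (?P K)" if "k \<in> K" "t \<in> J" for k t K
    by (rule measurable_compose[OF measurable_component_singleton[OF that(1)] measurable_component_singleton])
      (use that J(2) in auto)
  have fm: "(\<lambda>x. f x i j t) \<in> borel_measurable (?P K)" if "{i..<j} \<subseteq> K" "t \<in> J" for K i j t
    unfolding f_def using that
    by (intro borel_measurable_sum borel_measurable_times borel_measurable_const coord) auto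
  define U where "U = {x\<in>space (?P {m..<n}). (\<exists>t\<in>J. a < \<bar>f x m n t\<bar>) \<and> (\<forall>j\<in>I. \<forall>t\<in>J. \<bar>f x m j t\<bar> \<le> a)}"
  define V where "V = {x\<in>space (?P {n..<p}). \<forall>t\<in>J. \<bar>f x n p t\<bar> \<le> b}"
  have "Measurable.pred (?P {m..<n}) (\<lambda>x. \<exists>t\<in>J. a < \<bar>f x m n t\<bar>)"
  proof (rule pred_intros_finite(4)[OF J(1)])
    fix t assume "t \<in> J"
    then have [measurable]: "(\<lambda>x. f x m n t) \<in> borel_measurable (?P {m..<n})" by (intro fm) auto
    show "Measurable.pred (?P {m..<n}) (\<lambda>x. a < \<bar>f x m n t\<bar>)" by measurable
  qed
  moreover have "Measurable.pred (?P {m..<n}) (\<lambda>x. \<forall>j\<in>I. \<forall>t\<in>J. \<bar>f x m j t\<bar> \<le> a)"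
  proof (rule pred_intros_finite(3)[OF J(3)], rule pred_intros_finite(3)[OF J(1)])
    fix j t assume jt: "j \<in> I" "t \<in> J"
    then have "j < n" using J(4) by blast
    then have [measurable]: "(\<lambda>x. f x m j t) \<in> borel_measurable (?P {m..<n})" using jt by (intro fm) auto
    show "Measurable.pred (?P {m..<n}) (\<lambda>x. \<bar>f x m j t\<bar> \<le> a)" by measurable
  qed
  ultimately have "U \<in> sets (?P {m..<n})"
    unfolding U_def by (simp only: pred_def[symmetric] pred_intros_logic)
  moreover have "Measurable.pred (?P {n..<p}) (\<lambda>x. \<forall>t\<in>J. \<bar>f x n p t\<bar> \<le> b)"
  proof (rule pred_intros_finite(3)[OF J(1)])
    fix t assume "t \<in> J"
    then have [measurable]: "(\<lambda>x. f x n p t) \<in> borel_measurable (?P {n..<p})" by (intro fm) auto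
    show "Measurable.pred (?P {n..<p}) (\<lambda>x. \<bar>f x n p t\<bar> \<le> b)" by measurable
  qed
  then have "V \<in> sets (?P {n..<p})"
    unfolding V_def by (simp only: pred_def[symmetric])
  ultimately have prod: "prob ((\<lambda>\<omega>. (Y {m..<n} \<omega>, Y {n..<p} \<omega>)) -` (U \<times> V) \<inter> space M) =
      prob (Y {m..<n} -` U \<inter> space M) * prob (Y {n..<p} -` V \<inter> space M)"
    by (rule indep_varD[OF ind])
  have Ysp: "Y K \<omega> \<in> space (?P K)" for K \<omega>
    by (auto simp: space_PiM Y_def)
  have fS: "f (Y {m..<n} \<omega>) m j t = block_sum m j t \<omega>" if "j \<in> I" "t \<in> J" for j t \<omega>
    using J(4)[OF that(1)] that(2) by (intro fY) auto
  have U': "Y {m..<n} -` U \<inter> space M = {\<omega>\<in>space M. (\<exists>t\<in>J. a < \<bar>block_sum m n t \<omega>\<bar>) \<and> (\<forall>j\<in>I. \<forall>t\<in>J. \<bar>block_sum m j t \<omega>\<bar> \<le> a)}"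
    unfolding U_def using Ysp by (auto simp: fY fS)
  have V': "Y {n..<p} -` V \<inter> space M = {\<omega>\<in>space M. \<forall>t\<in>J. \<bar>block_sum n p t \<omega>\<bar> \<le> b}"
    unfolding V_def using Ysp by (auto simp: fY)
  have "(\<lambda>\<omega>. (Y {m..<n} \<omega>, Y {n..<p} \<omega>)) -` (U \<times> V) \<inter> space M =
      (Y {m..<n} -` U \<inter> space M) \<inter> (Y {n..<p} -` V \<inter> space M)" by auto
  with prod show ?thesis by (simp only: U' V')
qed

lemma block_sum_exceeds_sets:
  assumes "countable J" "J \<subseteq> {0..}" "countable I"
  shows "{\<omega>\<in>space M. \<exists>n\<in>I. \<exists>t\<in>J. a < \<bar>block_sum m n t \<omega>\<bar>} \<in> events"
proof -
  have "{\<omega>\<in>space M. a < \<bar>block_sum m n t \<omega>\<bar>} \<in> events" if "t \<in> J" for n t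
  proof -
    have [measurable]: "block_sum m n t \<in> borel_measurable M" using that assms by (intro block_sum_measurable) auto
    show ?thesis by measurable
  qed
  then have "(\<Union>n\<in>I. \<Union>t\<in>J. {\<omega>\<in>space M. a < \<bar>block_sum m n t \<omega>\<bar>}) \<in> events"
    using assms by (intro sets.countable_UN' ) auto
  also have "(\<Union>n\<in>I. \<Union>t\<in>J. {\<omega>\<in>space M. a < \<bar>block_sum m n t \<omega>\<bar>}) = {\<omega>\<in>space M. \<exists>n\<in>I. \<exists>t\<in>J. a < \<bar>block_sum m n t \<omega>\<bar>}"
    by auto
  finally show ?thesis .
qed

text \<open>Ottaviani's argument in the number of terms, applied to the maximum over \<open>J\<close>. If the sum exceeds
  \<open>2 * r\<close> for the first time at index \<open>n\<close>, then the remaining block, which is independent of this event,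
  stays below \<open>r\<close> with probability at least \<open>1 - v\<close>, and in that case the full sum still exceeds
  \<open>r\<close>. Hence the probability is at most \<open>v / (1 - v)\<close>; for \<open>v\<close> above one half the claimed bound
  \<open>2 * v\<close> exceeds one.\<close>

lemma maximal_inequality_partial_sums:
  assumes J: "finite J" "J \<subseteq> {0..T}" and T: "0 \<le> T" and r: "0 < r"
  shows "prob {\<omega>\<in>space M. \<exists>n\<in>{m..p}. \<exists>t\<in>J. 2 * r < \<bar>block_sum m n t \<omega>\<bar>}
    \<le> 2 * ((\<Sum>k\<in>{m..<p}. (c k)\<^sup>2) * T / r\<^sup>2)"
proof -
  define v where "v = (\<Sum>k\<in>{m..<p}. (c k)\<^sup>2) * T / r\<^sup>2"
  define A where "A n = {\<omega>\<in>space M. (\<exists>t\<in>J. 2 * r < \<bar>block_sum m n t \<omega>\<bar>) \<and> (\<forall>j\<in>{m..<n}. \<forall>t\<in>J. \<bar>block_sum m j t \<omega>\<bar> \<le> 2 * r)}" for n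
  define C where "C n = {\<omega>\<in>space M. \<forall>t\<in>J. \<bar>block_sum n p t \<omega>\<bar> \<le> r}" for n
  have J0: "J \<subseteq> {0..}" using J by auto
  have [measurable]: "{\<omega>\<in>space M. \<exists>t\<in>J. a < \<bar>block_sum i j t \<omega>\<bar>} \<in> events" for i j a
    using block_sum_exceeds_sets[OF countable_finite[OF J(1)] J0, of "{j}" a i] by simp
  have C_compl: "C n = space M - {\<omega>\<in>space M. \<exists>t\<in>J. r < \<bar>block_sum n p t \<omega>\<bar>}" for n
    unfolding C_def not_less[symmetric] by blast
  have CM: "C n \<in> events" for n unfolding C_compl by simp
  have AM: "A n \<in> events" for n
  proof -
    have "A n = {\<omega>\<in>space M. \<exists>t\<in>J. 2 * r < \<bar>block_sum m n t \<omega>\<bar>}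
        - {\<omega>\<in>space M. \<exists>j\<in>{m..<n}. \<exists>t\<in>J. 2 * r < \<bar>block_sum m j t \<omega>\<bar>}"
      unfolding A_def not_less[symmetric] by blast
    moreover have "{\<omega>\<in>space M. \<exists>j\<in>{m..<n}. \<exists>t\<in>J. 2 * r < \<bar>block_sum m j t \<omega>\<bar>} \<in> events"
      using J by (intro block_sum_exceeds_sets[OF _ J0] countable_finite) auto
    ultimately show ?thesis by simp
  qed
  have disj: "disjoint_family_on A {m..p}"
    unfolding disjoint_family_on_def
  proof (intro ballI impI)
    fix i j assume ij: "i \<in> {m..p}" "j \<in> {m..p}" "i \<noteq> j"
    have less: "A i \<inter> A j = {}" if "i < j" "m \<le> i" for i j
    proof (rule ccontr)
      assume "A i \<inter> A j \<noteq> {}"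
      then obtain \<omega> where "\<omega> \<in> A i" "\<omega> \<in> A j" by blast
      then obtain t where "t \<in> J" "2 * r < \<bar>block_sum m i t \<omega>\<bar>" "\<forall>j\<in>{m..<j}. \<forall>t\<in>J. \<bar>block_sum m j t \<omega>\<bar> \<le> 2 * r"
        unfolding A_def by blast
      then show False using that by (force simp: not_less[symmetric])
    qed
    show "A i \<inter> A j = {}"
      using less[of i j] less[of j i] ij by (cases "i < j") (simp_all add: Int_commute)
  qed
  have U: "{\<omega>\<in>space M. \<exists>n\<in>{m..p}. \<exists>t\<in>J. 2 * r < \<bar>block_sum m n t \<omega>\<bar>} \<subseteq> (\<Union>n\<in>{m..p}. A n)"
  proof
    fix \<omega> assume \<omega>: "\<omega> \<in> {\<omega>\<in>space M. \<exists>n\<in>{m..p}. \<exists>t\<in>J. 2 * r < \<bar>block_sum m n t \<omega>\<bar>}"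
    define Q where "Q n \<longleftrightarrow> n \<in> {m..p} \<and> (\<exists>t\<in>J. 2 * r < \<bar>block_sum m n t \<omega>\<bar>)" for n
    define n where "n = (LEAST n. Q n)"
    have "\<exists>n. Q n" using \<omega> unfolding Q_def by blast
    then have n: "Q n" unfolding n_def by (rule LeastI_ex)
    have "\<bar>block_sum m j t \<omega>\<bar> \<le> 2 * r" if "j \<in> {m..<n}" "t \<in> J" for j t
    proof (rule ccontr)
      assume "\<not> \<bar>block_sum m j t \<omega>\<bar> \<le> 2 * r"
      then have "Q j" using that n unfolding Q_def by (auto simp: not_le)
      then have "n \<le> j" unfolding n_def by (rule Least_le)
      then show False using that by simp
    qed
    then have "\<omega> \<in> A n" using \<omega> n unfolding A_def Q_def by blast
    then show "\<omega> \<in> (\<Union>n\<in>{m..p}. A n)" using n unfolding Q_def by blast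
  qed
  have v0: "0 \<le> v" unfolding v_def using T by (simp add: sum_nonneg)
  have Cprob: "1 - v \<le> prob (C n)" if n: "n \<in> {m..p}" for n
  proof -
    have "prob (C n) = 1 - prob {\<omega>\<in>space M. \<exists>t\<in>J. r < \<bar>block_sum n p t \<omega>\<bar>}"
      unfolding C_compl by (rule prob_compl) simp
    moreover have "prob {\<omega>\<in>space M. \<exists>t\<in>J. r < \<bar>block_sum n p t \<omega>\<bar>} \<le> (\<Sum>k\<in>{n..<p}. (c k)\<^sup>2) * T / r\<^sup>2"
      by (rule maximal_inequality_time[OF J T r])
    moreover have "(\<Sum>k\<in>{n..<p}. (c k)\<^sup>2) * T / r\<^sup>2 \<le> v"
      unfolding v_def using n T by (intro divide_right_mono mult_right_mono sum_mono2) auto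
    ultimately show ?thesis by linarith
  qed
  have "(\<Sum>n\<in>{m..p}. prob (A n)) * (1 - v) \<le> v"
  proof -
    have "(\<Sum>n\<in>{m..p}. prob (A n)) * (1 - v) \<le> (\<Sum>n\<in>{m..p}. prob (A n) * prob (C n))"
      unfolding sum_distrib_right by (intro sum_mono mult_left_mono Cprob) auto
    also have "\<dots> = (\<Sum>n\<in>{m..p}. prob (A n \<inter> C n))"
    proof (rule sum.cong[OF refl])
      fix n assume "n \<in> {m..p}"
      then show "prob (A n) * prob (C n) = prob (A n \<inter> C n)"
        unfolding A_def C_def using J by (intro block_independent[symmetric]) auto
    qed
    also have "\<dots> = prob (\<Union>n\<in>{m..p}. A n \<inter> C n)"
    proof (rule finite_measure_finite_Union[symmetric])
      show "disjoint_family_on (\<lambda>n. A n \<inter> C n) {m..p}"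
        using disj unfolding disjoint_family_on_def by blast
    qed (use AM CM in auto)
    also have "\<dots> \<le> prob {\<omega>\<in>space M. \<exists>t\<in>J. r < \<bar>block_sum m p t \<omega>\<bar>}"
    proof (rule finite_measure_mono, rule subsetI)
      fix \<omega> assume "\<omega> \<in> (\<Union>n\<in>{m..p}. A n \<inter> C n)"
      then obtain n where n: "n \<in> {m..p}" "\<omega> \<in> A n" "\<omega> \<in> C n" by blast
      then obtain t where t: "t \<in> J" "2 * r < \<bar>block_sum m n t \<omega>\<bar>" unfolding A_def by blast
      have "\<bar>block_sum n p t \<omega>\<bar> \<le> r" using n(3) t(1) unfolding C_def by blast
      then have "r < \<bar>block_sum m p t \<omega>\<bar>" using block_sum_split[of m n p t \<omega>] n(1) t(2) by simp
      then show "\<omega> \<in> {\<omega>\<in>space M. \<exists>t\<in>J. r < \<bar>block_sum m p t \<omega>\<bar>}" using n(2) t(1) unfolding A_def by blast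
    qed simp
    also have "\<dots> \<le> v" unfolding v_def by (rule maximal_inequality_time[OF J T r])
    finally show ?thesis .
  qed
  moreover have "prob {\<omega>\<in>space M. \<exists>n\<in>{m..p}. \<exists>t\<in>J. 2 * r < \<bar>block_sum m n t \<omega>\<bar>} \<le> (\<Sum>n\<in>{m..p}. prob (A n))"
    using finite_measure_mono[OF U] AM finite_measure_finite_Union[of "{m..p}" A, OF _ _ disj]
    by (auto simp: image_subset_iff)
  moreover have "prob {\<omega>\<in>space M. \<exists>n\<in>{m..p}. \<exists>t\<in>J. 2 * r < \<bar>block_sum m n t \<omega>\<bar>} \<le> 1" by simp
  moreover have "0 \<le> (\<Sum>n\<in>{m..p}. prob (A n))" by (simp add: sum_nonneg)
  \<comment> \<open>The final arithmetic, with \<open>s\<close> for the sum and \<open>x\<close> for the probability.\<close>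
  moreover have "x \<le> 2 * v" if "s * (1 - v) \<le> v" "x \<le> s" "x \<le> 1" "0 \<le> s" for x s :: real
  proof (cases "v \<le> 1 / 2")
    case True
    then have "s * (1 / 2) \<le> s * (1 - v)" using that by (intro mult_left_mono) auto
    then show ?thesis using that by linarith
  qed (use that in linarith)
  ultimately show ?thesis unfolding v_def[symmetric] by blast
qed

definition rational_times :: "real \<Rightarrow> real set" where
  "rational_times T = \<rat> \<inter> {0..T}"

lemma countable_rational_times: "countable (rational_times T)"
  unfolding rational_times_def using countable_rat by blast

context
  assumes c: "summable (\<lambda>k. (c k)\<^sup>2)"
begin

definition tail :: "nat \<Rightarrow> real" where
  "tail m = (\<Sum>k. (c k)\<^sup>2) - (\<Sum>k<m. (c k)\<^sup>2)"

lemma tail_tendsto: "tail \<longlonglongrightarrow> 0"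
  unfolding tail_def[abs_def]
  using tendsto_diff[OF tendsto_const summable_LIMSEQ[OF c], of "\<Sum>k. (c k)\<^sup>2"] by simp

lemma tail_bound: "(\<Sum>k\<in>{m..<n}. (c k)\<^sup>2) \<le> tail m"
proof (cases "m \<le> n")
  case True
  have "(\<Sum>k<m. (c k)\<^sup>2) + (\<Sum>k\<in>{m..<n}. (c k)\<^sup>2) = (\<Sum>k<n. (c k)\<^sup>2)"
    unfolding lessThan_atLeast0 using True by (simp add: sum.atLeastLessThan_concat)
  moreover have "(\<Sum>k<n. (c k)\<^sup>2) \<le> (\<Sum>k. (c k)\<^sup>2)"
    by (rule sum_le_suminf[OF c]) auto
  ultimately show ?thesis unfolding tail_def by linarith
next
  case False
  have "(\<Sum>k<m. (c k)\<^sup>2) \<le> (\<Sum>k. (c k)\<^sup>2)"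
    by (rule sum_le_suminf[OF c]) auto
  with False show ?thesis unfolding tail_def by simp
qed

definition exceeds :: "real \<Rightarrow> real \<Rightarrow> nat \<Rightarrow> 'w set" where
  "exceeds T a m = {\<omega>\<in>space M. \<exists>n\<in>{m..}. \<exists>t\<in>rational_times T. a < \<bar>block_sum m n t \<omega>\<bar>}"

lemma exceeds_events: "exceeds T a m \<in> events"
  unfolding exceeds_def
  by (rule block_sum_exceeds_sets[OF countable_rational_times]) (auto simp: rational_times_def)

text \<open>The maximal inequality is exhausted along finite index ranges and finite sets of rational times.\<close>

lemma prob_exceeds_le:
  assumes T: "0 \<le> T" and r: "0 < r"
  shows "prob (exceeds T (2 * r) m) \<le> 2 * (tail m * T / r\<^sup>2)"
proof -
  define q where "q = from_nat_into (rational_times T)"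
  have ne: "rational_times T \<noteq> {}" using T by (auto simp: rational_times_def)
  define E where "E p = {\<omega>\<in>space M. \<exists>n\<in>{m..p}. \<exists>t\<in>q ` {..p}. 2 * r < \<bar>block_sum m n t \<omega>\<bar>}" for p
  have q: "q i \<in> rational_times T" for i unfolding q_def by (rule from_nat_into[OF ne])
  have J: "q ` {..p} \<subseteq> {0..T}" for p using q by (auto simp: rational_times_def)
  have EM: "E p \<in> events" for p
    unfolding E_def using J[of p] by (intro block_sum_exceeds_sets) (auto intro: countable_finite)
  have inc: "incseq E" unfolding E_def by (intro monoI) (force intro: order_trans)
  have U: "(\<Union>p. E p) = exceeds T (2 * r) m"
  proof (intro equalityI subsetI)
    fix \<omega> assume "\<omega> \<in> (\<Union>p. E p)"
    then show "\<omega> \<in> exceeds T (2 * r) m" unfolding E_def exceeds_def using q by force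
  next
    fix \<omega> assume "\<omega> \<in> exceeds T (2 * r) m"
    then obtain n t where nt: "\<omega> \<in> space M" "m \<le> n" "t \<in> rational_times T" "2 * r < \<bar>block_sum m n t \<omega>\<bar>"
      unfolding exceeds_def by auto
    obtain i where i: "t = q i"
      unfolding q_def using from_nat_into_surj[OF countable_rational_times nt(3)] by metis
    have "\<omega> \<in> E (max n i)"
      unfolding E_def
      by (intro CollectI conjI bexI[of _ n] bexI[of _ t]) (use nt i in auto)
    then show "\<omega> \<in> (\<Union>p. E p)" by blast
  qed
  have "(\<lambda>p. prob (E p)) \<longlonglongrightarrow> prob (\<Union>p. E p)"
    by (rule finite_Lim_measure_incseq[OF _ inc]) (use EM in auto)
  moreover have "prob (E p) \<le> 2 * (tail m * T / r\<^sup>2)" for p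
  proof -
    have "prob (E p) \<le> 2 * ((\<Sum>k\<in>{m..<p}. (c k)\<^sup>2) * T / r\<^sup>2)"
      unfolding E_def by (rule maximal_inequality_partial_sums[OF _ J T r]) simp
    also have "\<dots> \<le> 2 * (tail m * T / r\<^sup>2)"
      using tail_bound[of m p] T by (intro mult_left_mono divide_right_mono mult_right_mono) auto
    finally show ?thesis .
  qed
  ultimately show ?thesis unfolding U by (intro LIMSEQ_le_const2) auto
qed

lemma AE_eventually_small:
  assumes T: "0 \<le> T" and r: "0 < r"
  shows "AE \<omega> in M. \<exists>m. \<omega> \<notin> exceeds T (2 * r) m"
proof (rule AE_I)
  let ?N = "\<Inter>m. exceeds T (2 * r) m"
  show "{\<omega>\<in>space M. \<not> (\<exists>m. \<omega> \<notin> exceeds T (2 * r) m)} \<subseteq> ?N" by auto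
  show N: "?N \<in> events" using exceeds_events by auto
  have "prob ?N \<le> 0"
  proof (rule LIMSEQ_le_const)
    have "(\<lambda>m. 2 * (tail m * T / r\<^sup>2)) \<longlonglongrightarrow> 2 * (0 * T / r\<^sup>2)"
      using r by (intro tendsto_intros tail_tendsto) auto
    then show "(\<lambda>m. 2 * (tail m * T / r\<^sup>2)) \<longlonglongrightarrow> 0" by simp
    have "prob ?N \<le> 2 * (tail m * T / r\<^sup>2)" for m
      using finite_measure_mono[of ?N "exceeds T (2 * r) m"] exceeds_events prob_exceeds_le[OF T r, of m]
      by (meson INF_lower UNIV_I order_trans)
    then show "\<exists>N. \<forall>m\<ge>N. prob ?N \<le> 2 * (tail m * T / r\<^sup>2)" by blast
  qed
  then show "emeasure M ?N = 0" by (simp add: emeasure_eq_measure measure_le_0_iff)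
qed

lemma uniformly_convergent_if_eventually_small:
  assumes T: "0 \<le> T" and \<omega>: "\<omega> \<in> space M"
    and cont: "\<And>k. continuous_on {0..} (\<lambda>t. B k t \<omega>)"
    and small: "\<And>j. \<exists>m. \<omega> \<notin> exceeds T (2 * (1 / real (Suc j))) m"
  shows "uniformly_convergent_on {0..T} (\<lambda>n t. \<Sum>k<n. c k * B k t \<omega>)"
proof (rule Cauchy_uniformly_convergent)
  have Sc: "continuous_on {0..T} (\<lambda>t. block_sum m n t \<omega>)" for m n
    unfolding block_sum_def by (intro continuous_intros continuous_on_subset[OF cont]) auto
  show "uniformly_Cauchy_on {0..T} (\<lambda>n t. \<Sum>k<n. c k * B k t \<omega>)"
    unfolding uniformly_Cauchy_on_def
  proof (intro allI impI)
    fix e :: real assume "0 < e"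
    then obtain j where j: "4 * (1 / real (Suc j)) < e"
      using reals_Archimedean[of "e / 4"] by (auto simp: field_simps)
    obtain m where m: "\<omega> \<notin> exceeds T (2 * (1 / real (Suc j))) m" using small by blast
    have le: "\<bar>block_sum m n t \<omega>\<bar> \<le> 2 * (1 / real (Suc j))" if n: "m \<le> n" and t: "t \<in> {0..T}" for n t
    proof (rule LIMSEQ_le_const2)
      let ?q = "\<lambda>i. of_int \<lfloor>real i * t\<rfloor> / real i"
      have qT: "?q i \<in> {0..T}" for i
        using floor_grid_le[of t i] t by (auto intro!: divide_nonneg_nonneg)
      have "(\<lambda>i. block_sum m n (?q i) \<omega>) \<longlonglongrightarrow> block_sum m n t \<omega>"
        using t qT by (intro continuous_on_tendsto_compose[OF Sc floor_grid_tendsto]) auto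
      then show "(\<lambda>i. \<bar>block_sum m n (?q i) \<omega>\<bar>) \<longlonglongrightarrow> \<bar>block_sum m n t \<omega>\<bar>" by (rule tendsto_rabs)
      have "?q i \<in> rational_times T" for i using qT by (auto simp: rational_times_def)
      then have "\<bar>block_sum m n (?q i) \<omega>\<bar> \<le> 2 * (1 / real (Suc j))" for i
        using m n \<omega> unfolding exceeds_def by (auto simp: not_less)
      then show "\<exists>N. \<forall>i\<ge>N. \<bar>block_sum m n (?q i) \<omega>\<bar> \<le> 2 * (1 / real (Suc j))" by blast
    qed
    have split: "(\<Sum>k<n. c k * B k t \<omega>) = (\<Sum>k<m. c k * B k t \<omega>) + block_sum m n t \<omega>" if "m \<le> n" for n t
      unfolding block_sum_def lessThan_atLeast0 using that by (simp add: sum.atLeastLessThan_concat)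
    show "\<exists>K. \<forall>t\<in>{0..T}. \<forall>n\<ge>K. \<forall>p\<ge>K. dist (\<Sum>k<n. c k * B k t \<omega>) (\<Sum>k<p. c k * B k t \<omega>) < e"
    proof (intro exI[of _ m] ballI allI impI)
      fix t n p assume t: "t \<in> {0..T}" and n: "m \<le> n" and p: "m \<le> p"
      have "dist (\<Sum>k<n. c k * B k t \<omega>) (\<Sum>k<p. c k * B k t \<omega>) = \<bar>block_sum m n t \<omega> - block_sum m p t \<omega>\<bar>"
        unfolding split[OF n] split[OF p] by (simp add: dist_real_def)
      also have "\<dots> < e" using le[OF n t] le[OF p t] j by linarith
      finally show "dist (\<Sum>k<n. c k * B k t \<omega>) (\<Sum>k<p. c k * B k t \<omega>) < e" .
    qed
  qed
qed

text \<open>Almost surely, for every time horizon and every tolerance, all late partial sums are close to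
  each other at rational times. Continuity of the paths extends this to real times, and a uniform
  limit of continuous functions is continuous.\<close>

lemma AE_series_continuous:
  "AE \<omega> in M. (\<forall>t\<ge>0. summable (\<lambda>k. c k * B k t \<omega>)) \<and> continuous_on {0..} (\<lambda>t. \<Sum>k. c k * B k t \<omega>)"
proof -
  have "AE \<omega> in M. \<forall>T j. \<exists>m. \<omega> \<notin> exceeds (real T) (2 * (1 / real (Suc j))) m"
    unfolding AE_all_countable by (intro allI AE_eventually_small) auto
  moreover have "AE \<omega> in M. \<forall>k. continuous_on {0..} (\<lambda>t. B k t \<omega>)"
    unfolding AE_all_countable by (intro allI brownian_motionD(3)[OF brownian])
  moreover have "AE \<omega> in M. \<omega> \<in> space M" by simp
  ultimately show ?thesis
  proof eventually_elim
    case (elim \<omega>)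
    let ?P = "\<lambda>n t. \<Sum>k<n. c k * B k t \<omega>"
    have "uniformly_convergent_on {0..real T} ?P" for T
      using elim by (intro uniformly_convergent_if_eventually_small) auto
    then have lim: "uniform_limit {0..real T} ?P (\<lambda>t. lim (\<lambda>n. ?P n t)) sequentially" for T
      by (simp only: uniformly_convergent_uniform_limit_iff)
    have sums: "(\<lambda>k. c k * B k t \<omega>) sums lim (\<lambda>n. ?P n t)" if t: "0 \<le> t" for t
    proof -
      obtain T where "t \<le> real T" using real_arch_simple by blast
      then show ?thesis
        unfolding sums_def using t by (intro tendsto_uniform_limitI[OF lim[of T]]) auto
    qed
    have "continuous_on {0..} (\<lambda>t. lim (\<lambda>n. ?P n t))"
    proof (rule continuous_on_halfline, rule uniform_limit_theorem[OF _ lim])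
      have "continuous_on {0..real T} (?P n)" for T n
        using elim by (intro continuous_intros) (auto intro: continuous_on_subset)
      then show "\<forall>\<^sub>F n in sequentially. continuous_on {0..real T} (?P n)" for T
        by (rule always_eventually[OF allI])
    qed simp
    moreover have "continuous_on {0..} (\<lambda>t. lim (\<lambda>n. ?P n t)) = continuous_on {0..} (\<lambda>t. \<Sum>k. c k * B k t \<omega>)"
      by (rule continuous_on_cong) (auto simp: sums_unique[OF sums])
    ultimately show ?case using sums by (auto intro: sums_summable)
  qed
qed

end

end

section \<open>The drift of the scheme\<close>

lemma succ_mod_in: "i \<in> {1..N} \<Longrightarrow> succ_mod N i \<in> {1..N}"
  and pred_mod_in: "i \<in> {1..N} \<Longrightarrow> pred_mod N i \<in> {1..N}"
  and succ_pred_mod: "i \<in> {1..N} \<Longrightarrow> succ_mod N (pred_mod N i) = i"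
  and pred_succ_mod: "i \<in> {1..N} \<Longrightarrow> pred_mod N (succ_mod N i) = i"
  by (auto simp: succ_mod_def pred_mod_def)

lemma sum_pred_mod: "(\<Sum>i=1..N. f (pred_mod N i)) = (\<Sum>i=1..N. f i)"
  by (rule sum.reindex_bij_witness[where i="succ_mod N" and j="pred_mod N"])
    (simp_all add: succ_mod_in pred_mod_in succ_pred_mod pred_succ_mod del: atLeastAtMost_iff One_nat_def)

definition l1norm :: "nat \<Rightarrow> (nat \<Rightarrow> real) \<Rightarrow> real" where
  "l1norm N v = (\<Sum>i=1..N. \<bar>v i\<bar>)"

lemma l1norm_nonneg: "0 \<le> l1norm N v"
  by (simp add: l1norm_def sum_nonneg)

lemma abs_le_l1norm: "i \<in> {1..N} \<Longrightarrow> \<bar>v i\<bar> \<le> l1norm N v"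
  unfolding l1norm_def by (rule member_le_sum) auto

lemma l1norm_triangle: "l1norm N (\<lambda>i. v i + w i) \<le> l1norm N v + l1norm N w"
  unfolding l1norm_def sum.distrib[symmetric] by (intro sum_mono abs_triangle_ineq)

lemma l1norm_scale: "l1norm N (\<lambda>i. c * v i) = \<bar>c\<bar> * l1norm N v"
  by (simp add: l1norm_def abs_mult sum_distrib_left)

lemma l1norm_cong: "(\<And>i. i \<in> {1..N} \<Longrightarrow> v i = w i) \<Longrightarrow> l1norm N v = l1norm N w"
  by (simp add: l1norm_def)

text \<open>Convective and diffusive flux through the interface between the cells \<open>i\<close> and \<open>i + 1\<close>. The
  diffusive part is increasing in \<open>v i\<close> and decreasing in the neighbour, like a
  monotone convective flux, so both can be treated together.\<close>

definition total_flux :: "nat \<Rightarrow> real \<Rightarrow> (real \<times> real \<Rightarrow> real) \<Rightarrow> (nat \<Rightarrow> real) \<Rightarrow> nat \<Rightarrow> real" where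
  "total_flux N \<nu> \<Phi> v i =
    real N * \<Phi> (v i, v (succ_mod N i)) - \<nu> * (real N)\<^sup>2 * (v (succ_mod N i) - v i)"

lemma drift_eq_total_flux:
  assumes "i \<in> {1..N}"
  shows "drift N \<nu> \<Phi> v i = total_flux N \<nu> \<Phi> v (pred_mod N i) - total_flux N \<nu> \<Phi> v i"
  using assms pred_mod_in[OF assms] succ_pred_mod[OF assms]
  unfolding drift_def D1_minus_def D2_def D1_plus_def num_flux_def total_flux_def
  by (simp add: algebra_simps power2_eq_square del: atLeastAtMost_iff)

lemma sum_drift: "(\<Sum>i=1..N. drift N \<nu> \<Phi> v i) = 0"
  by (simp add: drift_eq_total_flux sum_subtractf sum_pred_mod del: atLeastAtMost_iff One_nat_def)

lemma drift_cong:
  assumes "\<And>i. i \<in> {1..N} \<Longrightarrow> v i = w i" "i \<in> {1..N}"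
    and "\<And>i j. i \<in> {1..N} \<Longrightarrow> j \<in> {1..N} \<Longrightarrow> \<Phi> (w i, w j) = \<Phi>' (w i, w j)"
  shows "drift N \<nu> \<Phi> v i = drift N \<nu> \<Phi>' w i"
  using assms succ_mod_in pred_mod_in
  by (simp add: drift_eq_total_flux total_flux_def del: atLeastAtMost_iff)

lemma drift_continuous_on:
  assumes \<Phi>: "continuous_on UNIV \<Phi>"
    and u: "\<And>i. i \<in> {1..N} \<Longrightarrow> continuous_on S (\<lambda>t. u t i)" and i: "i \<in> {1..N}"
  shows "continuous_on S (\<lambda>t. drift N \<nu> \<Phi> (u t) i)"
  unfolding drift_eq_total_flux[OF i] total_flux_def
  using i by (intro continuous_intros continuous_on_compose2[OF \<Phi>] u succ_mod_in pred_mod_in) auto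

text \<open>A mean value theorem without derivatives: difference quotients of a nondecreasing Lipschitz
  function lie between zero and the Lipschitz constant.\<close>

lemma nondecreasing_lipschitz_slope:
  fixes f :: "real \<Rightarrow> real"
  assumes mono: "\<And>x y. x \<le> y \<Longrightarrow> f x \<le> f y" and lip: "\<And>x y. \<bar>f x - f y\<bar> \<le> K * \<bar>x - y\<bar>"
  obtains \<alpha> where "0 \<le> \<alpha>" "\<alpha> \<le> K" "f x - f y = \<alpha> * (x - y)"
proof (cases "x = y")
  case True
  have "0 \<le> K" using order_trans[OF abs_ge_zero lip[of 1 0]] by simp
  with True that[of 0] show ?thesis by simp
next
  case False
  have "f x - f y = (f x - f y) / (x - y) * (x - y)" using False by simp
  moreover have "0 \<le> (f x - f y) / (x - y)"
    using mono[of x y] mono[of y x] by (cases "x \<le> y") (simp_all add: divide_nonpos_nonpos)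
  moreover have "\<bar>(f x - f y) / (x - y)\<bar> \<le> K"
    using lip[of x y] False by (simp add: abs_divide pos_divide_le_eq)
  ultimately show ?thesis using that[of "(f x - f y) / (x - y)"] by linarith
qed

section \<open>Contraction in $\ell^1$ for monotone Lipschitz fluxes\<close>

lemma continuous_lborel_integral_eq:
  fixes f :: "real \<Rightarrow> real"
  assumes "continuous_on {a..b} f"
  shows "(LINT s:{a..b}|lborel. f s) = integral {a..b} f"
  by (rule set_borel_integral_eq_integral(2)) (rule borel_integrable_atLeastAtMost'[OF assms])

lemma integral_increment_error:
  fixes f :: "real \<Rightarrow> real"
  assumes f: "continuous_on {0..t + h} f" and t: "0 \<le> t" "0 \<le> h"
    and e: "\<And>s. s \<in> {t..t + h} \<Longrightarrow> \<bar>f s - f t\<bar> \<le> \<epsilon>"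
  shows "\<bar>integral {0..t + h} f - integral {0..t} f - h * f t\<bar> \<le> h * \<epsilon>"
proof -
  have i: "f integrable_on {0..t + h}" by (rule integrable_continuous_real[OF f])
  have "integral {0..t} f + integral {t..t + h} f = integral {0..t + h} f"
    by (rule Henstock_Kurzweil_Integration.integral_combine) (use t i in auto)
  moreover have ft: "continuous_on {t..t + h} f"
    using t by (intro continuous_on_subset[OF f]) auto
  have "integral {t..t + h} (\<lambda>s. f s - f t) = integral {t..t + h} f - h * f t"
    using t integrable_continuous_real[OF ft] by (subst integral_diff) auto
  moreover have "norm (integral {t..t + h} (\<lambda>s. f s - f t)) \<le> \<epsilon> * (t + h - t)"
    using t e by (intro integral_bound continuous_intros ft) auto
  ultimately show ?thesis by (simp add: mult.commute)
qed

lemma uniformly_close_on_fine_grid: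
  fixes f :: "real \<Rightarrow> real"
  assumes f: "continuous_on {0..T} f" and \<epsilon>: "0 < \<epsilon>"
  shows "\<forall>\<^sub>F n in sequentially. \<forall>s\<in>{0..T}. \<forall>t\<in>{0..T}. \<bar>s - t\<bar> \<le> T / real n \<longrightarrow> \<bar>f s - f t\<bar> \<le> \<epsilon>"
proof -
  have "uniformly_continuous_on {0..T} f"
    by (rule compact_uniformly_continuous[OF f]) simp
  then obtain \<delta> where \<delta>: "0 < \<delta>" "\<And>s t. s \<in> {0..T} \<Longrightarrow> t \<in> {0..T} \<Longrightarrow> \<bar>s - t\<bar> < \<delta> \<Longrightarrow> \<bar>f s - f t\<bar> < \<epsilon>"
    using \<epsilon> unfolding uniformly_continuous_on_def dist_real_def by metis
  have "(\<lambda>n. T / real n) \<longlonglongrightarrow> 0" by (rule lim_const_over_n)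
  then have "\<forall>\<^sub>F n in sequentially. T / real n < \<delta>"
    using \<delta>(1) by (rule order_tendstoD)
  then show ?thesis
    by eventually_elim (use \<delta>(2) in \<open>fastforce intro: less_imp_le\<close>)
qed

lemma uniform_limit_sum:
  fixes f :: "'i \<Rightarrow> 'n \<Rightarrow> 'a \<Rightarrow> real"
  assumes "finite A" "\<And>j. j \<in> A \<Longrightarrow> uniform_limit S (f j) (g j) F"
  shows "uniform_limit S (\<lambda>n s. \<Sum>j\<in>A. f j n s) (\<lambda>s. \<Sum>j\<in>A. g j s) F"
  using assms by (induction A) (auto intro!: uniform_limit_add uniform_limit_const)

locale monotone_scheme =
  fixes N :: nat and \<nu> :: real and \<Phi> :: "real \<times> real \<Rightarrow> real"
  assumes N: "1 \<le> N" and \<nu>: "0 \<le> \<nu>"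
    and mono_fst: "a \<le> a' \<Longrightarrow> \<Phi> (a, b) \<le> \<Phi> (a', b)"
    and mono_snd: "b \<le> b' \<Longrightarrow> \<Phi> (a, b') \<le> \<Phi> (a, b)"

locale lipschitz_scheme = monotone_scheme +
  fixes L :: real
  assumes lip_fst: "\<bar>\<Phi> (a, b) - \<Phi> (a', b)\<bar> \<le> L * \<bar>a - a'\<bar>"
    and lip_snd: "\<bar>\<Phi> (a, b) - \<Phi> (a, b')\<bar> \<le> L * \<bar>b - b'\<bar>"
begin

text \<open>A Lipschitz constant of the total flux in each argument; the summand 1 makes it positive, so
  that it can be divided by.\<close>

definition K :: real where "K = real N * L + \<nu> * (real N)\<^sup>2 + 1"

lemma L_nonneg: "0 \<le> L"
  using order_trans[OF abs_ge_zero lip_fst[of 1 0 0]] by simp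

lemma K_pos: "0 < K"
  using L_nonneg \<nu> by (simp add: K_def add_nonneg_pos)

text \<open>The increment of the flux is linearised with nonnegative slopes \<open>\<alpha>\<close> and \<open>\<beta>\<close>: the first
  argument is changed with the second one fixed at its value for \<open>u\<close>, then the second one with the first
  fixed at its value for \<open>w\<close>.\<close>

lemma total_flux_diff:
  obtains \<alpha> \<beta> where "0 \<le> \<alpha>" "\<alpha> \<le> K" "0 \<le> \<beta>" "\<beta> \<le> K"
    "total_flux N \<nu> \<Phi> u i - total_flux N \<nu> \<Phi> w i =
      \<alpha> * (u i - w i) - \<beta> * (u (succ_mod N i) - w (succ_mod N i))"
proof -
  let ?s = "succ_mod N i"
  have c: "0 \<le> \<nu> * (real N)\<^sup>2" using \<nu> by simp
  define f where "f a = real N * \<Phi> (a, u ?s) + \<nu> * (real N)\<^sup>2 * a" for a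
  define h where "h b = \<nu> * (real N)\<^sup>2 * b - real N * \<Phi> (w i, b)" for b
  have fm: "f a \<le> f a'" if "a \<le> a'" for a a'
    unfolding f_def using mono_fst[OF that] that c by (intro add_mono mult_left_mono) auto
  have hm: "h a \<le> h a'" if "a \<le> a'" for a a'
    unfolding h_def using mono_snd[OF that] that c by (intro diff_mono mult_left_mono) auto
  have fl: "\<bar>f a - f a'\<bar> \<le> K * \<bar>a - a'\<bar>" for a a'
  proof -
    have "f a - f a' = real N * (\<Phi> (a, u ?s) - \<Phi> (a', u ?s)) + \<nu> * (real N)\<^sup>2 * (a - a')"
      by (simp add: f_def algebra_simps)
    also have "\<bar>\<dots>\<bar> \<le> real N * \<bar>\<Phi> (a, u ?s) - \<Phi> (a', u ?s)\<bar> + \<nu> * (real N)\<^sup>2 * \<bar>a - a'\<bar>"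
      by (rule order_trans[OF abs_triangle_ineq]) (use \<nu> in \<open>simp add: abs_mult\<close>)
    also have "\<dots> \<le> real N * (L * \<bar>a - a'\<bar>) + \<nu> * (real N)\<^sup>2 * \<bar>a - a'\<bar>"
      by (intro add_right_mono mult_left_mono lip_fst) simp
    also have "\<dots> \<le> K * \<bar>a - a'\<bar>" by (simp add: K_def algebra_simps)
    finally show ?thesis .
  qed
  have hl: "\<bar>h b - h b'\<bar> \<le> K * \<bar>b - b'\<bar>" for b b'
  proof -
    have "h b - h b' = \<nu> * (real N)\<^sup>2 * (b - b') - real N * (\<Phi> (w i, b) - \<Phi> (w i, b'))"
      by (simp add: h_def algebra_simps)
    also have "\<bar>\<dots>\<bar> \<le> \<nu> * (real N)\<^sup>2 * \<bar>b - b'\<bar> + real N * \<bar>\<Phi> (w i, b) - \<Phi> (w i, b')\<bar>"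
      by (rule order_trans[OF abs_triangle_ineq4]) (use \<nu> in \<open>simp add: abs_mult\<close>)
    also have "\<dots> \<le> \<nu> * (real N)\<^sup>2 * \<bar>b - b'\<bar> + real N * (L * \<bar>b - b'\<bar>)"
      by (intro add_left_mono mult_left_mono lip_snd) simp
    also have "\<dots> \<le> K * \<bar>b - b'\<bar>" by (simp add: K_def algebra_simps)
    finally show ?thesis .
  qed
  obtain \<alpha> where \<alpha>: "0 \<le> \<alpha>" "\<alpha> \<le> K" "f (u i) - f (w i) = \<alpha> * (u i - w i)"
    by (rule nondecreasing_lipschitz_slope[OF fm fl])
  obtain \<beta> where \<beta>: "0 \<le> \<beta>" "\<beta> \<le> K" "h (u ?s) - h (w ?s) = \<beta> * (u ?s - w ?s)"
    by (rule nondecreasing_lipschitz_slope[OF hm hl])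
  have "total_flux N \<nu> \<Phi> u i - total_flux N \<nu> \<Phi> w i = (f (u i) - f (w i)) - (h (u ?s) - h (w ?s))"
    by (simp add: total_flux_def f_def h_def algebra_simps)
  with \<alpha> \<beta> that show ?thesis by simp
qed

text \<open>Inserting the linearised fluxes, the difference after the step is a combination of the differences
  at \<open>i\<close> and its two neighbours. The step size restriction makes all coefficients nonnegative, and
  what leaves one cell enters the next, so the coefficients with which a given cell contributes sum up
  to 1.\<close>

lemma euler_step_contraction:
  assumes h: "0 \<le> h" "2 * h * K \<le> 1"
  shows "l1norm N (\<lambda>i. (u i - w i) + h * (drift N \<nu> \<Phi> u i - drift N \<nu> \<Phi> w i))
    \<le> l1norm N (\<lambda>i. u i - w i)"
proof -
  have "\<forall>i. \<exists>\<alpha> \<beta>. 0 \<le> \<alpha> \<and> \<alpha> \<le> K \<and> 0 \<le> \<beta> \<and> \<beta> \<le> K \<and>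
    total_flux N \<nu> \<Phi> u i - total_flux N \<nu> \<Phi> w i =
      \<alpha> * (u i - w i) - \<beta> * (u (succ_mod N i) - w (succ_mod N i))"
    using total_flux_diff by metis
  then obtain \<alpha> \<beta> where
    ab: "\<And>i. 0 \<le> \<alpha> i" "\<And>i. \<alpha> i \<le> K" "\<And>i. 0 \<le> \<beta> i" "\<And>i. \<beta> i \<le> K"
    and eq: "\<And>i. total_flux N \<nu> \<Phi> u i - total_flux N \<nu> \<Phi> w i =
      \<alpha> i * (u i - w i) - \<beta> i * (u (succ_mod N i) - w (succ_mod N i))"
    by metis
  define d where "d i = u i - w i" for i
  let ?p = "pred_mod N" and ?s = "succ_mod N"
  have le: "\<bar>d i + h * (drift N \<nu> \<Phi> u i - drift N \<nu> \<Phi> w i)\<bar>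
      \<le> (1 - h * \<alpha> i - h * \<beta> (?p i)) * \<bar>d i\<bar> + h * \<alpha> (?p i) * \<bar>d (?p i)\<bar> + h * \<beta> i * \<bar>d (?s i)\<bar>"
    if i: "i \<in> {1..N}" for i
  proof -
    have "drift N \<nu> \<Phi> u i - drift N \<nu> \<Phi> w i =
      (total_flux N \<nu> \<Phi> u (?p i) - total_flux N \<nu> \<Phi> w (?p i)) - (total_flux N \<nu> \<Phi> u i - total_flux N \<nu> \<Phi> w i)"
      by (simp only: drift_eq_total_flux[OF i])
    also have "\<dots> = (\<alpha> (?p i) * d (?p i) - \<beta> (?p i) * d i) - (\<alpha> i * d i - \<beta> i * d (?s i))"
      by (simp only: eq d_def succ_pred_mod[OF i])
    finally have e: "drift N \<nu> \<Phi> u i - drift N \<nu> \<Phi> w i = \<dots>" .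
    have "d i + h * (drift N \<nu> \<Phi> u i - drift N \<nu> \<Phi> w i) =
      (1 - h * \<alpha> i - h * \<beta> (?p i)) * d i + h * \<alpha> (?p i) * d (?p i) + h * \<beta> i * d (?s i)"
      unfolding e by (simp add: algebra_simps)
    also have "\<bar>\<dots>\<bar> \<le> \<bar>(1 - h * \<alpha> i - h * \<beta> (?p i)) * d i\<bar> + \<bar>h * \<alpha> (?p i) * d (?p i)\<bar> + \<bar>h * \<beta> i * d (?s i)\<bar>"
      by linarith
    also have "\<dots> = (1 - h * \<alpha> i - h * \<beta> (?p i)) * \<bar>d i\<bar> + h * \<alpha> (?p i) * \<bar>d (?p i)\<bar> + h * \<beta> i * \<bar>d (?s i)\<bar>"
    proof -
      have "h * \<alpha> i \<le> h * K" "h * \<beta> (?p i) \<le> h * K" using ab h by (auto intro: mult_left_mono)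
      then have "0 \<le> 1 - h * \<alpha> i - h * \<beta> (?p i)" using h(2) by linarith
      then show ?thesis using ab h by (simp add: abs_mult)
    qed
    finally show ?thesis .
  qed
  have "l1norm N (\<lambda>i. d i + h * (drift N \<nu> \<Phi> u i - drift N \<nu> \<Phi> w i)) \<le>
    (\<Sum>i=1..N. (1 - h * \<alpha> i - h * \<beta> (?p i)) * \<bar>d i\<bar> + h * \<alpha> (?p i) * \<bar>d (?p i)\<bar> + h * \<beta> i * \<bar>d (?s i)\<bar>)"
    unfolding l1norm_def by (rule sum_mono[OF le])
  also have "\<dots> = (\<Sum>i=1..N. \<bar>d i\<bar>)
      + ((\<Sum>i=1..N. h * \<alpha> (?p i) * \<bar>d (?p i)\<bar>) - (\<Sum>i=1..N. h * \<alpha> i * \<bar>d i\<bar>))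
      - ((\<Sum>i=1..N. h * \<beta> (?p i) * \<bar>d (?s (?p i))\<bar>) - (\<Sum>i=1..N. h * \<beta> i * \<bar>d (?s i)\<bar>))"
    by (simp add: succ_pred_mod sum.distrib sum_subtractf left_diff_distrib del: atLeastAtMost_iff)
  also have "\<dots> = l1norm N d"
    using sum_pred_mod[of "\<lambda>i. h * \<alpha> i * \<bar>d i\<bar>" N] sum_pred_mod[of "\<lambda>i. h * \<beta> i * \<bar>d (?s i)\<bar>" N]
    by (simp add: l1norm_def)
  finally show ?thesis by (simp add: d_def[abs_def])
qed

text \<open>A consequence of the contraction: \<open>h\<close> times the difference of the drifts is the difference
  between the state after and before an Euler step, both of which are bounded by the initial distance.
  The largest admissible \<open>h\<close> gives the constant.\<close>

lemma drift_lipschitz: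
  "l1norm N (\<lambda>i. drift N \<nu> \<Phi> u i - drift N \<nu> \<Phi> w i) \<le> 4 * K * l1norm N (\<lambda>i. u i - w i)"
proof -
  let ?h = "1 / (2 * K)"
  let ?b = "\<lambda>i. drift N \<nu> \<Phi> u i - drift N \<nu> \<Phi> w i" and ?d = "\<lambda>i. u i - w i"
  have h: "?h > 0" using K_pos by simp
  have "?h * l1norm N ?b = l1norm N (\<lambda>i. ?h * ?b i)"
    using h by (simp only: l1norm_scale abs_of_pos)
  also have "\<dots> = l1norm N (\<lambda>i. (?d i + ?h * ?b i) + (-1) * ?d i)"
    by (rule l1norm_cong) simp
  also have "\<dots> \<le> l1norm N (\<lambda>i. ?d i + ?h * ?b i) + l1norm N (\<lambda>i. (-1) * ?d i)"
    by (rule l1norm_triangle)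
  also have "\<dots> \<le> l1norm N ?d + l1norm N ?d"
    unfolding l1norm_scale using K_pos by (intro add_mono euler_step_contraction) auto
  finally show ?thesis using K_pos by (simp add: field_simps)
qed

lemma continuous_flux: "continuous_on UNIV \<Phi>"
proof -
  have "\<bar>\<Phi> p - \<Phi> q\<bar> \<le> 2 * L * dist p q" for p q
  proof -
    have "\<bar>\<Phi> p - \<Phi> q\<bar> \<le> \<bar>\<Phi> (fst p, snd p) - \<Phi> (fst q, snd p)\<bar> + \<bar>\<Phi> (fst q, snd p) - \<Phi> (fst q, snd q)\<bar>"
      by simp
    also have "\<dots> \<le> L * \<bar>fst p - fst q\<bar> + L * \<bar>snd p - snd q\<bar>"
      by (intro add_mono lip_fst lip_snd)
    also have "\<dots> \<le> L * dist p q + L * dist p q"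
      using L_nonneg dist_fst_le[of p q] dist_snd_le[of p q]
      by (intro add_mono mult_left_mono) (auto simp: dist_real_def)
    finally show ?thesis by simp
  qed
  then have "(2 * L)-lipschitz_on UNIV \<Phi>"
    using L_nonneg by (intro lipschitz_onI) (auto simp: dist_real_def)
  then show ?thesis by (rule lipschitz_on_continuous_on)
qed

lemmas drift_continuous = drift_continuous_on[OF continuous_flux]

lemma drift_measurable:
  assumes u: "\<And>i. i \<in> {1..N} \<Longrightarrow> (\<lambda>\<omega>. u \<omega> i) \<in> borel_measurable G" and i: "i \<in> {1..N}"
  shows "(\<lambda>\<omega>. drift N \<nu> \<Phi> (u \<omega>) i) \<in> borel_measurable G"
proof -
  have [measurable]: "\<Phi> \<in> borel_measurable borel"
    by (rule borel_measurable_continuous_onI[OF continuous_flux])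
  have [measurable]: "(\<lambda>\<omega>. u \<omega> i) \<in> borel_measurable G" "(\<lambda>\<omega>. u \<omega> (succ_mod N i)) \<in> borel_measurable G"
    "(\<lambda>\<omega>. u \<omega> (pred_mod N i)) \<in> borel_measurable G" 
    "(\<lambda>\<omega>. u \<omega> (succ_mod N (pred_mod N i))) \<in> borel_measurable G" 
    using i by (intro u succ_mod_in pred_mod_in; simp)+
  show ?thesis
    unfolding drift_eq_total_flux[OF i] total_flux_def by measurable
qed

text \<open>On a uniform grid with small step \<open>h\<close>, the difference of the paths evolves by a
  contracting Euler step, plus \<open>h\<close> times the defect \<open>e\<close>, plus an error of order \<open>h * \<delta>\<close> because the
  integrand is uniformly continuous. Summing over the steps and letting \<open>\<delta>\<close> vanish gives the bound.
  The argument avoids differentiating the norm.\<close>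

lemma l1_stability:
  assumes T: "0 \<le> T"
    and u: "\<And>i. i \<in> {1..N} \<Longrightarrow> continuous_on {0..T} (\<lambda>t. u t i)"
    and w: "\<And>i. i \<in> {1..N} \<Longrightarrow> continuous_on {0..T} (\<lambda>t. w t i)"
    and e: "\<And>i. i \<in> {1..N} \<Longrightarrow> continuous_on {0..T} (\<lambda>t. e t i)"
    and eq: "\<And>t i. t \<in> {0..T} \<Longrightarrow> i \<in> {1..N} \<Longrightarrow>
      u t i - w t i = integral {0..t} (\<lambda>s. drift N \<nu> \<Phi> (u s) i - drift N \<nu> \<Phi> (w s) i + e s i)"
    and E: "\<And>t. t \<in> {0..T} \<Longrightarrow> l1norm N (e t) \<le> E"
  shows "l1norm N (\<lambda>i. u T i - w T i) \<le> T * E"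
proof (cases "T = 0")
  case True
  then show ?thesis using eq[of 0] by (simp add: l1norm_def)
next
  case False
  define f where "f i s = drift N \<nu> \<Phi> (u s) i - drift N \<nu> \<Phi> (w s) i + e s i" for i s
  define D where "D t = l1norm N (\<lambda>i. u t i - w t i)" for t
  have fc: "continuous_on {0..T} (f i)" if "i \<in> {1..N}" for i
    unfolding f_def by (intro continuous_intros drift_continuous u w e that)
  have "D T \<le> T * E + \<epsilon>" if \<epsilon>: "0 < \<epsilon>" for \<epsilon>
  proof -
    define \<delta> where "\<delta> = \<epsilon> / (T * real N)"
    have TN: "0 < T" "0 < T * real N" using T False N by auto
    then have \<delta>: "0 < \<delta>" using \<epsilon> by (simp add: \<delta>_def)
    have "\<forall>\<^sub>F n in sequentially. \<forall>i\<in>{1..N}. \<forall>s\<in>{0..T}. \<forall>t\<in>{0..T}.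
        \<bar>s - t\<bar> \<le> T / real n \<longrightarrow> \<bar>f i s - f i t\<bar> \<le> \<delta>"
      using uniformly_close_on_fine_grid[OF fc \<delta>] by (intro eventually_ball_finite) auto
    moreover have "(\<lambda>n. 2 * K * T / real n) \<longlonglongrightarrow> 0" by (rule lim_const_over_n)
    then have "\<forall>\<^sub>F n in sequentially. 2 * K * T / real n < 1" by (rule order_tendstoD) simp
    moreover have "\<forall>\<^sub>F n in sequentially. (1::nat) \<le> n" by (rule eventually_ge_at_top)
    ultimately have "\<forall>\<^sub>F n in sequentially. (\<forall>i\<in>{1..N}. \<forall>s\<in>{0..T}. \<forall>t\<in>{0..T}.
        \<bar>s - t\<bar> \<le> T / real n \<longrightarrow> \<bar>f i s - f i t\<bar> \<le> \<delta>) \<and> 2 * K * T / real n < 1 \<and> 1 \<le> n"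
      by eventually_elim blast
    from eventually_happens'[OF sequentially_bot this]
    obtain n where n0: "\<forall>i\<in>{1..N}. \<forall>s\<in>{0..T}. \<forall>t\<in>{0..T}.
        \<bar>s - t\<bar> \<le> T / real n \<longrightarrow> \<bar>f i s - f i t\<bar> \<le> \<delta>"
      and n: "2 * K * T / real n < 1" "1 \<le> n"
      by blast
    define h where "h = T / real n"
    have h: "0 \<le> h" "2 * h * K \<le> 1" "real n * h = T"
      using n TN by (auto simp: h_def mult_ac)
    have step: "D (t + h) \<le> D t + h * (E + real N * \<delta>)" if t: "0 \<le> t" "t + h \<le> T" for t
    proof -
      define r where "r i = (u (t + h) i - w (t + h) i) - (u t i - w t i) - h * f i t" for i
      have r: "\<bar>r i\<bar> \<le> h * \<delta>" if i: "i \<in> {1..N}" for i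
      proof -
        have "\<bar>integral {0..t + h} (f i) - integral {0..t} (f i) - h * f i t\<bar> \<le> h * \<delta>"
        proof (rule integral_increment_error)
          show "continuous_on {0..t + h} (f i)"
            using t h by (intro continuous_on_subset[OF fc[OF i]]) auto
          show "\<bar>f i s - f i t\<bar> \<le> \<delta>" if "s \<in> {t..t + h}" for s
            using that t h by (intro n0[rule_format, OF i]) (auto simp: h_def)
        qed (use t h in auto)
        moreover have "u (t + h) i - w (t + h) i = integral {0..t + h} (f i)" "u t i - w t i = integral {0..t} (f i)"
          using t h i by (auto simp: eq f_def[abs_def])
        ultimately show ?thesis by (simp add: r_def)
      qed
      let ?b = "\<lambda>i. drift N \<nu> \<Phi> (u t) i - drift N \<nu> \<Phi> (w t) i"
      have "D (t + h) = l1norm N (\<lambda>i. ((u t i - w t i) + h * ?b i) + (h * e t i + r i))"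
        unfolding D_def by (rule l1norm_cong) (simp add: r_def f_def algebra_simps)
      also have "\<dots> \<le> l1norm N (\<lambda>i. (u t i - w t i) + h * ?b i) + l1norm N (\<lambda>i. h * e t i + r i)"
        by (rule l1norm_triangle)
      also have "\<dots> \<le> D t + (l1norm N (\<lambda>i. h * e t i) + l1norm N r)"
        unfolding D_def by (intro add_mono euler_step_contraction h l1norm_triangle)
      also have "l1norm N (\<lambda>i. h * e t i) \<le> h * E"
        unfolding l1norm_scale using h E[of t] t by (auto intro!: mult_left_mono)
      also have "l1norm N r \<le> real N * (h * \<delta>)"
        using sum_bounded_above[of "{1..N}" "\<lambda>i. \<bar>r i\<bar>" "h * \<delta>"] r by (simp add: l1norm_def)
      finally show ?thesis by (simp add: algebra_simps)
    qed
    have "k \<le> n \<Longrightarrow> D (real k * h) \<le> real k * h * (E + real N * \<delta>)" for k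
    proof (induction k)
      case 0
      show ?case using eq[of 0] T by (simp add: D_def l1norm_def)
    next
      case (Suc k)
      have "real (Suc k) * h \<le> real n * h" using Suc.prems h by (intro mult_right_mono) auto
      then have "D (real k * h + h) \<le> D (real k * h) + h * (E + real N * \<delta>)"
        using h by (intro step) (auto simp: algebra_simps)
      also have "\<dots> \<le> real k * h * (E + real N * \<delta>) + h * (E + real N * \<delta>)"
        using Suc by simp
      finally show ?case by (simp add: algebra_simps)
    qed
    from this[of n] have "D T \<le> T * E + T * real N * \<delta>"
      unfolding h(3) by (simp add: algebra_simps)
    also have "T * real N * \<delta> = \<epsilon>" using TN N by (simp add: \<delta>_def)
    finally show ?thesis .
  qed
  then show ?thesis unfolding D_def by (rule field_le_epsilon)
qed

end

section \<open>Paths solving the integral equation\<close>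

definition solves ::
  "nat \<Rightarrow> real \<Rightarrow> (real \<times> real \<Rightarrow> real) \<Rightarrow> (real \<Rightarrow> nat \<Rightarrow> real) \<Rightarrow> real \<Rightarrow> (real \<Rightarrow> nat \<Rightarrow> real) \<Rightarrow> bool" where
  "solves N \<nu> \<Phi> X T u \<longleftrightarrow>
    (\<forall>i\<in>{1..N}. continuous_on {0..T} (\<lambda>t. u t i)) \<and>
    (\<forall>t\<in>{0..T}. \<forall>i\<in>{1..N}. u t i = X t i + integral {0..t} (\<lambda>s. drift N \<nu> \<Phi> (u s) i))"

text \<open>The flux may be changed away from the values that the path takes; this is how a
  solution of the clipped equation is recognised as a solution of the original one.\<close>

lemma solves_cong:
  assumes u: "solves N \<nu> \<Phi> X T u"
    and eq: "\<And>t i. t \<in> {0..T} \<Longrightarrow> i \<in> {1..N} \<Longrightarrow> u t i = v t i"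
    and \<Phi>: "\<And>t i j. t \<in> {0..T} \<Longrightarrow> i \<in> {1..N} \<Longrightarrow> j \<in> {1..N} \<Longrightarrow> \<Phi> (v t i, v t j) = \<Phi>' (v t i, v t j)"
  shows "solves N \<nu> \<Phi>' X T v"
  unfolding solves_def
proof (intro conjI ballI)
  fix i assume i: "i \<in> {1..N}"
  then have "continuous_on {0..T} (\<lambda>t. u t i)" using u unfolding solves_def by blast
  moreover have "continuous_on {0..T} (\<lambda>t. u t i) = continuous_on {0..T} (\<lambda>t. v t i)"
    by (rule continuous_on_cong) (use eq i in auto)
  ultimately show "continuous_on {0..T} (\<lambda>t. v t i)" by blast
  fix t assume t: "t \<in> {0..T}"
  have "u t i = X t i + integral {0..t} (\<lambda>s. drift N \<nu> \<Phi> (u s) i)"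
    using u i t unfolding solves_def by blast
  moreover have "integral {0..t} (\<lambda>s. drift N \<nu> \<Phi> (u s) i) = integral {0..t} (\<lambda>s. drift N \<nu> \<Phi>' (v s) i)"
  proof (rule integral_cong)
    fix s assume "s \<in> {0..t}"
    then have "s \<in> {0..T}" using t by simp
    then show "drift N \<nu> \<Phi> (u s) i = drift N \<nu> \<Phi>' (v s) i"
      by (intro drift_cong eq \<Phi> i)
  qed
  ultimately show "v t i = X t i + integral {0..t} (\<lambda>s. drift N \<nu> \<Phi>' (v s) i)"
    using eq[OF t i] by simp
qed

lemma continuous_path_bounded:
  fixes u :: "real \<Rightarrow> nat \<Rightarrow> real" and N :: nat
  assumes "\<And>i. i \<in> {1..N} \<Longrightarrow> continuous_on {0..T} (\<lambda>t. u t i)"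
  obtains R where "0 \<le> R" "\<forall>t\<in>{0..T}. \<forall>i\<in>{1..N}. \<bar>u t i\<bar> \<le> R"
proof -
  have "continuous_on {0..T} (\<lambda>t. l1norm N (u t))"
    unfolding l1norm_def by (intro continuous_intros assms)
  then have "bounded ((\<lambda>t. l1norm N (u t)) ` {0..T})"
    by (intro compact_imp_bounded compact_continuous_image) auto
  then obtain R where R: "\<And>t. t \<in> {0..T} \<Longrightarrow> \<bar>l1norm N (u t)\<bar> \<le> R"
    unfolding bounded_iff real_norm_def by blast
  show ?thesis
  proof (rule that[of "\<bar>R\<bar>"], simp, intro ballI)
    fix t i assume "t \<in> {0..T}" "i \<in> {1..N}"
    then show "\<bar>u t i\<bar> \<le> \<bar>R\<bar>"
      using R[of t] abs_le_l1norm[of i N "u t"] by linarith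
  qed
qed

text \<open>The drift is a discrete divergence and has sum zero, so the total mass is that of the forcing.\<close>

lemma solves_sum:
  fixes u :: "real \<Rightarrow> nat \<Rightarrow> real"
  assumes u: "solves N \<nu> \<Phi> X T u" and \<Phi>: "continuous_on UNIV \<Phi>" and t: "t \<in> {0..T}"
  shows "(\<Sum>i=1..N. u t i) = (\<Sum>i=1..N. X t i)"
proof -
  have "(\<lambda>s. drift N \<nu> \<Phi> (u s) i) integrable_on {0..t}" if i: "i \<in> {1..N}" for i
  proof (intro integrable_continuous_real drift_continuous_on[OF \<Phi> _ i])
    fix j assume "j \<in> {1..N}"
    then have "continuous_on {0..T} (\<lambda>s. u s j)" using u unfolding solves_def by blast
    then show "continuous_on {0..t} (\<lambda>s. u s j)" by (rule continuous_on_subset) (use t in simp)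
  qed
  then have "(\<Sum>i=1..N. integral {0..t} (\<lambda>s. drift N \<nu> \<Phi> (u s) i)) = integral {0..t} (\<lambda>s. \<Sum>i=1..N. drift N \<nu> \<Phi> (u s) i)"
    by (intro integral_sum[symmetric]) auto
  also have "\<dots> = 0" by (simp add: sum_drift del: One_nat_def)
  moreover have "(\<Sum>i=1..N. u t i) = (\<Sum>i=1..N. X t i + integral {0..t} (\<lambda>s. drift N \<nu> \<Phi> (u s) i))"
    using u t unfolding solves_def by (intro sum.cong refl) blast
  ultimately show ?thesis by (simp add: sum.distrib)
qed

section \<open>Picard iteration for Lipschitz fluxes\<close>

text \<open>An integrand that is measurable in \<open>\<omega>\<close> for each time and continuous in time is jointly
  measurable, being the limit of its evaluations at discretised times. Applied with \<open>G = F t\<close>,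
  this is what makes time integrals of adapted continuous processes adapted.\<close>

lemma caratheodory_integral_measurable:
  fixes f :: "'w \<Rightarrow> real \<Rightarrow> real"
  assumes t: "0 \<le> t"
    and m: "\<And>s. s \<in> {0..t} \<Longrightarrow> (\<lambda>\<omega>. f \<omega> s) \<in> borel_measurable G"
    and c: "\<And>\<omega>. \<omega> \<in> space G \<Longrightarrow> continuous_on {0..t} (f \<omega>)"
  shows "(\<lambda>\<omega>. integral {0..t} (f \<omega>)) \<in> borel_measurable G"
proof -
  \<comment> \<open>Grid times below \<open>s\<close>, forced into the interval on which the integrand is controlled.\<close>
  define q where "q n s = max 0 (min t (of_int \<lfloor>real n * s\<rfloor> / real n))" for n s
  have q: "q n s \<in> {0..t}" for n s using t by (auto simp: q_def)
  have qlim: "(\<lambda>n. q n s) \<longlonglongrightarrow> s" if s: "s \<in> {0..t}" for s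
  proof -
    have "(\<lambda>n. q n s) \<longlonglongrightarrow> max 0 (min t s)"
      unfolding q_def using s by (intro tendsto_intros floor_grid_tendsto) simp
    then show ?thesis using s by simp
  qed
  define h where "h n p = indicat_real {0..t} (snd p) * f (fst p) (q n (snd p))" for n and p :: "'w \<times> real"
  have "h n \<in> borel_measurable (G \<Otimes>\<^sub>M lborel)" for n
  proof -
    have "(\<lambda>p. f (fst p) (max 0 (min t (of_int k / real n)))) \<in> borel_measurable (G \<Otimes>\<^sub>M lborel)" for k :: int
      by (rule measurable_compose[OF measurable_fst m]) (use t in auto)
    then have "(\<lambda>p. f (fst p) (q n (snd p))) \<in> borel_measurable (G \<Otimes>\<^sub>M lborel)"
      unfolding q_def
      by (rule measurable_compose_countable[where g="\<lambda>p. \<lfloor>real n * snd p\<rfloor>"]) measurable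
    then show ?thesis unfolding h_def by measurable
  qed
  then have "(\<lambda>p. indicat_real {0..t} (snd p) * f (fst p) (snd p)) \<in> borel_measurable (G \<Otimes>\<^sub>M lborel)"
  proof (rule borel_measurable_LIMSEQ_real[rotated])
    fix p :: "'w \<times> real" assume p: "p \<in> space (G \<Otimes>\<^sub>M lborel)"
    show "(\<lambda>n. h n p) \<longlonglongrightarrow> indicat_real {0..t} (snd p) * f (fst p) (snd p)"
    proof (cases "snd p \<in> {0..t}")
      case True
      have "fst p \<in> space G" using p by (auto simp: space_pair_measure)
      then have "(\<lambda>n. f (fst p) (q n (snd p))) \<longlonglongrightarrow> f (fst p) (snd p)"
        using q by (intro continuous_on_tendsto_compose[OF c qlim] True) auto
      then show ?thesis unfolding h_def by (intro tendsto_intros)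
    next
      case False
      then show ?thesis by (simp add: h_def)
    qed
  qed
  then have "(\<lambda>\<omega>. LINT s|lborel. indicat_real {0..t} s * f \<omega> s) \<in> borel_measurable G"
    by (intro lborel.borel_measurable_lebesgue_integral) (simp add: case_prod_beta')
  moreover have "(LINT s|lborel. indicat_real {0..t} s * f \<omega> s) = integral {0..t} (f \<omega>)" if "\<omega> \<in> space G" for \<omega>
    using continuous_lborel_integral_eq[OF c[OF that]] by (simp add: set_lebesgue_integral_def)
  ultimately show ?thesis by (simp cong: measurable_cong)
qed

context lipschitz_scheme
begin

text \<open>The iteration starts from the forcing, so that every iterate carries the full noise and only the drift is corrected.\<close>

primrec picard :: "(real \<Rightarrow> nat \<Rightarrow> real) \<Rightarrow> nat \<Rightarrow> real \<Rightarrow> nat \<Rightarrow> real" where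
  "picard X 0 = X"
| "picard X (Suc n) = (\<lambda>t i. X t i + integral {0..t} (\<lambda>s. drift N \<nu> \<Phi> (picard X n s) i))"

definition sol :: "(real \<Rightarrow> nat \<Rightarrow> real) \<Rightarrow> real \<Rightarrow> nat \<Rightarrow> real" where
  "sol X t i = lim (\<lambda>n. picard X n t i)"

context
  fixes X :: "real \<Rightarrow> nat \<Rightarrow> real" and T :: real
  assumes X: "\<And>i. i \<in> {1..N} \<Longrightarrow> continuous_on {0..T} (\<lambda>t. X t i)"
begin

lemma picard_continuous:
  "i \<in> {1..N} \<Longrightarrow> continuous_on {0..T} (\<lambda>t. picard X n t i)"
proof (induction n arbitrary: i)
  case 0
  then show ?case by (simp add: X)
next
  case (Suc n)
  show ?case
    by (simp only: picard.simps)
      (intro continuous_intros X indefinite_integral_continuous_1 integrable_continuous_real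
        drift_continuous Suc; simp)
qed

text \<open>Distances are measured relative to \<open>exp (8 * K * t)\<close>, with twice the Lipschitz constant \<open>4 * K\<close> of the
  drift in the exponent: integrating the exponential then gains the factor one half in every step, on
  intervals of any length.\<close>

lemma picard_step_bound:
  obtains B where "0 \<le> B" "\<forall>n. \<forall>t\<in>{0..T}.
    l1norm N (\<lambda>i. picard X (Suc n) t i - picard X n t i) \<le> B * exp (8 * K * t) * (1 / 2) ^ n"
proof -
  define g where "g n t = l1norm N (\<lambda>i. picard X (Suc n) t i - picard X n t i)" for n t
  have gc: "continuous_on {0..T} (g n)" for n
    unfolding g_def l1norm_def by (intro continuous_intros picard_continuous)
  then have "bounded (g 0 ` {0..T})"
    by (intro compact_imp_bounded compact_continuous_image) auto
  then obtain B where B: "\<And>t. t \<in> {0..T} \<Longrightarrow> \<bar>g 0 t\<bar> \<le> B"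
    unfolding bounded_iff real_norm_def by blast
  define B' where "B' = max B 0"
  have B': "0 \<le> B'" "\<And>t. t \<in> {0..T} \<Longrightarrow> g 0 t \<le> B'"
    using B unfolding B'_def by (auto simp: abs_le_iff le_max_iff_disj)
  have bound: "g n t \<le> B' * exp (8 * K * t) * (1 / 2) ^ n" if "t \<in> {0..T}" for n t
    using that
  proof (induction n arbitrary: t)
    case 0
    have "g 0 t \<le> B'" using B' 0 by simp
    also have "\<dots> \<le> B' * exp (8 * K * t)"
      using mult_left_mono[of 1 "exp (8 * K * t)" B'] B'(1) K_pos 0 by simp
    finally show ?case by simp
  next
    case (Suc n)
    define c where "c = 4 * K * (B' * (1 / 2) ^ n)"
    let ?b = "\<lambda>s i. drift N \<nu> \<Phi> (picard X (Suc n) s) i - drift N \<nu> \<Phi> (picard X n s) i"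
    have t: "0 \<le> t" "{0..t} \<subseteq> {0..T}" using Suc.prems by auto
    have dc: "continuous_on {0..t} (\<lambda>s. drift N \<nu> \<Phi> (picard X m s) i)" if "i \<in> {1..N}" for i m
      by (rule continuous_on_subset[OF _ t(2)]) (intro drift_continuous picard_continuous that)
    have p: "picard X (Suc m) t i = X t i + integral {0..t} (\<lambda>s. drift N \<nu> \<Phi> (picard X m s) i)" for m i
      by simp
    have "g (Suc n) t \<le> (\<Sum>i=1..N. integral {0..t} (\<lambda>s. \<bar>?b s i\<bar>))"
      unfolding g_def l1norm_def
    proof (rule sum_mono)
      fix i assume i: "i \<in> {1..N}"
      have "integral {0..t} (\<lambda>s. ?b s i) =
          integral {0..t} (\<lambda>s. drift N \<nu> \<Phi> (picard X (Suc n) s) i) - integral {0..t} (\<lambda>s. drift N \<nu> \<Phi> (picard X n s) i)"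
        by (rule integral_diff; rule integrable_continuous_real[OF dc[OF i]])
      then have "picard X (Suc (Suc n)) t i - picard X (Suc n) t i = integral {0..t} (\<lambda>s. ?b s i)"
        using p[of "Suc n" i] p[of n i] by linarith
      moreover have "norm (integral {0..t} (\<lambda>s. ?b s i)) \<le> integral {0..t} (\<lambda>s. \<bar>?b s i\<bar>)"
      proof (rule integral_norm_bound_integral)
        show "(\<lambda>s. ?b s i) integrable_on {0..t}" "(\<lambda>s. \<bar>?b s i\<bar>) integrable_on {0..t}"
          by (intro integrable_continuous_real continuous_intros dc[OF i])+
      qed simp
      ultimately show "\<bar>picard X (Suc (Suc n)) t i - picard X (Suc n) t i\<bar> \<le> integral {0..t} (\<lambda>s. \<bar>?b s i\<bar>)"
        by simp
    qed
    also have "\<dots> = integral {0..t} (\<lambda>s. \<Sum>i=1..N. \<bar>?b s i\<bar>)"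
      by (intro integral_sum[symmetric] integrable_continuous_real continuous_intros dc) simp_all
    also have "\<dots> \<le> integral {0..t} (\<lambda>s. c * exp (8 * K * s))"
    proof (rule integral_le)
      fix s assume s: "s \<in> {0..t}"
      have "(\<Sum>i=1..N. \<bar>?b s i\<bar>) \<le> 4 * K * g n s"
        using drift_lipschitz[of "picard X (Suc n) s" "picard X n s"] unfolding g_def l1norm_def .
      also have "\<dots> \<le> 4 * K * (B' * exp (8 * K * s) * (1 / 2) ^ n)"
        using s t K_pos by (intro mult_left_mono Suc.IH) auto
      finally show "(\<Sum>i=1..N. \<bar>?b s i\<bar>) \<le> c * exp (8 * K * s)" by (simp add: c_def mult_ac)
    next
      show "(\<lambda>s. \<Sum>i=1..N. \<bar>?b s i\<bar>) integrable_on {0..t}"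
        by (intro integrable_continuous_real continuous_intros dc)
      show "(\<lambda>s. c * exp (8 * K * s)) integrable_on {0..t}"
        by (intro integrable_continuous_real continuous_intros)
    qed
    also have "\<dots> = c / (8 * K) * exp (8 * K * t) - c / (8 * K) * exp (8 * K * 0)"
    proof (rule integral_unique, rule fundamental_theorem_of_calculus[OF t(1)])
      fix s
      show "((\<lambda>s. c / (8 * K) * exp (8 * K * s)) has_vector_derivative c * exp (8 * K * s)) (at s within {0..t})"
        unfolding has_real_derivative_iff_has_vector_derivative[symmetric]
        using K_pos by (auto intro!: derivative_eq_intros)
    qed
    also have "\<dots> \<le> c / (8 * K) * exp (8 * K * t)"
      using K_pos B' by (simp add: c_def)
    also have "\<dots> = B' * exp (8 * K * t) * (1 / 2) ^ Suc n"
      using K_pos by (simp add: c_def)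
    finally show ?case .
  qed
  show ?thesis
    by (rule that[OF B'(1)], intro allI ballI) (rule bound[unfolded g_def])
qed

lemma picard_uniform_limit:
  assumes i: "i \<in> {1..N}"
  shows "uniform_limit {0..T} (\<lambda>n t. picard X n t i) (\<lambda>t. sol X t i) sequentially"
proof -
  obtain B where B: "0 \<le> B" "\<forall>n. \<forall>t\<in>{0..T}.
    l1norm N (\<lambda>i. picard X (Suc n) t i - picard X n t i) \<le> B * exp (8 * K * t) * (1 / 2) ^ n"
    by (rule picard_step_bound)
  let ?d = "\<lambda>n t. picard X (Suc n) t i - picard X n t i"
  have "uniformly_convergent_on {0..T} (\<lambda>n t. \<Sum>k<n. ?d k t)"
  proof (rule Weierstrass_m_test')
    fix n t assume t: "t \<in> {0..T}"
    have "norm (?d n t) \<le> B * exp (8 * K * t) * (1 / 2) ^ n"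
      using abs_le_l1norm[OF i, of "\<lambda>i. picard X (Suc n) t i - picard X n t i"] B(2)[rule_format, OF t, of n] by simp
    also have "\<dots> \<le> B * exp (8 * K * T) * (1 / 2) ^ n"
      using B(1) t K_pos by (intro mult_right_mono mult_left_mono) auto
    finally show "norm (?d n t) \<le> B * exp (8 * K * T) * (1 / 2) ^ n" .
  qed (intro summable_mult summable_geometric, simp)
  then have "uniform_limit {0..T} (\<lambda>n t. \<Sum>k<n. ?d k t) (\<lambda>t. lim (\<lambda>n. \<Sum>k<n. ?d k t)) sequentially"
    by (simp only: uniformly_convergent_uniform_limit_iff)
  then have "uniform_limit {0..T} (\<lambda>n t. (\<Sum>k<n. ?d k t) + X t i) (\<lambda>t. lim (\<lambda>n. \<Sum>k<n. ?d k t) + X t i) sequentially"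
    by (intro uniform_limit_intros)
  moreover have "(\<Sum>k<n. ?d k t) + X t i = picard X n t i" for n t
    using sum_lessThan_telescope[of "\<lambda>n. picard X n t i" n] by simp
  ultimately have "uniformly_convergent_on {0..T} (\<lambda>n t. picard X n t i)"
    unfolding uniformly_convergent_on_def by auto
  then show ?thesis
    by (simp only: uniformly_convergent_uniform_limit_iff sol_def)
qed

lemma sol_continuous: "i \<in> {1..N} \<Longrightarrow> continuous_on {0..T} (\<lambda>t. sol X t i)"
  by (rule uniform_limit_theorem[OF _ picard_uniform_limit])
    (auto intro!: always_eventually picard_continuous)

lemma sol_equation:
  assumes i: "i \<in> {1..N}" and t: "t \<in> {0..T}"
  shows "sol X t i = X t i + integral {0..t} (\<lambda>s. drift N \<nu> \<Phi> (sol X s) i)"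
proof -
  have "uniform_limit {0..T} (\<lambda>n s. \<Sum>j=1..N. \<bar>picard X n s j - sol X s j\<bar>)
      (\<lambda>s. \<Sum>j=1..N. \<bar>sol X s j - sol X s j\<bar>) sequentially"
    unfolding real_norm_def[symmetric]
    by (intro uniform_limit_sum uniform_limit_norm uniform_limit_minus uniform_limit_const picard_uniform_limit) simp_all
  then have u0: "uniform_limit {0..T} (\<lambda>n s. l1norm N (\<lambda>j. picard X n s j - sol X s j)) (\<lambda>s. 0) sequentially"
    by (simp add: l1norm_def)
  have lim: "uniform_limit {0..t} (\<lambda>n s. drift N \<nu> \<Phi> (picard X n s) i) (\<lambda>s. drift N \<nu> \<Phi> (sol X s) i) sequentially"
  proof (rule uniform_limitI)
    fix \<epsilon> :: real assume "0 < \<epsilon>"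
    then have "\<forall>\<^sub>F n in sequentially. \<forall>s\<in>{0..T}. dist (l1norm N (\<lambda>j. picard X n s j - sol X s j)) 0 < \<epsilon> / (4 * K)"
      using K_pos by (intro uniform_limitD[OF u0]) simp
    then show "\<forall>\<^sub>F n in sequentially. \<forall>s\<in>{0..t}.
        dist (drift N \<nu> \<Phi> (picard X n s) i) (drift N \<nu> \<Phi> (sol X s) i) < \<epsilon>"
    proof eventually_elim
      case (elim n)
      show ?case
      proof
        fix s assume "s \<in> {0..t}"
        then have "l1norm N (\<lambda>j. picard X n s j - sol X s j) < \<epsilon> / (4 * K)"
          using elim t by (auto simp: l1norm_nonneg)
        then have "4 * K * l1norm N (\<lambda>j. picard X n s j - sol X s j) < \<epsilon>"
          using K_pos by (simp add: field_simps)
        then show "dist (drift N \<nu> \<Phi> (picard X n s) i) (drift N \<nu> \<Phi> (sol X s) i) < \<epsilon>"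
          using drift_lipschitz[of "picard X n s" "sol X s"]
            abs_le_l1norm[OF i, of "\<lambda>i. drift N \<nu> \<Phi> (picard X n s) i - drift N \<nu> \<Phi> (sol X s) i"]
          by (simp add: dist_real_def)
      qed
    qed
  qed
  have cont: "continuous_on {0..t} (\<lambda>s. drift N \<nu> \<Phi> (picard X n s) i)" for n
    using t by (intro drift_continuous[OF _ i] continuous_on_subset[OF picard_continuous]) auto
  obtain I J where IJ: "\<And>n. ((\<lambda>s. drift N \<nu> \<Phi> (picard X n s) i) has_integral I n) {0..t}"
      "((\<lambda>s. drift N \<nu> \<Phi> (sol X s) i) has_integral J) {0..t}" "I \<longlonglongrightarrow> J"
    using uniform_limit_integral[OF lim cont sequentially_bot] by metis
  then have "(\<lambda>n. picard X (Suc n) t i) \<longlonglongrightarrow> X t i + integral {0..t} (\<lambda>s. drift N \<nu> \<Phi> (sol X s) i)"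
    unfolding picard.simps integral_unique[OF IJ(1)] integral_unique[OF IJ(2)]
    by (intro tendsto_intros)
  moreover have "(\<lambda>n. picard X (Suc n) t i) \<longlonglongrightarrow> sol X t i"
    using tendsto_uniform_limitI[OF picard_uniform_limit[OF i] t] by (rule LIMSEQ_Suc)
  ultimately show ?thesis by (rule LIMSEQ_unique[symmetric])
qed

end

lemma sol_solves:
  assumes "\<And>i. i \<in> {1..N} \<Longrightarrow> continuous_on {0..T} (\<lambda>t. X t i)"
  shows "solves N \<nu> \<Phi> X T (sol X)"
  unfolding solves_def by (intro conjI ballI) (rule sol_continuous[OF assms] sol_equation[OF assms]; assumption)+

lemma sol_measurable:
  assumes t: "t \<in> {0..T}" and i: "i \<in> {1..N}"
    and m: "\<And>s i. s \<in> {0..T} \<Longrightarrow> i \<in> {1..N} \<Longrightarrow> (\<lambda>\<omega>. X \<omega> s i) \<in> borel_measurable G"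
    and c: "\<And>\<omega> i. \<omega> \<in> space G \<Longrightarrow> i \<in> {1..N} \<Longrightarrow> continuous_on {0..T} (\<lambda>t. X \<omega> t i)"
  shows "(\<lambda>\<omega>. sol (X \<omega>) t i) \<in> borel_measurable G"
proof -
  have "(\<lambda>\<omega>. picard (X \<omega>) n t i) \<in> borel_measurable G" if "t \<in> {0..T}" "i \<in> {1..N}" for n t i
    using that
  proof (induction n arbitrary: t i)
    case 0
    then show ?case by (simp add: m)
  next
    case (Suc n)
    have "(\<lambda>\<omega>. integral {0..t} (\<lambda>s. drift N \<nu> \<Phi> (picard (X \<omega>) n s) i)) \<in> borel_measurable G"
    proof (rule caratheodory_integral_measurable)
      show "(\<lambda>\<omega>. drift N \<nu> \<Phi> (picard (X \<omega>) n s) i) \<in> borel_measurable G" if "s \<in> {0..t}" for s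
        using that Suc.prems by (intro drift_measurable Suc.IH) auto
      show "continuous_on {0..t} (\<lambda>s. drift N \<nu> \<Phi> (picard (X \<omega>) n s) i)" if "\<omega> \<in> space G" for \<omega>
        using Suc.prems
        by (intro drift_continuous continuous_on_subset[OF picard_continuous[OF c[OF that]]]) auto
    qed (use Suc.prems in auto)
    moreover have "(\<lambda>\<omega>. X \<omega> t i) \<in> borel_measurable G" using Suc.prems by (rule m)
    ultimately show ?case by simp
  qed
  from this[OF t i] show ?thesis
    unfolding sol_def by (rule borel_measurable_lim_metric)
qed

text \<open>The forcing is compared with the solution as if it were a solution itself: it satisfies the
  equation with defect \<open>drift (X s)\<close>. Stability then bounds the distance in terms of \<open>X\<close> alone.\<close>

lemma solution_distance_to_forcing:
  assumes u: "solves N \<nu> \<Phi> X T u" and X: "\<And>i. i \<in> {1..N} \<Longrightarrow> continuous_on {0..T} (\<lambda>t. X t i)"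
    and E: "\<And>s. s \<in> {0..T} \<Longrightarrow> l1norm N (drift N \<nu> \<Phi> (X s)) \<le> E" and t: "t \<in> {0..T}"
  shows "l1norm N (\<lambda>i. u t i - X t i) \<le> t * E"
proof (rule l1_stability[where e="\<lambda>s. drift N \<nu> \<Phi> (X s)"])
  have sub: "{0..t} \<subseteq> {0..T}" using t by auto
  fix i assume i: "i \<in> {1..N}"
  show "continuous_on {0..t} (\<lambda>t. u t i)"
    using u i unfolding solves_def by (blast intro: continuous_on_subset[OF _ sub])
  show X': "continuous_on {0..t} (\<lambda>t. X t i)" by (rule continuous_on_subset[OF X[OF i] sub])
  show "continuous_on {0..t} (\<lambda>t. drift N \<nu> \<Phi> (X t) i)"
    by (intro drift_continuous continuous_on_subset[OF X sub] i)
  fix r assume "r \<in> {0..t}"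
  then show "u r i - X r i = integral {0..r} (\<lambda>s. drift N \<nu> \<Phi> (u s) i - drift N \<nu> \<Phi> (X s) i + drift N \<nu> \<Phi> (X s) i)"
    using u i t unfolding solves_def by simp
qed (use t E in auto)

lemma solution_unique:
  assumes u: "solves N \<nu> \<Phi> X T u" and v: "solves N \<nu> \<Phi> X T v"
    and t: "t \<in> {0..T}" and i: "i \<in> {1..N}"
  shows "u t i = v t i"
proof -
  have sub: "{0..t} \<subseteq> {0..T}" using t by auto
  have uc: "continuous_on {0..T} (\<lambda>t. u t i)" and vc: "continuous_on {0..T} (\<lambda>t. v t i)"
    if "i \<in> {1..N}" for i
    using u v that unfolding solves_def by auto
  have "l1norm N (\<lambda>i. u t i - v t i) \<le> t * 0"
  proof (rule l1_stability[where e="\<lambda>_ _. 0"])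
    fix r j assume r: "r \<in> {0..t}" and j: "j \<in> {1..N}"
    have sub': "{0..r} \<subseteq> {0..T}" "r \<in> {0..T}" using r t by auto
    have "integral {0..r} (\<lambda>s. drift N \<nu> \<Phi> (u s) j - drift N \<nu> \<Phi> (v s) j + 0) =
        integral {0..r} (\<lambda>s. drift N \<nu> \<Phi> (u s) j) - integral {0..r} (\<lambda>s. drift N \<nu> \<Phi> (v s) j)"
      unfolding add_0_right
      by (intro integral_diff integrable_continuous_real drift_continuous j
          continuous_on_subset[OF uc sub'(1)] continuous_on_subset[OF vc sub'(1)])
    moreover have "u r j = X r j + integral {0..r} (\<lambda>s. drift N \<nu> \<Phi> (u s) j)"
      "v r j = X r j + integral {0..r} (\<lambda>s. drift N \<nu> \<Phi> (v s) j)"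
      using u v j sub' unfolding solves_def by blast+
    ultimately show "u r j - v r j = integral {0..r} (\<lambda>s. drift N \<nu> \<Phi> (u s) j - drift N \<nu> \<Phi> (v s) j + 0)"
      by linarith
  next
    fix j assume j: "j \<in> {1..N}"
    show "continuous_on {0..t} (\<lambda>t. u t j)" "continuous_on {0..t} (\<lambda>t. v t j)"
      by (rule continuous_on_subset[OF uc[OF j] sub] continuous_on_subset[OF vc[OF j] sub])+
  qed (use t in \<open>simp_all add: l1norm_def\<close>)
  then show ?thesis using abs_le_l1norm[OF i, of "\<lambda>i. u t i - v t i"] by simp
qed

end

section \<open>Removal of the Lipschitz bound\<close>

definition clip :: "real \<Rightarrow> real \<Rightarrow> real" where
  "clip R x = max (- R) (min R x)"

definition clip_flux :: "real \<Rightarrow> (real \<times> real \<Rightarrow> real) \<Rightarrow> real \<times> real \<Rightarrow> real" where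
  "clip_flux R \<Phi> p = \<Phi> (clip R (fst p), clip R (snd p))"

lemma clip_flux_eq: "\<bar>a\<bar> \<le> R \<Longrightarrow> \<bar>b\<bar> \<le> R \<Longrightarrow> clip_flux R \<Phi> (a, b) = \<Phi> (a, b)"
  by (simp add: clip_flux_def clip_def abs_le_iff min_absorb2 max_absorb2)

locale locally_lipschitz_scheme = monotone_scheme +
  assumes local_lip: "\<exists>L. \<forall>a\<in>{-R..R}. \<forall>a'\<in>{-R..R}. \<forall>b\<in>{-R..R}. \<forall>b'\<in>{-R..R}.
    \<bar>\<Phi> (a, b) - \<Phi> (a', b)\<bar> \<le> L * \<bar>a - a'\<bar> \<and> \<bar>\<Phi> (a, b) - \<Phi> (a, b')\<bar> \<le> L * \<bar>b - b'\<bar>"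
begin

lemma clip_flux_scheme:
  assumes R: "0 \<le> R"
  obtains L where "lipschitz_scheme N \<nu> (clip_flux R \<Phi>) L"
proof -
  obtain L where L: "\<forall>a\<in>{-R..R}. \<forall>a'\<in>{-R..R}. \<forall>b\<in>{-R..R}. \<forall>b'\<in>{-R..R}.
    \<bar>\<Phi> (a, b) - \<Phi> (a', b)\<bar> \<le> L * \<bar>a - a'\<bar> \<and> \<bar>\<Phi> (a, b) - \<Phi> (a, b')\<bar> \<le> L * \<bar>b - b'\<bar>"
    using local_lip by blast
  have in_box: "clip R x \<in> {-R..R}" for x using R by (auto simp: clip_def)
  have mono: "clip R x \<le> clip R y" if "x \<le> y" for x y using that by (auto simp: clip_def)
  have le: "L * \<bar>clip R x - clip R y\<bar> \<le> \<bar>L\<bar> * \<bar>x - y\<bar>" for x y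
    by (intro mult_mono) (auto simp: clip_def abs_le_iff)
  have "lipschitz_scheme N \<nu> (clip_flux R \<Phi>) \<bar>L\<bar>"
  proof unfold_locales
    fix a a' b b' :: real
    show "a \<le> a' \<Longrightarrow> clip_flux R \<Phi> (a, b) \<le> clip_flux R \<Phi> (a', b)"
      unfolding clip_flux_def fst_conv snd_conv by (intro mono_fst mono)
    show "b \<le> b' \<Longrightarrow> clip_flux R \<Phi> (a, b') \<le> clip_flux R \<Phi> (a, b)"
      unfolding clip_flux_def fst_conv snd_conv by (intro mono_snd mono)
    have "\<bar>clip_flux R \<Phi> (a, b) - clip_flux R \<Phi> (a', b)\<bar> \<le> L * \<bar>clip R a - clip R a'\<bar>"
      using L in_box unfolding clip_flux_def fst_conv snd_conv by blast
    also note le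
    finally show "\<bar>clip_flux R \<Phi> (a, b) - clip_flux R \<Phi> (a', b)\<bar> \<le> \<bar>L\<bar> * \<bar>a - a'\<bar>" .
    have "\<bar>clip_flux R \<Phi> (a, b) - clip_flux R \<Phi> (a, b')\<bar> \<le> L * \<bar>clip R b - clip R b'\<bar>"
      using L in_box unfolding clip_flux_def fst_conv snd_conv by blast
    also note le
    finally show "\<bar>clip_flux R \<Phi> (a, b) - clip_flux R \<Phi> (a, b')\<bar> \<le> \<bar>L\<bar> * \<bar>b - b'\<bar>" .
  qed (use N \<nu> in auto)
  then show ?thesis by (rule that)
qed

lemma solves_clip_flux_iff:
  assumes "\<forall>t\<in>{0..T}. \<forall>i\<in>{1..N}. \<bar>u t i\<bar> \<le> R"
  shows "solves N \<nu> (clip_flux R \<Phi>) X T u \<longleftrightarrow> solves N \<nu> \<Phi> X T u"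
proof -
  have eq: "clip_flux R \<Phi> (u t i, u t j) = \<Phi> (u t i, u t j)"
    if "t \<in> {0..T}" "i \<in> {1..N}" "j \<in> {1..N}" for t i j
    using assms that by (intro clip_flux_eq) auto
  show ?thesis
  proof
    assume "solves N \<nu> (clip_flux R \<Phi>) X T u"
    then show "solves N \<nu> \<Phi> X T u" by (rule solves_cong) (rule refl eq; assumption)+
  next
    assume "solves N \<nu> \<Phi> X T u"
    then show "solves N \<nu> (clip_flux R \<Phi>) X T u" by (rule solves_cong) (rule refl eq[symmetric]; assumption)+
  qed
qed

text \<open>Both paths are bounded on a compact time interval, so they solve the equation clipped at a common
  level, where uniqueness is known.\<close>

lemma local_solution_unique:
  assumes u: "solves N \<nu> \<Phi> X T u" and v: "solves N \<nu> \<Phi> X T v"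
    and t: "t \<in> {0..T}" and i: "i \<in> {1..N}"
  shows "u t i = v t i"
proof -
  obtain R1 where R1: "0 \<le> R1" "\<forall>t\<in>{0..T}. \<forall>i\<in>{1..N}. \<bar>u t i\<bar> \<le> R1"
    by (rule continuous_path_bounded[of N T u]) (use u in \<open>auto simp: solves_def\<close>)
  obtain R2 where R2: "0 \<le> R2" "\<forall>t\<in>{0..T}. \<forall>i\<in>{1..N}. \<bar>v t i\<bar> \<le> R2"
    by (rule continuous_path_bounded[of N T v]) (use v in \<open>auto simp: solves_def\<close>)
  define R where "R = R1 + R2"
  have R: "0 \<le> R" using R1 R2 by (simp add: R_def)
  obtain L where "lipschitz_scheme N \<nu> (clip_flux R \<Phi>) L"
    by (rule clip_flux_scheme[OF R])
  then interpret clipped: lipschitz_scheme N \<nu> "clip_flux R \<Phi>" L .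
  have "\<forall>t\<in>{0..T}. \<forall>i\<in>{1..N}. \<bar>u t i\<bar> \<le> R" "\<forall>t\<in>{0..T}. \<forall>i\<in>{1..N}. \<bar>v t i\<bar> \<le> R"
    using R1 R2 by (force simp: R_def)+
  then have "solves N \<nu> (clip_flux R \<Phi>) X T u" "solves N \<nu> (clip_flux R \<Phi>) X T v"
    using u v by (simp_all only: solves_clip_flux_iff)
  then show ?thesis using t i by (rule clipped.solution_unique)
qed

definition clipped_sol :: "nat \<Rightarrow> (real \<Rightarrow> nat \<Rightarrow> real) \<Rightarrow> real \<Rightarrow> nat \<Rightarrow> real" where
  "clipped_sol n = lipschitz_scheme.sol N \<nu> (clip_flux (real n) \<Phi>)"

text \<open>The limit exists because the sequence is eventually constant; a limit instead of a choice of the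
  level keeps the dependence on \<open>X\<close> measurable.\<close>

definition flow :: "(real \<Rightarrow> nat \<Rightarrow> real) \<Rightarrow> real \<Rightarrow> nat \<Rightarrow> real" where
  "flow X t i = lim (\<lambda>n. clipped_sol n X t i)"

text \<open>Once the level exceeds the bound \<open>B\<close> for the forcing, the drift along the forcing is not affected by
  clipping, so the estimate for the distance of the solution to the forcing is uniform in the
  level. From the level \<open>R\<close> on, the solution stays in the region in which clipping has no
  effect.\<close>

lemma clipped_sol_eventually_solves:
  assumes T: "0 \<le> T" and X: "\<And>i. i \<in> {1..N} \<Longrightarrow> continuous_on {0..T} (\<lambda>t. X t i)"
  obtains m where "\<forall>n\<ge>m. solves N \<nu> \<Phi> X T (clipped_sol n X)"
proof -
  obtain B where B: "0 \<le> B" "\<forall>t\<in>{0..T}. \<forall>i\<in>{1..N}. \<bar>X t i\<bar> \<le> B"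
    by (rule continuous_path_bounded[OF X])
  have drift_X: "drift N \<nu> (clip_flux R \<Phi>) (X s) i = drift N \<nu> \<Phi> (X s) i"
    if "B \<le> R" "s \<in> {0..T}" "i \<in> {1..N}" for R s i
  proof -
    have "\<bar>X s j\<bar> \<le> R" if "j \<in> {1..N}" for j
      using B(2)[rule_format, OF \<open>s \<in> {0..T}\<close> that] \<open>B \<le> R\<close> by linarith
    then show ?thesis using \<open>i \<in> {1..N}\<close> by (intro drift_cong clip_flux_eq) simp_all
  qed
  obtain L where "lipschitz_scheme N \<nu> (clip_flux B \<Phi>) L" by (rule clip_flux_scheme[OF B(1)])
  then interpret B: lipschitz_scheme N \<nu> "clip_flux B \<Phi>" L .
  obtain E where E: "0 \<le> E" "\<forall>t\<in>{0..T}. \<forall>i\<in>{1..N}. \<bar>drift N \<nu> (clip_flux B \<Phi>) (X t) i\<bar> \<le> E"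
    by (rule continuous_path_bounded[OF B.drift_continuous[OF X]])
  have E': "l1norm N (drift N \<nu> (clip_flux R \<Phi>) (X s)) \<le> real N * E" if "B \<le> R" "s \<in> {0..T}" for R s
  proof -
    have "l1norm N (drift N \<nu> (clip_flux R \<Phi>) (X s)) \<le> of_nat (card {1..N}) * E"
      unfolding l1norm_def
    proof (rule sum_bounded_above)
      fix i assume "i \<in> {1..N}"
      then show "\<bar>drift N \<nu> (clip_flux R \<Phi>) (X s) i\<bar> \<le> E"
        using E(2)[rule_format, of s i] that drift_X[of R s i] drift_X[of B s i] by simp
    qed
    then show ?thesis by simp
  qed
  define R where "R = B + T * (real N * E)"
  have BR: "B \<le> R" using T E by (simp add: R_def)
  have "solves N \<nu> \<Phi> X T (clipped_sol n X)" if n: "nat \<lceil>R\<rceil> \<le> n" for n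
  proof -
    have Rn: "R \<le> real n" using n by linarith
    obtain L where "lipschitz_scheme N \<nu> (clip_flux (real n) \<Phi>) L"
      by (rule clip_flux_scheme[OF of_nat_0_le_iff])
    then interpret clipped: lipschitz_scheme N \<nu> "clip_flux (real n) \<Phi>" L .
    have s: "solves N \<nu> (clip_flux (real n) \<Phi>) X T (clipped_sol n X)"
      unfolding clipped_sol_def by (rule clipped.sol_solves[OF X])
    have "\<bar>clipped_sol n X t i\<bar> \<le> real n" if t: "t \<in> {0..T}" and i: "i \<in> {1..N}" for t i
    proof -
      have "l1norm N (\<lambda>i. clipped_sol n X t i - X t i) \<le> t * (real N * E)"
        using BR Rn by (intro clipped.solution_distance_to_forcing[OF s X _ t] E') auto
      also have "\<dots> \<le> T * (real N * E)" using t E by (intro mult_right_mono) auto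
      finally have "\<bar>clipped_sol n X t i - X t i\<bar> \<le> T * (real N * E)"
        using abs_le_l1norm[OF i, of "\<lambda>i. clipped_sol n X t i - X t i"] by linarith
      moreover have "\<bar>X t i\<bar> \<le> B" using B t i by blast
      ultimately show ?thesis using Rn unfolding R_def by linarith
    qed
    then show ?thesis using s solves_clip_flux_iff by blast
  qed
  then show ?thesis using that by blast
qed

lemma flow_solves:
  assumes T: "0 \<le> T" and X: "\<And>i. i \<in> {1..N} \<Longrightarrow> continuous_on {0..T} (\<lambda>t. X t i)"
  shows "solves N \<nu> \<Phi> X T (flow X)"
proof -
  obtain m where m: "\<forall>n\<ge>m. solves N \<nu> \<Phi> X T (clipped_sol n X)"
    by (rule clipped_sol_eventually_solves[OF T X])
  have eq: "clipped_sol m X t i = flow X t i" if "t \<in> {0..T}" "i \<in> {1..N}" for t i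
    unfolding flow_def
  proof (rule sym, rule limI, rule tendsto_eventually)
    show "\<forall>\<^sub>F n in sequentially. clipped_sol n X t i = clipped_sol m X t i"
    proof (rule eventually_sequentiallyI)
      fix n assume "m \<le> n"
      then show "clipped_sol n X t i = clipped_sol m X t i"
        using m that by (intro local_solution_unique[of X T]) auto
    qed
  qed
  have "solves N \<nu> \<Phi> X T (clipped_sol m X)" using m by blast
  then show ?thesis by (rule solves_cong) (rule eq refl; assumption)+
qed

lemma flow_measurable:
  assumes t: "t \<in> {0..T}" and i: "i \<in> {1..N}"
    and m: "\<And>s i. s \<in> {0..T} \<Longrightarrow> i \<in> {1..N} \<Longrightarrow> (\<lambda>\<omega>. X \<omega> s i) \<in> borel_measurable G"
    and c: "\<And>\<omega> i. \<omega> \<in> space G \<Longrightarrow> i \<in> {1..N} \<Longrightarrow> continuous_on {0..T} (\<lambda>t. X \<omega> t i)"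
  shows "(\<lambda>\<omega>. flow (X \<omega>) t i) \<in> borel_measurable G"
  unfolding flow_def
proof (rule borel_measurable_lim_metric)
  fix n
  obtain L where "lipschitz_scheme N \<nu> (clip_flux (real n) \<Phi>) L"
    by (rule clip_flux_scheme[OF of_nat_0_le_iff])
  then interpret clipped: lipschitz_scheme N \<nu> "clip_flux (real n) \<Phi>" L .
  show "(\<lambda>\<omega>. clipped_sol n (X \<omega>) t i) \<in> borel_measurable G"
    unfolding clipped_sol_def
    by (rule clipped.sol_measurable[where X=X, OF t i]; rule m c; assumption)
qed

end

section \<open>The stochastic equation\<close>

lemma C1_real2_partial_derivatives:
  assumes f: "C1_real2 f"
  shows "((\<lambda>v. f (v, b)) has_real_derivative partial1 f (a, b)) (at a)"
    and "((\<lambda>w. f (a, w)) has_real_derivative partial2 f (a, b)) (at b)"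
proof -
  have d: "f differentiable (at p)" for p using f unfolding C1_real2_def by blast
  have "(\<lambda>v. f (v, b)) differentiable (at a)"
    by (rule differentiable_compose[OF d]) (auto intro!: derivative_intros simp: differentiable_def)
  then show "((\<lambda>v. f (v, b)) has_real_derivative partial1 f (a, b)) (at a)"
    unfolding partial1_def by (simp add: DERIV_deriv_iff_real_differentiable)
  have "(\<lambda>w. f (a, w)) differentiable (at b)"
    by (rule differentiable_compose[OF d]) (auto intro!: derivative_intros simp: differentiable_def)
  then show "((\<lambda>w. f (a, w)) has_real_derivative partial2 f (a, b)) (at b)"
    unfolding partial2_def by (simp add: DERIV_deriv_iff_real_differentiable)
qed

text \<open>The growth bounds on the partial derivatives provide Lipschitz constants on boxes, and the signs of
  the partial derivatives provide monotonicity.\<close>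

lemma C1_monotone_flux_scheme:
  assumes C1: "C1_real2 f" and N: "1 \<le> N" and \<nu>: "0 \<le> \<nu>"
    and mono: "\<And>v w. 0 \<le> partial1 f (v, w)" "\<And>v w. partial2 f (v, w) \<le> 0"
    and growth: "\<exists>C>0. \<exists>p\<ge>1. \<forall>v w. \<bar>partial1 f (v, w)\<bar> \<le> C * (1 + \<bar>v\<bar> ^ p)
      \<and> \<bar>partial2 f (v, w)\<bar> \<le> C * (1 + \<bar>w\<bar> ^ p)"
  shows "locally_lipschitz_scheme N \<nu> f"
proof unfold_locales
  fix a a' b b' R :: real
  note d = C1_real2_partial_derivatives[OF C1]
  show "a \<le> a' \<Longrightarrow> f (a, b) \<le> f (a', b)"
    by (rule DERIV_nonneg_imp_nondecreasing[where f="\<lambda>v. f (v, b)"]) (use d(1) mono(1) in blast)+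
  show "b \<le> b' \<Longrightarrow> f (a, b') \<le> f (a, b)"
    by (rule DERIV_nonpos_imp_nonincreasing[where f="\<lambda>w. f (a, w)"]) (use d(2) mono(2) in blast)+
  obtain C p where C: "0 < C" and grow: "\<And>v w. \<bar>partial1 f (v, w)\<bar> \<le> C * (1 + \<bar>v\<bar> ^ p)"
      "\<And>v w. \<bar>partial2 f (v, w)\<bar> \<le> C * (1 + \<bar>w\<bar> ^ p)"
    using growth by blast
  define L where "L = C * (1 + \<bar>R\<bar> ^ p)"
  have le: "C * (1 + \<bar>x\<bar> ^ p) \<le> L" if "x \<in> {-R..R}" for x
    using that C unfolding L_def by (intro mult_left_mono add_left_mono power_mono) auto
  have "\<bar>f (a, b) - f (a', b)\<bar> \<le> L * \<bar>a - a'\<bar> \<and> \<bar>f (a, b) - f (a, b')\<bar> \<le> L * \<bar>b - b'\<bar>"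
    if "a \<in> {-R..R}" "a' \<in> {-R..R}" "b \<in> {-R..R}" "b' \<in> {-R..R}" for a a' b b'
  proof
    have "norm (f (a, b) - f (a', b)) \<le> L * norm (a - a')"
      by (rule field_differentiable_bound[of "{-R..R}" _ "\<lambda>v. partial1 f (v, b)"])
        (use that order_trans[OF grow(1) le] d(1) in \<open>auto intro: has_field_derivative_at_within\<close>)
    then show "\<bar>f (a, b) - f (a', b)\<bar> \<le> L * \<bar>a - a'\<bar>" by simp
    have "norm (f (a, b) - f (a, b')) \<le> L * norm (b - b')"
      by (rule field_differentiable_bound[of "{-R..R}" _ "\<lambda>w. partial2 f (a, w)"])
        (use that order_trans[OF grow(2) le] d(2) in \<open>auto intro: has_field_derivative_at_within\<close>)
    then show "\<bar>f (a, b) - f (a, b')\<bar> \<le> L * \<bar>b - b'\<bar>" by simp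
  qed
  then show "\<exists>L. \<forall>a\<in>{-R..R}. \<forall>a'\<in>{-R..R}. \<forall>b\<in>{-R..R}. \<forall>b'\<in>{-R..R}.
    \<bar>f (a, b) - f (a', b)\<bar> \<le> L * \<bar>a - a'\<bar> \<and> \<bar>f (a, b) - f (a, b')\<bar> \<le> L * \<bar>b - b'\<bar>"
    by blast
qed (use N \<nu> in auto)

lemma summable_cell_avg_squared:
  assumes g: "\<And>k. k \<ge> 1 \<Longrightarrow> g k \<in> H20_torus"
    and sum: "(\<lambda>k. (H20_norm (g k))\<^sup>2) summable_on {1..}" and i: "i \<in> {1..N}"
  shows "summable (\<lambda>k. (cell_avg N (g (Suc k)) i)\<^sup>2)"
proof (rule summable_comparison_test)
  have "{1..} = range Suc" by (auto simp: image_iff) (metis Suc_pred' gr0_conv_Suc less_eq_Suc_le)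
  then have "((\<lambda>k. (H20_norm (g k))\<^sup>2) \<circ> Suc) summable_on UNIV"
    using sum by (subst summable_on_reindex[symmetric]) auto
  then have "summable (\<lambda>k. (H20_norm (g (Suc k)))\<^sup>2)"
    by (subst (asm) summable_on_UNIV_nonneg_real_iff) (auto simp: comp_def)
  then show "summable (\<lambda>k. (4 * real N)\<^sup>2 * (H20_norm (g (Suc k)))\<^sup>2)"
    by (rule summable_mult)
  have "(cell_avg N (g (Suc k)) i)\<^sup>2 \<le> (4 * real N)\<^sup>2 * (H20_norm (g (Suc k)))\<^sup>2" for k
    using power_mono[OF abs_cell_avg_le[OF g i, of "Suc k"], of 2] by (simp add: power_mult_distrib)
  then show "\<exists>K. \<forall>k\<ge>K. norm ((cell_avg N (g (Suc k)) i)\<^sup>2) \<le> (4 * real N)\<^sup>2 * (H20_norm (g (Suc k)))\<^sup>2"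
    by simp
qed

lemma brownian_series_shift:
  assumes M: "prob_space M" and F: "normal_filtration M F"
    and W: "\<And>k. k \<ge> 1 \<Longrightarrow> brownian_motion M F (W k)" and ind: "independent_processes M {1..} W"
  shows "brownian_series M F (\<lambda>k. W (Suc k))"
proof -
  interpret prob_space M by (rule M)
  have "indep_vars (\<lambda>j. PiM {Suc j} (\<lambda>_. PiM {0..} (\<lambda>_. borel)))
      (\<lambda>j \<omega>. \<lambda>k\<in>{Suc j}. \<lambda>t\<in>{0..}. W k t \<omega>) UNIV"
    using ind unfolding independent_processes_def
    by (rule indep_vars_restrict) (auto simp: disjoint_family_on_def)
  then have "indep_vars (\<lambda>_. PiM {0..} (\<lambda>_. borel)) (\<lambda>j \<omega>. (\<lambda>x. x (Suc j)) (\<lambda>k\<in>{Suc j}. \<lambda>t\<in>{0..}. W k t \<omega>)) UNIV"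
    by (rule indep_vars_compose2) (auto intro: measurable_component_singleton)
  then show ?thesis
    using W F by unfold_locales auto
qed

theorem proposition2p4:
  fixes M :: "'w measure" and F :: "real \<Rightarrow> 'w measure"
    and W :: "nat \<Rightarrow> real \<Rightarrow> 'w \<Rightarrow> real" and g :: "nat \<Rightarrow> real \<Rightarrow> real"
    and A :: "real \<Rightarrow> real" and Abar :: "real \<times> real \<Rightarrow> real"
    and \<nu> :: real and N :: nat and U0 :: "'w \<Rightarrow> nat \<Rightarrow> real"
  assumes "\<nu> > 0"
    and "C2_real A" and "locally_lipschitz (deriv (deriv A))"
    and "\<exists>C>0. \<exists>p\<ge>1. \<forall>v. \<bar>deriv A v\<bar> \<le> C * (1 + \<bar>v\<bar> ^ p)"
    and "\<And>k. k \<ge> 1 \<Longrightarrow> g k \<in> H20_torus"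
    and "(\<lambda>k. (H20_norm (g k))\<^sup>2) summable_on {1..}"
    and "prob_space M" and "normal_filtration M F"
    and "\<And>k. k \<ge> 1 \<Longrightarrow> brownian_motion M F (W k)"
    and "independent_processes M {1..} W"
    and "C1_real2 Abar"
    and "locally_lipschitz (partial1 Abar)" and "locally_lipschitz (partial2 Abar)"
    and "\<And>v. Abar (v, v) = A v"
    and "\<And>v w. partial1 Abar (v, w) \<ge> 0" and "\<And>v w. partial2 Abar (v, w) \<le> 0"
    and "\<exists>C>0. \<exists>p\<ge>1. \<forall>v w. \<bar>partial1 Abar (v, w)\<bar> \<le> C * (1 + \<bar>v\<bar> ^ p)
                           \<and> \<bar>partial2 Abar (v, w)\<bar> \<le> C * (1 + \<bar>w\<bar> ^ p)"
    and "N \<ge> 1"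
    and "U0 \<in> F 0 \<rightarrow>\<^sub>M RN N" and "\<And>\<omega>. \<omega> \<in> space M \<Longrightarrow> U0 \<omega> \<in> RN0 N"
  shows "\<exists>U. strong_solution M F W g N \<nu> Abar U0 U
           \<and> (\<forall>t\<ge>0. \<forall>\<omega>\<in>space M. U t \<omega> \<in> RN0 N)
           \<and> (\<forall>V. strong_solution M F W g N \<nu> Abar U0 V
                  \<longrightarrow> (AE \<omega> in M. \<forall>t\<ge>0. V t \<omega> = U t \<omega>))"
proof -
  note g = assms(5) and Fnormal = assms(8) and W = assms(9) and C1 = assms(11)
  interpret prob_space M by fact
  have "0 \<le> \<nu>" using \<open>0 < \<nu>\<close> by simp
  then interpret scheme: locally_lipschitz_scheme N \<nu> Abar
    using assms by (intro C1_monotone_flux_scheme) auto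
  have Abar_cont: "continuous_on UNIV Abar"
    using C1 unfolding C1_real2_def
    by (intro continuous_at_imp_continuous_on ballI differentiable_imp_continuous_within) blast
  define c where "c i k = cell_avg N (g (Suc k)) i" for i k
  interpret series: brownian_series M F "\<lambda>k. W (Suc k)" "c i" for i
    using assms by (intro brownian_series_shift) auto
  have c: "summable (\<lambda>k. (c i k)\<^sup>2)" if "i \<in> {1..N}" for i
    unfolding c_def using g assms(6) that by (rule summable_cell_avg_squared)
  have noise: "noise N g W t \<omega> i = (\<Sum>k. c i k * W (Suc k) t \<omega>)" if "i \<in> {1..N}" for t \<omega> i
    using that by (simp add: noise_def c_def)
  \<comment> \<open>The event on which the noise is a continuous path that starts at zero; summability at all times allows the components of the noise to be summed termwise.\<close>
  define good where "good \<omega> \<longleftrightarrow> (\<forall>i\<in>{1..N}. (\<forall>t\<ge>0. summable (\<lambda>k. c i k * W (Suc k) t \<omega>)) \<and>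
      continuous_on {0..} (\<lambda>t. noise N g W t \<omega> i)) \<and> (\<forall>k. W (Suc k) 0 \<omega> = 0)" for \<omega>
  have "AE \<omega> in M. \<forall>i\<in>{1..N}. (\<forall>t\<ge>0. summable (\<lambda>k. c i k * W (Suc k) t \<omega>)) \<and>
      continuous_on {0..} (\<lambda>t. noise N g W t \<omega> i)"
    using series.AE_series_continuous[OF c] by (intro AE_finite_allI) (simp_all add: noise)
  moreover have "AE \<omega> in M. \<forall>k. W (Suc k) 0 \<omega> = 0"
    unfolding AE_all_countable by (intro allI brownian_motionD(2)[OF W]) simp
  ultimately have "AE \<omega> in M. good \<omega>" unfolding good_def by eventually_elim simp
  then obtain bad where bad: "{\<omega>\<in>space M. \<not> good \<omega>} \<subseteq> bad" "bad \<in> null_sets M"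
    by (auto elim!: AE_E simp: null_sets_def)
  have bad_F: "bad \<in> sets (F t)" if "0 \<le> t" for t
    using bad(2) normal_filtrationD(3)[OF Fnormal] normal_filtrationD(2)[OF Fnormal order_refl that] by blast
  have AE_good: "AE \<omega> in M. \<omega> \<in> space M \<and> \<omega> \<notin> bad \<and> good \<omega>"
    using AE_not_in[OF bad(2)] AE_space by eventually_elim (use bad(1) in blast)
  \<comment> \<open>The noise is replaced by zero on a null set of the initial sigma-algebra, so that all forcing paths are continuous and remain adapted.\<close>
  define Z where "Z \<omega> t i = (if \<omega> \<in> bad then 0 else noise N g W t \<omega> i)" for \<omega> t i
  define X where "X \<omega> t i = U0 \<omega> i + Z \<omega> t i" for \<omega> t i
  define U where "U t \<omega> = (\<lambda>i\<in>{1..N}. scheme.flow (X \<omega>) t i)" for t \<omega>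
  have X_cont: "continuous_on {0..T} (\<lambda>t. X \<omega> t i)" if "\<omega> \<in> space M" "i \<in> {1..N}" for \<omega> i T
  proof (cases "\<omega> \<in> bad")
    case False
    then have "good \<omega>" using bad(1) that by blast
    then have "continuous_on {0..} (\<lambda>t. noise N g W t \<omega> i)" using that unfolding good_def by blast
    then show ?thesis
      using False unfolding X_def Z_def by (auto intro!: continuous_intros intro: continuous_on_subset)
  qed (simp add: X_def Z_def)
  have flow: "solves N \<nu> Abar (X \<omega>) T (scheme.flow (X \<omega>))" if "\<omega> \<in> space M" "0 \<le> T" for \<omega> T
    by (rule scheme.flow_solves[OF that(2) X_cont[OF that(1)]])
  have space_F: "space (F t) = space M" if "0 \<le> t" for t
    by (rule series.space_F[OF that])
  have X_meas: "(\<lambda>\<omega>. X \<omega> s i) \<in> borel_measurable (F t)" if st: "0 \<le> s" "s \<le> t" and i: "i \<in> {1..N}" for s t i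
  proof -
    have t: "0 \<le> t" using st by simp
    have "(\<lambda>\<omega>. U0 \<omega> i) \<in> borel_measurable (F 0)"
      by (rule measurable_compose[OF assms(19) measurable_component_singleton[OF i]])
    then have [measurable]: "(\<lambda>\<omega>. U0 \<omega> i) \<in> borel_measurable (F t)"
      using t by (rule series.F_measurable_mono[OF _ order_refl])
    have [measurable]: "W (Suc k) s \<in> borel_measurable (F t)" for k
      by (rule series.B_adapted[OF st])
    note [measurable] = bad_F[OF t]
    show ?thesis unfolding X_def Z_def noise[OF i] by measurable
  qed
  have U_adapted: "U t \<in> F t \<rightarrow>\<^sub>M RN N" if t: "0 \<le> t" for t
    unfolding U_def
  proof (rule measurable_restrict)
    fix i assume i: "i \<in> {1..N}"
    show "(\<lambda>\<omega>. scheme.flow (X \<omega>) t i) \<in> borel_measurable (F t)"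
    proof (rule scheme.flow_measurable[where T=t])
      show "(\<lambda>\<omega>. X \<omega> s i) \<in> borel_measurable (F t)" if "s \<in> {0..t}" "i \<in> {1..N}" for s i
        using that by (intro X_meas) auto
      show "continuous_on {0..t} (\<lambda>t. X \<omega> t i)" if "\<omega> \<in> space (F t)" "i \<in> {1..N}" for \<omega> i
        using that by (intro X_cont) (simp_all add: space_F[OF t])
    qed (use t i in auto)
  qed
  have U_cont: "continuous_on {0..} (\<lambda>t. U t \<omega>)" if \<omega>: "\<omega> \<in> space M" for \<omega>
  proof (rule continuous_on_coordinatewise_then_product)
    fix i show "continuous_on {0..} (\<lambda>t. U t \<omega> i)"
    proof (cases "i \<in> {1..N}")
      case True
      have "continuous_on {0..} (\<lambda>t. scheme.flow (X \<omega>) t i)"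
        using flow[OF \<omega>] True unfolding solves_def by (intro continuous_on_halfline) auto
      then show ?thesis using True by (simp add: U_def)
    qed (simp only: U_def restrict_apply if_False continuous_on_const)
  qed
  have lint: "(LINT s:{0..t}|lborel. drift N \<nu> Abar (u s) i) = integral {0..t} (\<lambda>s. drift N \<nu> Abar (u s) i)"
    if "\<And>i. i \<in> {1..N} \<Longrightarrow> continuous_on {0..t} (\<lambda>s. u s i)" "i \<in> {1..N}"
    for u :: "real \<Rightarrow> nat \<Rightarrow> real" and t i
    by (intro continuous_lborel_integral_eq drift_continuous_on[OF Abar_cont] that)
  have U_eq: "U t \<omega> i = X \<omega> t i + (LINT s:{0..t}|lborel. drift N \<nu> Abar (U s \<omega>) i)"
    if \<omega>: "\<omega> \<in> space M" and t: "0 \<le> t" and i: "i \<in> {1..N}" for \<omega> t i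
  proof -
    have "U t \<omega> i = X \<omega> t i + integral {0..t} (\<lambda>s. drift N \<nu> Abar (scheme.flow (X \<omega>) s) i)"
      using flow[OF \<omega> t] t i unfolding solves_def by (simp add: U_def)
    also have "(\<lambda>s. drift N \<nu> Abar (scheme.flow (X \<omega>) s) i) = (\<lambda>s. drift N \<nu> Abar (U s \<omega>) i)"
      by (intro ext drift_cong i) (simp_all add: U_def)
    also have "integral {0..t} \<dots> = (LINT s:{0..t}|lborel. drift N \<nu> Abar (U s \<omega>) i)"
      by (intro lint[symmetric] i continuous_on_subset[OF continuous_on_product_then_coordinatewise[OF U_cont[OF \<omega>]]])
        simp
    finally show ?thesis .
  qed
  have "strong_solution M F W g N \<nu> Abar U0 U"
    unfolding strong_solution_def
  proof (intro conjI allI impI)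
    show "U t \<in> F t \<rightarrow>\<^sub>M RN N" if "0 \<le> t" for t by (rule U_adapted[OF that])
    show "AE \<omega> in M. continuous_on {0..} (\<lambda>t. U t \<omega>)" using U_cont by (intro AE_I2)
    show "AE \<omega> in M. U 0 \<omega> = U0 \<omega>"
      using AE_good
    proof eventually_elim
      case (elim \<omega>)
      have "U 0 \<omega> i = U0 \<omega> i" if "i \<in> {1..N}" for i
        using U_eq[of \<omega> 0 i] continuous_lborel_integral_eq[of 0 0 "\<lambda>s. drift N \<nu> Abar (U s \<omega>) i"] elim that
        by (simp add: X_def Z_def noise good_def del: atLeastAtMost_iff)
      moreover have "U0 \<omega> \<in> extensional {1..N}" using assms(20)[of \<omega>] elim by (auto simp: RN0_def PiE_def)
      ultimately show ?case
        by (intro extensionalityI[of _ "{1..N}"]) (auto simp: U_def)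
    qed
    show "AE \<omega> in M. \<forall>t\<ge>0. \<forall>i\<in>{1..N}. U t \<omega> i =
        U0 \<omega> i + (LINT s:{0..t}|lborel. drift N \<nu> Abar (U s \<omega>) i) + noise N g W t \<omega> i"
      using AE_good
    proof eventually_elim
      case (elim \<omega>)
      then show ?case using U_eq[of \<omega>] by (simp add: X_def Z_def)
    qed
  qed
  moreover have "U t \<omega> \<in> RN0 N" if t: "0 \<le> t" and \<omega>: "\<omega> \<in> space M" for t \<omega>
  proof -
    \<comment> \<open>The cell averages of a function of mean zero sum up to zero, and so does the noise, term by term.\<close>
    have Z0: "(\<Sum>i=1..N. Z \<omega> t i) = 0"
    proof (cases "\<omega> \<in> bad")
      case False
      then have "good \<omega>" using bad(1) \<omega> by blast
      then have "(\<Sum>i=1..N. \<Sum>k. c i k * W (Suc k) t \<omega>) = (\<Sum>k. \<Sum>i=1..N. c i k * W (Suc k) t \<omega>)"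
        using t unfolding good_def by (intro suminf_sum[symmetric]) blast
      also have "\<dots> = (\<Sum>k. (\<Sum>i=1..N. c i k) * W (Suc k) t \<omega>)" by (simp add: sum_distrib_right)
      also have "\<dots> = 0"
      proof -
        have "(\<Sum>i=1..N. c i k) = 0" for k
          unfolding c_def using g[of "Suc k"] \<open>1 \<le> N\<close> by (intro sum_cell_avg) (auto simp: H20_torus_def)
        then show ?thesis by (simp del: One_nat_def)
      qed
      finally show ?thesis using False by (simp add: Z_def noise del: atLeastAtMost_iff One_nat_def)
    qed (simp add: Z_def)
    have "(\<Sum>i=1..N. U t \<omega> i) = (\<Sum>i=1..N. scheme.flow (X \<omega>) t i)" by (simp add: U_def)
    also have "\<dots> = (\<Sum>i=1..N. X \<omega> t i)"
      using t by (intro solves_sum[OF flow[OF \<omega> t] Abar_cont]) simp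
    also have "\<dots> = (\<Sum>i=1..N. U0 \<omega> i)" using Z0 by (simp add: X_def sum.distrib)
    also have "\<dots> = 0" using assms(20)[OF \<omega>] by (simp add: RN0_def)
    finally show ?thesis by (auto simp: RN0_def U_def)
  qed
  moreover have "AE \<omega> in M. \<forall>t\<ge>0. V t \<omega> = U t \<omega>" if V: "strong_solution M F W g N \<nu> Abar U0 V" for V
  proof -
    have V_meas: "\<And>t. 0 \<le> t \<Longrightarrow> V t \<in> F t \<rightarrow>\<^sub>M RN N"
      and V_cont: "AE \<omega> in M. continuous_on {0..} (\<lambda>t. V t \<omega>)"
      and V_eq: "AE \<omega> in M. \<forall>t\<ge>0. \<forall>i\<in>{1..N}. V t \<omega> i =
        U0 \<omega> i + (LINT s:{0..t}|lborel. drift N \<nu> Abar (V s \<omega>) i) + noise N g W t \<omega> i"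
      using V unfolding strong_solution_def by blast+
    show ?thesis using AE_good V_cont V_eq
    proof eventually_elim
      case (elim \<omega>)
      show ?case
      proof (intro allI impI)
        fix t :: real assume t: "0 \<le> t"
        have Vc: "continuous_on {0..r} (\<lambda>s. V s \<omega> i)" for i r
          by (rule continuous_on_subset[OF continuous_on_product_then_coordinatewise[OF elim(2)]]) simp
        have "solves N \<nu> Abar (X \<omega>) t (\<lambda>s. V s \<omega>)"
          unfolding solves_def
        proof (intro conjI ballI)
          fix i r assume "i \<in> {1..N}" "r \<in> {0..t}"
          then show "V r \<omega> i = X \<omega> r i + integral {0..r} (\<lambda>s. drift N \<nu> Abar (V s \<omega>) i)"
            using elim lint[of r "\<lambda>s. V s \<omega>" i] Vc by (simp add: X_def Z_def)
        qed (rule Vc)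
        then have "V t \<omega> i = U t \<omega> i" if "i \<in> {1..N}" for i
          using scheme.local_solution_unique[OF _ flow[of \<omega> t], of "\<lambda>s. V s \<omega>" t i] elim t that
          by (simp add: U_def)
        moreover have "V t \<omega> \<in> extensional {1..N}"
          using measurable_space[OF V_meas[OF t]] elim space_F[OF t] by (auto simp: space_PiM PiE_def)
        ultimately show "V t \<omega> = U t \<omega>"
          by (intro extensionalityI[of _ "{1..N}"]) (auto simp: U_def)
      qed
    qed
  qed
  ultimately show ?thesis by blast
qed

end
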